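(* Let $\mathbb{K}$ be an arbitrary field and let $n \geq p \geq r \geq 1$ be integers. Let $\mathcal{S}$ be an affine subspace of $\operatorname{M}_{n,p}(\mathbb{K})$ in which every matrix has rank at most $r$. Assume that $\dim \mathcal{S} > nr-(n-p+r)+1$. Then $\mathcal{S}$ is $r$-decomposable. More precisely: (a) either $\mathcal{S}$ is equivalent to a subspace of $\mathcal{R}(0,r)$; (b) or $n=p$ and $\mathcal{S}$ is equivalent to a subspace of $\mathcal{R}(r,0)$.
   Context: $\operatorname{M}_{n,p}(\mathbb{K})$ is the space of all $n\times p$ matrices with entries in $\mathbb{K}$. For $0\le s\le n$ and $0\le t\le p$, $\mathcal{R}(s,t)$ denotes the linear subspace of $\operatorname{M}_{n,p}(\mathbb{K})$ of all matrices of the form $\begin{bmatrix} A & C\\ B & 0\end{bmatrix}$ with $A\in \operatorname{M}_{s,t}(\mathbb{K})$, $B\in \operatorname{M}_{n-s,t}(\mathbb{K})$, $C\in \operatorname{M}_{s,p-t}(\mathbb{K})$ and zero block of size $(n-s)\times(p-t)$. Subsets $\mathcal{V},\mathcal{W}$ of $\operatorname{M}_{n,p}(\mathbb{K})$ are equivalent when $\mathcal{V}=P\mathcal{W}Q$ for some $P\in \operatorname{GL}_n(\mathbb{K})$, $Q\in \operatorname{GL}_p(\mathbb{K})$. For $r\le \min(n,p)$, a subset of $\operatorname{M}_{n,p}(\mathbb{K})$ is $r$-decomposable when it is included in a subspace equivalent to $\mathcal{R}(s,t)$ for some non-negative integers $s,t$ with $s+t=r$. "Subspace" in the conclusion means affine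 subspace (i.e. subset that is an affine subspace); the dimension of an affine subspace is the dimension of its translation vector space. *)

theory Defs
  imports "Jordan_Normal_Form.DL_Rank"
begin

abbreviation mat_subspace :: "nat \<Rightarrow> nat \<Rightarrow> 'a::field mat set \<Rightarrow> bool" where
  "mat_subspace n p W \<equiv> subspace class_ring W (module_mat TYPE('a) n p)"

abbreviation mat_subspace_dim :: "nat \<Rightarrow> nat \<Rightarrow> 'a::field mat set \<Rightarrow> nat" where
  "mat_subspace_dim n p W \<equiv>
     vectorspace.dim class_ring ((module_mat TYPE('a) n p)\<lparr>carrier := W\<rparr>)"

text \<open>Affine subspaces are translates of linear subspaces; in particular they are nonempty.\<close>

definition affine_subspace :: "nat \<Rightarrow> nat \<Rightarrow> 'a::field mat set \<Rightarrow> bool" where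
  "affine_subspace n p S \<longleftrightarrow>
     (\<exists>A \<in> carrier_mat n p. \<exists>W. mat_subspace n p W \<and> S = {A + M | M. M \<in> W})"

definition translation_space :: "'a::field mat set \<Rightarrow> 'a mat set" where
  "translation_space S = {A - B | A B. A \<in> S \<and> B \<in> S}"

definition affine_subspace_dim :: "nat \<Rightarrow> nat \<Rightarrow> 'a::field mat set \<Rightarrow> nat" where
  "affine_subspace_dim n p S = mat_subspace_dim n p (translation_space S)"

lemma translation_space_translate:
  fixes A :: "'a::field mat"
  assumes A: "A \<in> carrier_mat n p" and W: "mat_subspace n p W"
  shows "translation_space {A + M | M. M \<in> W} = W"
proof -
  interpret V: vectorspace "class_ring :: 'a ring" "module_mat TYPE('a) n p"
    by (rule matrix_vs)
  have sub: "submodule class_ring W (module_mat TYPE('a) n p)"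
    using W by (simp add: subspace_def)
  have car: "W \<subseteq> carrier_mat n p"
    using submodule.subset[OF sub] by (simp add: module_mat_simps)
  have add: "M + N \<in> W" if "M \<in> W" "N \<in> W" for M N
    using submodule.m_closed[OF sub that] by (simp add: module_mat_simps)
  have smult: "c \<cdot>\<^sub>m M \<in> W" if "M \<in> W" for c M
    using submodule.smult_closed[OF sub _ that, of c] by (simp add: module_mat_simps)
  have zero: "0\<^sub>m n p \<in> W"
    using submodule.zero_closed[OF sub] by (simp add: module_mat_simps)
  show ?thesis
  proof (intro equalityI subsetI)
    fix X assume "X \<in> translation_space {A + M | M. M \<in> W}"
    then obtain M N where MN: "M \<in> W" "N \<in> W" and X: "X = (A + M) - (A + N)"
      by (auto simp: translation_space_def)
    have "M \<in> carrier_mat n p" "N \<in> carrier_mat n p"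
      using MN car by auto
    then have "X = M + (- 1) \<cdot>\<^sub>m N"
      using A unfolding X by (intro eq_matI) auto
    then show "X \<in> W" using add smult MN by simp
  next
    fix M assume M: "M \<in> W"
    have "M \<in> carrier_mat n p"
      using M car by auto
    then have "M = (A + M) - (A + 0\<^sub>m n p)"
      using A by (intro eq_matI) auto
    then show "M \<in> translation_space {A + M | M. M \<in> W}"
      unfolding translation_space_def using M zero by blast
  qed
qed

definition compression_space :: "nat \<Rightarrow> nat \<Rightarrow> nat \<Rightarrow> nat \<Rightarrow> 'a::field mat set" where
  "compression_space n p s t =
     {four_block_mat A C B (0\<^sub>m (n - s) (p - t)) | A B C.
        A \<in> carrier_mat s t \<and> B \<in> carrier_mat (n - s) t \<and> C \<in> carrier_mat s (p - t)}"

definition GL :: "nat \<Rightarrow> 'a::field mat set" where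
  "GL n = {P \<in> carrier_mat n n. invertible_mat P}"

definition mat_equivalent :: "nat \<Rightarrow> nat \<Rightarrow> 'a::field mat set \<Rightarrow> 'a mat set \<Rightarrow> bool" where
  "mat_equivalent n p V W \<longleftrightarrow>
     V \<subseteq> carrier_mat n p \<and> W \<subseteq> carrier_mat n p \<and>
     (\<exists>P \<in> GL n. \<exists>Q \<in> GL p. V = {P * M * Q | M. M \<in> W})"

definition r_decomposable :: "nat \<Rightarrow> nat \<Rightarrow> nat \<Rightarrow> 'a::field mat set \<Rightarrow> bool" where
  "r_decomposable n p r S \<longleftrightarrow>
     (\<exists>s t U. s \<le> n \<and> t \<le> p \<and> s + t = r \<and> mat_subspace n p U \<and>
        mat_equivalent n p U (compression_space n p s t) \<and> S \<subseteq> U)"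

end

theory Submission
  imports Defs "HOL-Library.Function_Algebras"
begin

text \<open>
  All dimension counts are upper bounds of the form ``\<open>k\<close> linear equations cut \<open>V\<close> down to \<open>U\<close>'',
  where \<open>V\<close> is the translation space.  Choose bases such that some matrix of the affine space is the
  identity block of size \<open>r\<close> bordered by zeros, and write the directions as \<open>[A C; B D]\<close> accordingly.
  On the directions with \<open>A = 0\<close> one has \<open>D = B C\<close>, and \<open>B C' = 0\<close> if moreover \<open>C = 0\<close>; counting gives
  Flanders' bound \<open>n r\<close> for affine spaces over every field.

  For large spaces of square matrices let \<open>(A, C) = (0, 0)\<close> and \<open>B \<noteq> 0\<close> for some direction.  The minors
  of the whole space do not change along it, so deleting a column of \<open>A\<close> (in suitable coordinates) leaves
  an \<open>r\<close>-rowed matrix \<open>[A C]\<close> of rank less than \<open>r\<close>.  By induction on \<open>r\<close>, or by Flanders' bound applied to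
  the upper left blocks, the right blocks \<open>C\<close> and \<open>D\<close> vanish on the whole space.  If there is no such
  direction, then \<open>B\<close> and \<open>C\<close> play symmetric roles, and a polarization argument produces a
  direction with \<open>(A, B) = (0, 0)\<close> and \<open>C \<noteq> 0\<close>, to which the transposed argument applies.
  Rectangular matrices are reduced to square ones by deleting rows: either some row can be
  deleted at a small cost in dimension, or every row can be changed so freely that the right
  blocks vanish at once.
\<close>

section \<open>Determinants of bordered matrices\<close>

text \<open>The field may be finite: coefficients of polynomials in a parameter cannot be compared,
  a generic member cannot be chosen, and the linear span of the affine space may contain matrices of
  larger rank. What survives is the comparison of a minor at \<open>s\<close> and
  \<open>s + h\<close>. If \<open>h\<close> has, in suitable coordinates, a single nonzero entry
  among the rows and columns of the minor, the difference is that entry times a smaller minor. For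
  square matrices the threshold is \<open>(n - 1) * r + 1\<close>. Passing from \<open>A = 0\<close>
  to the zero direction costs \<open>(n - r) * r\<close>, so \<open>(r - 1) * r + 1\<close>
  equations cannot force \<open>A = 0\<close>. This is one more than Flanders' bound for singular
  \<open>r\<close> by \<open>r\<close> blocks, and the additional one pays for fixing the value of a
  linear form. The threshold cannot be lowered for \<open>n = p = 2\<close>, \<open>r = 1\<close>
  over the field with two elements: the matrices \<open>[a 0; b a + 1]\<close> form a plane of
  matrices of rank at most 1 without a common nonzero kernel vector on either side.\<close>

definition fdet :: "nat \<Rightarrow> (nat \<Rightarrow> nat \<Rightarrow> 'a::comm_ring_1) \<Rightarrow> 'a" where
  "fdet k X = det (mat k k (\<lambda>(a, b). X a b))"

lemma fdet_cong:
  assumes "\<And>a b. a < k \<Longrightarrow> b < k \<Longrightarrow> X a b = Y a b"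
  shows "fdet k X = fdet k Y"
  unfolding fdet_def by (rule arg_cong[of _ _ det], rule eq_matI) (use assms in auto)

lemma fdet_transpose: "fdet k (\<lambda>a b. X b a) = fdet k X"
proof -
  have "(mat k k (\<lambda>(a, b). X a b))\<^sup>T = mat k k (\<lambda>(a, b). X b a)"
    by (rule eq_matI) auto
  then show ?thesis
    unfolding fdet_def by (metis det_transpose mat_carrier)
qed

lemma fdet_mult: "fdet k (\<lambda>a b. \<Sum>c<k. X a c * Y c b) = fdet k X * fdet k Y"
proof -
  have "mat k k (\<lambda>(a, b). X a b) * mat k k (\<lambda>(a, b). Y a b)
      = mat k k (\<lambda>(a, b). \<Sum>c<k. X a c * Y c b)"
    by (rule eq_matI) (auto simp: scalar_prod_def lessThan_atLeast0)
  then show ?thesis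
    unfolding fdet_def by (metis det_mult mat_carrier)
qed

lemma fdet_diag: "fdet k (\<lambda>a b. if a = b then d a else 0) = (\<Prod>a<k. d a)"
proof -
  have "det (mat k k (\<lambda>(a, b). if a = b then d a else 0))
      = prod_list (diag_mat (mat k k (\<lambda>(a, b). if a = b then d a else 0)))"
    by (rule det_upper_triangular[of _ k]) (auto simp: upper_triangular_def)
  also have "\<dots> = (\<Prod>a<k. d a)"
    by (simp add: diag_mat_def prod.list_conv_set_nth lessThan_atLeast0)
  finally show ?thesis by (simp add: fdet_def)
qed

lemma fdet_eq_0_left_kernel:
  fixes X :: "nat \<Rightarrow> nat \<Rightarrow> 'a::field"
  assumes "fdet k X = 0"
  obtains v where "\<exists>i<k. v i \<noteq> 0" "\<And>j. j < k \<Longrightarrow> (\<Sum>i<k. v i * X i j) = 0"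
proof -
  let ?M = "mat k k (\<lambda>(a, b). X b a)"
  have "det ?M = 0"
    using trans[OF fdet_transpose assms] by (simp only: fdet_def)
  then obtain v where v: "v \<in> carrier_vec k" "v \<noteq> 0\<^sub>v k" "?M *\<^sub>v v = 0\<^sub>v k"
    using det_0_iff_vec_prod_zero_field[of ?M k] by auto
  show ?thesis
  proof (rule that[of "\<lambda>i. v $ i"])
    show "\<exists>i<k. v $ i \<noteq> 0"
      using v by (metis carrier_vecD eq_vecI index_zero_vec(1) index_zero_vec(2))
    fix j assume j: "j < k"
    have "(?M *\<^sub>v v) $ j = 0" using v j by simp
    then show "(\<Sum>i<k. v $ i * X i j) = 0"
      using j v(1) by (simp add: scalar_prod_def lessThan_atLeast0 mult.commute)
  qed
qed

lemma fdet_eq_0_right_kernel: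
  fixes X :: "nat \<Rightarrow> nat \<Rightarrow> 'a::field"
  assumes "fdet k X = 0"
  obtains v where "\<exists>j<k. v j \<noteq> 0" "\<And>i. i < k \<Longrightarrow> (\<Sum>j<k. X i j * v j) = 0"
proof -
  have "fdet k (\<lambda>a b. X b a) = 0" by (rule trans[OF fdet_transpose assms])
  from fdet_eq_0_left_kernel[OF this] obtain v where
    v: "\<exists>i<k. v i \<noteq> 0" "\<And>j. j < k \<Longrightarrow> (\<Sum>i<k. v i * X j i) = 0" by blast
  from v(2) have "\<And>i. i < k \<Longrightarrow> (\<Sum>j<k. X i j * v j) = 0"
    by (simp add: mult.commute)
  with v(1) show ?thesis by (rule that)
qed

lemma fdet_eq_0I_left:
  fixes X :: "nat \<Rightarrow> nat \<Rightarrow> 'a::field"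
  assumes "\<exists>i<k. v i \<noteq> 0" "\<And>j. j < k \<Longrightarrow> (\<Sum>i<k. v i * X i j) = 0"
  shows "fdet k X = 0"
proof -
  let ?M = "mat k k (\<lambda>(a, b). X b a)"
  have "?M *\<^sub>v vec k v = 0\<^sub>v k"
    by (rule eq_vecI) (use assms(2) in \<open>auto simp: scalar_prod_def lessThan_atLeast0 mult.commute\<close>)
  moreover have "vec k v \<noteq> 0\<^sub>v k" using assms(1) by (metis index_vec index_zero_vec(1))
  ultimately have "det ?M = 0"
    by (subst det_0_iff_vec_prod_zero_field[of _ k]) (auto intro!: exI[of _ "vec k v"])
  then have "fdet k (\<lambda>a b. X b a) = 0" by (simp only: fdet_def)
  then show ?thesis by (rule trans[OF fdet_transpose[symmetric]])
qed

lemma fdet_eq_0I_right: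
  fixes X :: "nat \<Rightarrow> nat \<Rightarrow> 'a::field"
  assumes "\<exists>j<k. v j \<noteq> 0" "\<And>i. i < k \<Longrightarrow> (\<Sum>j<k. X i j * v j) = 0"
  shows "fdet k X = 0"
proof -
  have "fdet k (\<lambda>a b. X b a) = 0"
    by (rule fdet_eq_0I_left[OF assms(1)]) (use assms(2) in \<open>simp add: mult.commute\<close>)
  then show ?thesis by (rule trans[OF fdet_transpose[symmetric]])
qed

lemma fdet_inverse:
  fixes X :: "nat \<Rightarrow> nat \<Rightarrow> 'a::field"
  assumes "fdet k X \<noteq> 0"
  obtains Y where "\<And>i j. i < k \<Longrightarrow> j < k \<Longrightarrow> (\<Sum>c<k. X i c * Y c j) = (if i = j then 1 else 0)"
proof -
  let ?M = "mat k k (\<lambda>(a, b). X a b)"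
  let ?Y = "\<lambda>c j. adj_mat ?M $$ (c, j) / det ?M"
  have d: "det ?M \<noteq> 0" using assms by (simp add: fdet_def)
  have c: "adj_mat ?M \<in> carrier_mat k k" and eq: "?M * adj_mat ?M = det ?M \<cdot>\<^sub>m 1\<^sub>m k"
    using adj_mat[of ?M k] by auto
  show ?thesis
  proof (rule that[of ?Y])
    fix i j assume ij: "i < k" "j < k"
    have "(?M * adj_mat ?M) $$ (i, j) = (\<Sum>c<k. X i c * adj_mat ?M $$ (c, j))"
      using ij c by (auto simp: scalar_prod_def lessThan_atLeast0)
    then have "(\<Sum>c<k. X i c * adj_mat ?M $$ (c, j)) = (if i = j then det ?M else 0)"
      unfolding eq using ij by auto
    moreover have "(\<Sum>c<k. X i c * ?Y c j) = (\<Sum>c<k. X i c * adj_mat ?M $$ (c, j)) / det ?M"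
      by (simp add: sum_divide_distrib)
    ultimately show "(\<Sum>c<k. X i c * ?Y c j) = (if i = j then 1 else 0)"
      using d by auto
  qed
qed

section \<open>Borders by one column and one row: expansion, Schur complement, rank one
  updates\<close>

definition border :: "nat \<Rightarrow> (nat \<Rightarrow> nat \<Rightarrow> 'a) \<Rightarrow> (nat \<Rightarrow> 'a) \<Rightarrow> (nat \<Rightarrow> 'a) \<Rightarrow> 'a
    \<Rightarrow> nat \<Rightarrow> nat \<Rightarrow> 'a" where
  "border k X c b d i j =
     (if i < k then if j < k then X i j else c i else if j < k then b j else d)"

text \<open>Laplace expansion along the last column. The cofactors \<open>K\<close> depend on
  \<open>X\<close> and \<open>b\<close> but on neither \<open>c\<close> nor \<open>d\<close>, whence
  additivity in the last column.\<close>

lemma fdet_border_column: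
  "\<exists>K. \<forall>c d. fdet (Suc k) (border k X c b d) = (\<Sum>i<k. c i * K i) + d * fdet k X"
proof -
  let ?M = "\<lambda>c d. mat (Suc k) (Suc k) (\<lambda>(i, j). border k X c b d i j)"
  define K where "K i = cofactor (?M (\<lambda>_. 0) 0) i k" for i
  have cof: "cofactor (?M c d) i k = K i" for c d i
    unfolding K_def cofactor_def mat_delete_def
    by (intro arg_cong2[of _ _ _ _ "(*)"] refl arg_cong[of _ _ det] eq_matI) (auto simp: border_def)
  have Kk: "K k = fdet k X"
    unfolding K_def cofactor_def mat_delete_def fdet_def
    by (auto simp: border_def intro!: arg_cong[of _ _ det] eq_matI)
  have "fdet (Suc k) (border k X c b d) = (\<Sum>i<k. c i * K i) + d * fdet k X" for c d
    unfolding fdet_def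
    by (subst laplace_expansion_column[of _ "Suc k" k])
       (auto simp: cof Kk[unfolded fdet_def] border_def intro!: sum.cong)
  then show ?thesis by blast
qed

lemma fdet_border_add_column:
  "fdet (Suc k) (border k X (\<lambda>i. c i + c' i) b (d + d'))
   = fdet (Suc k) (border k X c b d) + fdet (Suc k) (border k X c' b d')"
proof -
  obtain K where "\<And>c d. fdet (Suc k) (border k X c b d) = (\<Sum>i<k. c i * K i) + d * fdet k X"
    using fdet_border_column by blast
  then show ?thesis by (simp add: algebra_simps sum.distrib)
qed

lemma fdet_border_swap: "fdet (Suc k) (border k X c b d) = fdet (Suc k) (border k (\<lambda>i j. X j i) b c d)"
proof -
  have "fdet (Suc k) (border k (\<lambda>i j. X j i) b c d) = fdet (Suc k) (\<lambda>i j. border k X c b d j i)"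
    by (rule fdet_cong) (auto simp: border_def)
  also have "\<dots> = fdet (Suc k) (border k X c b d)" by (rule fdet_transpose)
  finally show ?thesis by (rule sym)
qed

lemma fdet_border_add_row:
  "fdet (Suc k) (border k X c (\<lambda>i. b i + b' i) (d + d'))
   = fdet (Suc k) (border k X c b d) + fdet (Suc k) (border k X c b' d')"
  by (simp only: fdet_border_swap[of k X c]) (rule fdet_border_add_column)

lemma fdet_border_zero_column: "fdet (Suc k) (border k X (\<lambda>_. 0) b d) = d * fdet k X"
proof -
  obtain K where "\<And>c d. fdet (Suc k) (border k X c b d) = (\<Sum>i<k. c i * K i) + d * fdet k X"
    using fdet_border_column by blast
  then show ?thesis by simp
qed

lemma fdet_border_zero_row: "fdet (Suc k) (border k X c (\<lambda>_. 0) d) = d * fdet k X"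
  by (rule trans[OF fdet_border_swap], rule trans[OF fdet_border_zero_column])
     (rule arg_cong[of _ _ "(*) d"], rule fdet_transpose)

text \<open>The slope in the corner is the inner minor; this turns the vanishing of two bordered
  minors into the vanishing of a smaller one.\<close>

lemma fdet_border_corner:
  "fdet (Suc k) (border k X c b (d + e)) = fdet (Suc k) (border k X c b d) + e * fdet k X"
  using fdet_border_add_column[of k X c "\<lambda>_. 0" b d e] by (simp add: fdet_border_zero_column)

text \<open>A left kernel vector of the singular bordered matrix has a nonzero last coordinate,
  since \<open>X\<close> is invertible. Pairing it with \<open>X z = c\<close> isolates
  \<open>d\<close>; \<open>z\<close> stands for the inverse of \<open>X\<close> applied to
  \<open>c\<close>.\<close>

lemma schur_complement_zero:
  fixes X :: "nat \<Rightarrow> nat \<Rightarrow> 'a::field"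
  assumes "fdet (Suc k) (border k X c b d) = 0" "fdet k X \<noteq> 0"
    and z: "\<And>i. i < k \<Longrightarrow> (\<Sum>j<k. X i j * z j) = c i"
  shows "d = (\<Sum>j<k. b j * z j)"
proof -
  obtain v where nz: "\<exists>i<Suc k. v i \<noteq> 0"
    and v: "\<And>j. j < Suc k \<Longrightarrow> (\<Sum>i<Suc k. v i * border k X c b d i j) = 0"
    using fdet_eq_0_left_kernel[OF assms(1)] by blast
  have v1: "(\<Sum>i<k. v i * X i j) + v k * b j = 0" if "j < k" for j
    using v[of j] that by (simp add: border_def)
  have v1': "(\<Sum>i<k. v i * X i j) = - (v k * b j)" if "j < k" for j
    using v1[OF that] by (simp only: eq_neg_iff_add_eq_0)
  have v2: "(\<Sum>i<k. v i * c i) + v k * d = 0"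
    using v[of k] by (simp add: border_def)
  have vk: "v k \<noteq> 0"
  proof
    assume 0: "v k = 0"
    then have "\<exists>i<k. v i \<noteq> 0" using nz less_Suc_eq by auto
    then have "fdet k X = 0"
      by (rule fdet_eq_0I_left) (use v1 0 in auto)
    then show False using assms(2) by simp
  qed
  have "(\<Sum>i<k. v i * c i) = (\<Sum>i<k. \<Sum>j<k. v i * X i j * z j)"
    by (intro sum.cong refl) (auto simp: z[symmetric] sum_distrib_left mult.assoc)
  also have "\<dots> = (\<Sum>j<k. (\<Sum>i<k. v i * X i j) * z j)"
    by (subst sum.swap) (simp add: sum_distrib_right)
  also have "\<dots> = (\<Sum>j<k. - (v k * b j) * z j)"
    by (intro sum.cong refl) (simp only: v1' lessThan_iff)
  also have "\<dots> = - v k * (\<Sum>j<k. b j * z j)"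
    by (simp add: sum_distrib_left mult.assoc sum_negf)
  finally have "v k * (d - (\<Sum>j<k. b j * z j)) = 0" using v2 by (simp add: algebra_simps)
  then show ?thesis using vk by simp
qed

lemma fdet_solve:
  fixes X :: "nat \<Rightarrow> nat \<Rightarrow> 'a::field"
  assumes "fdet k X \<noteq> 0"
  obtains z where "\<And>i. i < k \<Longrightarrow> (\<Sum>j<k. X i j * z j) = c i"
proof -
  obtain Y where Y: "\<And>i j. i < k \<Longrightarrow> j < k \<Longrightarrow> (\<Sum>c<k. X i c * Y c j) = (if i = j then 1 else 0)"
    using fdet_inverse[OF assms] by blast
  show ?thesis
  proof (rule that[of "\<lambda>j. \<Sum>l<k. Y j l * c l"])
    fix i assume i: "i < k"
    have "(\<Sum>j<k. X i j * (\<Sum>l<k. Y j l * c l)) = (\<Sum>l<k. (\<Sum>j<k. X i j * Y j l) * c l)"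
      by (simp add: sum_distrib_left sum_distrib_right mult.assoc, subst sum.swap, simp)
    also have "\<dots> = (\<Sum>l<k. (if i = l then c l else 0))"
      using i by (intro sum.cong refl) (auto simp: Y)
    also have "\<dots> = c i" using i by (subst sum.delta') auto
    finally show "(\<Sum>j<k. X i j * (\<Sum>l<k. Y j l * c l)) = c i" .
  qed
qed

lemma fdet_factor_through_smaller:
  fixes X :: "nat \<Rightarrow> nat \<Rightarrow> 'a::field"
  assumes "s < k"
  shows "fdet k (\<lambda>a b. \<Sum>c<s. X a c * Y c b) = 0"
proof -
  define X' where "X' a c = (if c < s then X a c else 0)" for a c
  have "fdet k (\<lambda>a b. \<Sum>c<s. X a c * Y c b) = fdet k (\<lambda>a b. \<Sum>c<k. X' a c * Y c b)"
  proof (rule fdet_cong)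
    fix a b
    have "(\<Sum>c<k. X' a c * Y c b) = (\<Sum>c<s. X' a c * Y c b)"
      by (rule sum.mono_neutral_right) (use assms in \<open>auto simp: X'_def\<close>)
    then show "(\<Sum>c<s. X a c * Y c b) = (\<Sum>c<k. X' a c * Y c b)"
      by (simp add: X'_def)
  qed
  moreover have "fdet k X' = 0"
    by (rule fdet_eq_0I_right[where v = "\<lambda>j. if j = s then 1 else 0"])
       (use assms in \<open>auto simp: X'_def\<close>)
  ultimately show ?thesis by (simp add: fdet_mult)
qed

text \<open>The matrix determinant lemma without division: \<open>[X + p q, p; 0, -1]\<close> times
  \<open>[1, 0; -q, 1]\<close> is \<open>[X, p; q, -1]\<close>, and then the corner is moved from
  \<open>-1\<close> to \<open>0\<close>.\<close>

lemma fdet_border_rank_one_update: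
  "fdet (Suc k) (border k X p q 0) = fdet k X - fdet k (\<lambda>i j. X i j + p i * q j)"
proof -
  let ?L = "border k (\<lambda>i j. X i j + p i * q j) p (\<lambda>_. 0) (- 1)"
  have R: "fdet (Suc k) (border k (\<lambda>i j. if i = j then 1 else 0) (\<lambda>_. 0) (\<lambda>j. - q j) (1::'a)) = 1"
    by (simp add: fdet_border_zero_column fdet_diag)
  have "fdet (Suc k) (\<lambda>i j. \<Sum>c<Suc k. ?L i c *
      border k (\<lambda>i j. if i = j then 1 else 0) (\<lambda>_. 0) (\<lambda>j. - q j) 1 c j)
    = fdet (Suc k) (border k X p q (0 + - 1))"
  proof (rule fdet_cong)
    fix a b assume ab: "a < Suc k" "b < Suc k"
    have *: "(\<Sum>c<k. f c * (if c = b then 1 else 0)) = (if b < k then f b else (0::'a))" for f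
      by (simp add: if_distrib[of "\<lambda>x. _ * x"] sum.delta cong: if_cong)
    show "(\<Sum>c<Suc k. ?L a c *
        border k (\<lambda>i j. if i = j then 1 else 0) (\<lambda>_. 0) (\<lambda>j. - q j) 1 c b)
      = border k X p q (0 + - 1) a b"
      using ab by (cases "a < k"; cases "b < k") (auto simp: border_def * split: if_splits)
  qed
  then have "fdet (Suc k) (border k X p q (0 + - 1)) = fdet (Suc k) ?L"
    by (simp only: fdet_mult R) simp
  also have "\<dots> = - fdet k (\<lambda>i j. X i j + p i * q j)"
    by (simp add: fdet_border_zero_row)
  finally show ?thesis by (simp only: fdet_border_corner) (simp add: algebra_simps)
qed

section \<open>Rank bounds and normal forms\<close>

definition bil :: "nat set \<Rightarrow> nat set \<Rightarrow> (nat \<Rightarrow> nat \<Rightarrow> 'a::comm_ring_1) \<Rightarrow> (nat \<Rightarrow> 'a) \<Rightarrow> (nat \<Rightarrow> 'a) \<Rightarrow> 'a"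
  where "bil I J M w u = (\<Sum>i\<in>I. \<Sum>j\<in>J. w i * M i j * u j)"

text \<open>A coordinate-free way to say that the rank is less than \<open>k\<close>: the minors are taken with
  respect to arbitrary vectors instead of rows and columns, so that invariance under
  equivalence is immediate.\<close>

definition rank_less :: "nat set \<Rightarrow> nat set \<Rightarrow> nat \<Rightarrow> (nat \<Rightarrow> nat \<Rightarrow> 'a::comm_ring_1) \<Rightarrow> bool" where
  "rank_less I J k M \<longleftrightarrow> (\<forall>w u. fdet k (\<lambda>a b. bil I J M (w a) (u b)) = 0)"

definition unit :: "nat \<Rightarrow> nat \<Rightarrow> 'a::comm_ring_1" where
  "unit i = (\<lambda>j. if j = i then 1 else 0)"

lemma bil_transpose: "bil J I (\<lambda>i j. M j i) u w = bil I J M w u"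
  unfolding bil_def by (subst sum.swap) (simp add: ac_simps)

lemma rank_less_transpose:
  assumes "rank_less I J k M"
  shows "rank_less J I k (\<lambda>i j. M j i)"
  unfolding rank_less_def
proof (intro allI)
  fix w u
  have "fdet k (\<lambda>a b. bil J I (\<lambda>i j. M j i) (w a) (u b)) = fdet k (\<lambda>a b. bil I J M (u b) (w a))"
    by (rule fdet_cong) (rule bil_transpose)
  also have "\<dots> = fdet k (\<lambda>a b. bil I J M (u a) (w b))"
    by (rule fdet_transpose)
  also have "\<dots> = 0" using assms by (simp add: rank_less_def)
  finally show "fdet k (\<lambda>a b. bil J I (\<lambda>i j. M j i) (w a) (u b)) = 0" .
qed

lemma sum_unit_left:
  assumes "finite I" "i \<in> I"
  shows "(\<Sum>a\<in>I. unit i a * f a) = f i"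
  using assms by (simp add: unit_def if_distrib[of "\<lambda>x. x * _"] sum.delta cong: if_cong)

lemma sum_unit_right:
  assumes "finite I" "i \<in> I"
  shows "(\<Sum>a\<in>I. f a * unit i a) = f i"
  using sum_unit_left[OF assms] by (simp add: mult.commute)

lemma bil_unit_left:
  assumes "finite I" "i \<in> I"
  shows "bil I J M (unit i) u = (\<Sum>j\<in>J. M i j * u j)"
proof -
  have "bil I J M (unit i) u = (\<Sum>a\<in>I. unit i a * (\<Sum>j\<in>J. M a j * u j))"
    by (simp add: bil_def sum_distrib_left mult.assoc)
  then show ?thesis by (simp add: sum_unit_left[OF assms])
qed

lemma bil_unit_right:
  assumes "finite J" "j \<in> J"
  shows "bil I J M w (unit j) = (\<Sum>i\<in>I. w i * M i j)"
  unfolding bil_def by (simp add: sum_unit_right[OF assms])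

lemma bil_unit:
  assumes "finite I" "finite J" "i \<in> I" "j \<in> J"
  shows "bil I J M (unit i) (unit j) = M i j"
  by (simp add: bil_unit_left[OF assms(1,3)] sum_unit_right[OF assms(2,4)])

lemma bil_sum_left:
  "bil I J M (\<lambda>i. \<Sum>a\<in>A. c a * w a i) u = (\<Sum>a\<in>A. c a * bil I J M (w a) u)"
proof -
  have "bil I J M (\<lambda>i. \<Sum>a\<in>A. c a * w a i) u
      = (\<Sum>i\<in>I. \<Sum>j\<in>J. \<Sum>a\<in>A. c a * (w a i * M i j * u j))"
    by (simp add: bil_def sum_distrib_right mult.assoc)
  also have "\<dots> = (\<Sum>i\<in>I. \<Sum>a\<in>A. \<Sum>j\<in>J. c a * (w a i * M i j * u j))"
    by (intro sum.cong refl sum.swap)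
  also have "\<dots> = (\<Sum>a\<in>A. \<Sum>i\<in>I. \<Sum>j\<in>J. c a * (w a i * M i j * u j))"
    by (rule sum.swap)
  finally show ?thesis by (simp add: bil_def sum_distrib_left)
qed

lemma bil_sum_right:
  "bil I J M w (\<lambda>j. \<Sum>b\<in>B. c b * u b j) = (\<Sum>b\<in>B. c b * bil I J M w (u b))"
  by (rule trans[OF bil_transpose[symmetric]], rule trans[OF bil_sum_left],
      rule sum.cong[OF refl], rule arg_cong[of _ _ "(*) _"], rule bil_transpose)

lemma bil_cong:
  assumes "\<And>i. i \<in> I \<Longrightarrow> w i = w' i" "\<And>j. j \<in> J \<Longrightarrow> u j = u' j"
    "\<And>i j. i \<in> I \<Longrightarrow> j \<in> J \<Longrightarrow> M i j = M' i j"
  shows "bil I J M w u = bil I J M' w' u'"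
  unfolding bil_def by (intro sum.cong refl) (simp add: assms)

lemma bil_change_basis:
  assumes "\<And>i j. i \<in> I' \<Longrightarrow> j \<in> J' \<Longrightarrow> M' i j = bil I J M (P i) (Q j)"
  shows "bil I' J' M' w u = bil I J M (\<lambda>a. \<Sum>i\<in>I'. w i * P i a) (\<lambda>b. \<Sum>j\<in>J'. u j * Q j b)"
  unfolding bil_sum_left unfolding bil_sum_right unfolding bil_def[of I']
  by (intro sum.cong refl) (auto simp: assms sum_distrib_left ac_simps)

text \<open>The vectors \<open>P i\<close> and \<open>Q j\<close> are arbitrary, so this one
  statement covers submatrices, row and column operations and changes of basis.\<close>

lemma rank_less_change_basis:
  assumes "rank_less I J k M"
    and "\<And>i j. i \<in> I' \<Longrightarrow> j \<in> J' \<Longrightarrow> M' i j = bil I J M (P i) (Q j)"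
  shows "rank_less I' J' k M'"
  using assms(1) unfolding rank_less_def by (simp add: bil_change_basis[OF assms(2)])

lemma rank_less_subset:
  assumes "rank_less I J k M" "I' \<subseteq> I" "J' \<subseteq> J" "finite I" "finite J"
  shows "rank_less I' J' k M"
  by (rule rank_less_change_basis[OF assms(1), of _ _ _ unit unit])
     (use assms in \<open>auto intro!: bil_unit[symmetric]\<close>)

lemma rank_less_minor:
  assumes "rank_less I J k M" "finite I" "finite J"
    "\<And>a. a < k \<Longrightarrow> \<rho> a \<in> I" "\<And>b. b < k \<Longrightarrow> \<sigma> b \<in> J"
  shows "fdet k (\<lambda>a b. M (\<rho> a) (\<sigma> b)) = 0"
proof -
  have "fdet k (\<lambda>a b. M (\<rho> a) (\<sigma> b)) = fdet k (\<lambda>a b. bil I J M (unit (\<rho> a)) (unit (\<sigma> b)))"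
    by (rule fdet_cong) (use assms in \<open>simp add: bil_unit\<close>)
  then show ?thesis using assms(1) unfolding rank_less_def by simp
qed

lemma rank_less_square:
  fixes M :: "nat \<Rightarrow> nat \<Rightarrow> 'a::field"
  assumes "fdet k M = 0"
  shows "rank_less {..<k} {..<k} k M"
  unfolding rank_less_def
proof (intro allI)
  fix w u :: "nat \<Rightarrow> nat \<Rightarrow> 'a"
  have "fdet k (\<lambda>a b. bil {..<k} {..<k} M (w a) (u b))
      = fdet k (\<lambda>a b. \<Sum>i<k. w a i * (\<Sum>j<k. M i j * (\<lambda>j b. u b j) j b))"
    by (rule fdet_cong) (simp add: bil_def sum_distrib_left mult.assoc)
  also have "\<dots> = fdet k w * (fdet k M * fdet k (\<lambda>j b. u b j))"
    unfolding fdet_mult ..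
  finally show "fdet k (\<lambda>a b. bil {..<k} {..<k} M (w a) (u b)) = 0" using assms by simp
qed

lemma rank_less_Suc_0:
  assumes "rank_less I J (Suc 0) M" "finite I" "finite J" "i \<in> I" "j \<in> J"
  shows "M i j = 0"
  using rank_less_minor[OF assms(1-3), of "\<lambda>_. i" "\<lambda>_. j"] assms(4,5)
  by (simp add: fdet_def det_single)

lemma rank_less_bordered:
  assumes "rank_less I J (Suc k) M"
  shows "fdet (Suc k) (border k (\<lambda>a b. bil I J M (w a) (u b)) (\<lambda>a. bil I J M (w a) u')
      (\<lambda>b. bil I J M w' (u b)) (bil I J M w' u')) = 0"
proof -
  have "fdet (Suc k) (border k (\<lambda>a b. bil I J M (w a) (u b)) (\<lambda>a. bil I J M (w a) u')
      (\<lambda>b. bil I J M w' (u b)) (bil I J M w' u'))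
    = fdet (Suc k) (\<lambda>a b. bil I J M (if a < k then w a else w') (if b < k then u b else u'))"
    by (rule fdet_cong) (auto simp: border_def)
  then show ?thesis using assms
    unfolding rank_less_def by simp
qed

text \<open>The two bordered minors differ by the single nonzero entry of \<open>N\<close> times the inner minor.\<close>

lemma rank_less_extraction:
  fixes M N :: "nat \<Rightarrow> nat \<Rightarrow> 'a::field"
  assumes M: "rank_less I J (Suc k) M" and MN: "rank_less I J (Suc k) (\<lambda>i j. M i j + N i j)"
    and nz: "bil I J N w' u' \<noteq> 0"
    and row: "\<And>j. j \<in> J' \<Longrightarrow> bil I J N w' (Q j) = 0"
    and col: "\<And>i. i \<in> I' \<Longrightarrow> bil I J N (P i) u' = 0"
    and inner: "\<And>i j. i \<in> I' \<Longrightarrow> j \<in> J' \<Longrightarrow> bil I J N (P i) (Q j) = 0"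
    and M': "\<And>i j. i \<in> I' \<Longrightarrow> j \<in> J' \<Longrightarrow> M' i j = bil I J M (P i) (Q j)"
  shows "rank_less I' J' k M'"
  unfolding rank_less_def
proof (intro allI)
  fix w u :: "nat \<Rightarrow> nat \<Rightarrow> 'a"
  define w1 where "w1 a i = (\<Sum>l\<in>I'. w a l * P l i)" for a i
  define u1 where "u1 b j = (\<Sum>l\<in>J'. u b l * Q l j)" for b j
  have add: "bil I J (\<lambda>i j. M i j + N i j) x y = bil I J M x y + bil I J N x y" for x y
    by (simp add: bil_def algebra_simps sum.distrib)
  have r: "bil I J N w' (u1 b) = 0" for b
    unfolding u1_def bil_sum_right by (simp add: row)
  have c: "bil I J N (w1 a) u' = 0" for a
    unfolding w1_def bil_sum_left by (simp add: col)
  have i: "bil I J N (w1 a) (u1 b) = 0" for a b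
    unfolding w1_def u1_def bil_sum_left bil_sum_right by (simp add: inner)
  let ?X = "\<lambda>a b. bil I J M (w1 a) (u1 b)"
  let ?B = "border k ?X (\<lambda>a. bil I J M (w1 a) u') (\<lambda>b. bil I J M w' (u1 b))"
  have "fdet (Suc k) (?B (bil I J M w' u')) = 0"
    by (rule rank_less_bordered[OF M])
  moreover have "fdet (Suc k) (?B (bil I J M w' u' + bil I J N w' u')) = 0"
    using rank_less_bordered[OF MN, of w1 u1 u' w'] by (simp add: add r c i)
  ultimately have "fdet k ?X = 0"
    using nz by (simp add: fdet_border_corner)
  moreover have "fdet k (\<lambda>a b. bil I' J' M' (w a) (u b)) = fdet k ?X"
    unfolding w1_def u1_def by (rule fdet_cong) (rule bil_change_basis[OF M'])
  ultimately show "fdet k (\<lambda>a b. bil I' J' M' (w a) (u b)) = 0" by simp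
qed

text \<open>Every \<open>P i\<close> pairs to zero with \<open>u'\<close> while \<open>w'\<close>
  does not, so the last column of the bordered minor is zero except for its corner, and the corner
  splits off.\<close>

lemma rank_less_kernel_column:
  fixes M :: "nat \<Rightarrow> nat \<Rightarrow> 'a::field"
  assumes M: "rank_less I J (Suc k) M" and nz: "bil I J M w' u' \<noteq> 0"
    and col: "\<And>i. i \<in> I' \<Longrightarrow> bil I J M (P i) u' = 0"
    and M': "\<And>i j. i \<in> I' \<Longrightarrow> j \<in> J' \<Longrightarrow> M' i j = bil I J M (P i) (Q j)"
  shows "rank_less I' J' k M'"
  unfolding rank_less_def
proof (intro allI)
  fix w u :: "nat \<Rightarrow> nat \<Rightarrow> 'a"
  define w1 where "w1 a i = (\<Sum>l\<in>I'. w a l * P l i)" for a i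
  define u1 where "u1 b j = (\<Sum>l\<in>J'. u b l * Q l j)" for b j
  have c: "bil I J M (w1 a) u' = 0" for a
    unfolding w1_def bil_sum_left by (simp add: col)
  have "fdet k (\<lambda>a b. bil I J M (w1 a) (u1 b)) = 0"
    using rank_less_bordered[OF M, of w1 u1 u' w'] nz by (simp add: c fdet_border_zero_column)
  moreover have "fdet k (\<lambda>a b. bil I' J' M' (w a) (u b)) = fdet k (\<lambda>a b. bil I J M (w1 a) (u1 b))"
    unfolding w1_def u1_def by (rule fdet_cong) (rule bil_change_basis[OF M'])
  ultimately show "fdet k (\<lambda>a b. bil I' J' M' (w a) (u b)) = 0" by simp
qed

section \<open>Pivot coordinates and the normal form of a matrix of given rank\<close>

text \<open>\<open>I\<close> is a smallest set of coordinates that still detects vanishing on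
  \<open>R\<close>. Dropping \<open>i\<close> from it admits a member of \<open>X\<close> that
  vanishes on the rest of \<open>I\<close> but not at \<open>i\<close>; scaled, these members are
  dual to the coordinates in \<open>I\<close>.\<close>

lemma pivot_coordinates:
  fixes X :: "(nat \<Rightarrow> 'a::field) set"
  assumes fin: "finite R"
    and zero: "(\<lambda>_. 0) \<in> X"
    and add: "\<And>x y. x \<in> X \<Longrightarrow> y \<in> X \<Longrightarrow> (\<lambda>i. x i + y i) \<in> X"
    and scale: "\<And>c x. x \<in> X \<Longrightarrow> (\<lambda>i. c * x i) \<in> X"
  obtains I where "I \<subseteq> R"
    "\<And>x i. x \<in> X \<Longrightarrow> (\<And>i. i \<in> I \<Longrightarrow> x i = 0) \<Longrightarrow> i \<in> R \<Longrightarrow> x i = 0"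
    "\<And>g. \<exists>x\<in>X. \<forall>i\<in>I. x i = g i"
proof -
  define inj where "inj I \<longleftrightarrow> I \<subseteq> R \<and> (\<forall>x\<in>X. (\<forall>i\<in>I. x i = 0) \<longrightarrow> (\<forall>i\<in>R. x i = 0))" for I
  have "inj R" by (simp add: inj_def)
  then obtain I where I: "inj I" and min: "\<And>I'. inj I' \<Longrightarrow> card I \<le> card I'"
    using ex_has_least_nat[of inj R card] by blast
  have IR: "I \<subseteq> R" using I by (simp add: inj_def)
  then have fI: "finite I" using fin finite_subset by blast
  have "\<exists>x\<in>X. \<forall>j\<in>I. x j = (if j = i then 1 else 0)" if i: "i \<in> I" for i
  proof -
    have "\<not> inj (I - {i})"
      using min[of "I - {i}"] card_Diff1_less[OF fI i] by linarith
    then obtain x where x: "x \<in> X" "\<forall>j\<in>I - {i}. x j = 0" "\<exists>j\<in>R. x j \<noteq> 0"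
      using IR by (auto simp: inj_def)
    then have "x i \<noteq> 0" using I unfolding inj_def by blast
    then have "\<forall>j\<in>I. inverse (x i) * x j = (if j = i then 1 else 0)" using x(2) by auto
    then show ?thesis
      using scale[OF x(1), of "inverse (x i)"] by (intro bexI[of _ "\<lambda>j. inverse (x i) * x j"])
  qed
  then obtain e where e: "\<And>i. i \<in> I \<Longrightarrow> e i \<in> X"
    "\<And>i j. i \<in> I \<Longrightarrow> j \<in> I \<Longrightarrow> e i j = (if j = i then 1 else 0)"
    by metis
  have "\<exists>x\<in>X. \<forall>i\<in>I. x i = g i" for g
  proof -
    have "(\<lambda>j. \<Sum>i\<in>A. g i * e i j) \<in> X" if "finite A" "A \<subseteq> I" for A
      using that
    proof (induction A rule: finite_induct)
      case empty
      then show ?case using zero by simp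
    next
      case (insert a A)
      then show ?case using add[OF scale[OF e(1)[of a], of "g a"]] by simp
    qed
    from this[OF fI subset_refl] have "(\<lambda>j. \<Sum>i\<in>I. g i * e i j) \<in> X" .
    moreover have "(\<Sum>i\<in>I. g i * e i j) = g j" if "j \<in> I" for j
    proof -
      have "(\<Sum>i\<in>I. g i * e i j) = (\<Sum>i\<in>I. if j = i then g i else 0)"
        by (intro sum.cong refl) (use e that in auto)
      then show ?thesis using fI that by simp
    qed
    ultimately show ?thesis by (intro bexI[of _ "\<lambda>j. \<Sum>i\<in>I. g i * e i j"]) auto
  qed
  then show ?thesis using that[of I] I unfolding inj_def by blast
qed

text \<open>Steinitz exchange that keeps the vectors from position \<open>r\<close> on in the common
  kernel of the forms \<open>f k\<close>. They become the rows and columns in which the normalized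
  matrix is zero.\<close>

lemma biorthogonal_basis_extension:
  fixes w f :: "nat \<Rightarrow> nat \<Rightarrow> 'a::field"
  assumes fin: "finite I"
    and bi: "\<And>k l. k < r \<Longrightarrow> l < r \<Longrightarrow> (\<Sum>i\<in>I. f k i * w l i) = (if k = l then 1 else 0)"
  shows "r \<le> card I \<and> (\<exists>p. (\<forall>a<r. p a = w a)
    \<and> (\<forall>a k. r \<le> a \<longrightarrow> k < r \<longrightarrow> (\<Sum>i\<in>I. f k i * p a i) = 0)
    \<and> (\<forall>x. \<exists>c. \<forall>i\<in>I. x i = (\<Sum>a<card I. c a * p a i)))"
  using bi
proof (induction r)
  case 0
  obtain e where e: "bij_betw e {..<card I} I"
    using ex_bij_betw_nat_finite[OF fin] by (metis lessThan_atLeast0)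
  have "\<exists>c. \<forall>i\<in>I. x i = (\<Sum>a<card I. c a * unit (e a) i)" for x :: "nat \<Rightarrow> 'a"
  proof -
    have "(\<Sum>a<card I. x (e a) * unit (e a) i) = x i" if "i \<in> I" for i
    proof -
      have "(\<Sum>a<card I. x (e a) * unit (e a) i) = (\<Sum>j\<in>I. x j * unit j i)"
        by (rule sum.reindex_bij_betw[OF e])
      also have "\<dots> = x i" using that fin
        by (simp add: unit_def if_distrib[of "\<lambda>x. _ * x"] cong: if_cong)
      finally show ?thesis .
    qed
    then show ?thesis by metis
  qed
  then show ?case by (auto intro!: exI[of _ "\<lambda>a. unit (e a)"])
next
  case (Suc r)
  let ?n = "card I"
  let ?f = "\<lambda>k x. \<Sum>i\<in>I. f k i * x i"
  have IH: "r \<le> ?n \<and> (\<exists>p. (\<forall>a<r. p a = w a)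
    \<and> (\<forall>a k. r \<le> a \<longrightarrow> k < r \<longrightarrow> ?f k (p a) = 0)
    \<and> (\<forall>x. \<exists>c. \<forall>i\<in>I. x i = (\<Sum>a<?n. c a * p a i)))"
    by (rule Suc.IH) (use Suc.prems in auto)
  then obtain p where rn: "r \<le> ?n" and p1: "\<And>a. a < r \<Longrightarrow> p a = w a"
    and p2: "\<And>a k. r \<le> a \<Longrightarrow> k < r \<Longrightarrow> ?f k (p a) = 0"
    and p3: "\<And>x. \<exists>c. \<forall>i\<in>I. x i = (\<Sum>a<?n. c a * p a i)" by blast
  have fsum: "?f k (\<lambda>i. \<Sum>a\<in>A. c a * q a i) = (\<Sum>a\<in>A. c a * ?f k (q a))" for k c A and q :: "nat \<Rightarrow> nat \<Rightarrow> 'a"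
    by (simp add: sum_distrib_left ac_simps) (rule sum.swap)
  obtain d where d: "\<And>i. i \<in> I \<Longrightarrow> w r i = (\<Sum>a<?n. d a * p a i)"
    using p3[of "w r"] by blast
  have fw: "?f k (w r) = (\<Sum>a<?n. d a * ?f k (p a))" for k
    unfolding fsum[symmetric] by (intro sum.cong refl) (simp add: d)
  have d0: "d k = 0" if "k < r" for k
  proof -
    have "(\<Sum>a<?n. d a * ?f k (p a)) = (\<Sum>a<?n. if k = a then d a else 0)"
    proof (intro sum.cong refl)
      fix a assume "a \<in> {..<?n}"
      show "d a * ?f k (p a) = (if k = a then d a else 0)"
        using p2[of a k] p1[of a] Suc.prems[of k a] that by (cases "a < r") auto
    qed
    also have "\<dots> = d k" using that rn by simp
    finally show ?thesis using fw[of k] Suc.prems[of k r] that by simp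
  qed
  have "\<exists>a\<in>{..<?n}. r \<le> a \<and> d a \<noteq> 0"
  proof (rule ccontr)
    assume "\<not> ?thesis"
    then have "\<And>a. a \<in> {..<?n} \<Longrightarrow> d a = 0" using d0 by (meson not_le)
    then have "?f r (w r) = 0" unfolding fw by simp
    then show False using Suc.prems[of r r] by simp
  qed
  then obtain m where m: "m < ?n" "r \<le> m" "d m \<noteq> 0" by blast
  \<comment> \<open>Position \<open>m\<close> is vacated by the exchange and receives the old vector
    \<open>p r\<close>, because position \<open>r\<close> now belongs to \<open>w r\<close>.\<close>
  define t where "t a = (if a = m then r else a)" for a
  define q where "q a = (if a < r then w a else if a = r then w r
      else (\<lambda>i. p (t a) i - ?f r (p (t a)) * w r i))" for a
  have fw_lt: "?f k (w r) = (if k = r then 1 else 0)" if "k < Suc r" for k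
    using Suc.prems[of k r] that by simp
  have q2: "?f k (q a) = 0" if "Suc r \<le> a" "k < Suc r" for a k
  proof -
    have "r \<le> t a" using that m by (auto simp: t_def)
    define s where "s = ?f r (p (t a))"
    have "?f k (q a) = (\<Sum>i\<in>I. f k i * p (t a) i - s * (f k i * w r i))"
      using that by (intro sum.cong refl) (simp add: q_def s_def[symmetric] algebra_simps)
    then have "?f k (q a) = ?f k (p (t a)) - ?f r (p (t a)) * ?f k (w r)"
      by (simp only: sum_subtractf sum_distrib_left[symmetric] s_def)
    then show ?thesis using p2[OF \<open>r \<le> t a\<close>, of k] fw_lt[OF that(2)] that(2)
      by (cases "k = r") auto
  qed
  define S where "S = {x. \<exists>c. \<forall>i\<in>I. x i = (\<Sum>a<?n. c a * q a i)}"
  have Sadd: "(\<lambda>i. x i + y i) \<in> S" if "x \<in> S" "y \<in> S" for x y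
  proof -
    obtain c c' where "\<forall>i\<in>I. x i = (\<Sum>a<?n. c a * q a i)" "\<forall>i\<in>I. y i = (\<Sum>a<?n. c' a * q a i)"
      using \<open>x \<in> S\<close> \<open>y \<in> S\<close> unfolding S_def by blast
    then have "\<forall>i\<in>I. x i + y i = (\<Sum>a<?n. (c a + c' a) * q a i)"
      by (simp add: algebra_simps sum.distrib)
    then show ?thesis unfolding S_def by (intro CollectI exI[of _ "\<lambda>a. c a + c' a"])
  qed
  have Sscale: "(\<lambda>i. e * x i) \<in> S" if "x \<in> S" for e x
  proof -
    obtain c where "\<forall>i\<in>I. x i = (\<Sum>a<?n. c a * q a i)"
      using \<open>x \<in> S\<close> unfolding S_def by blast
    then have "\<forall>i\<in>I. e * x i = (\<Sum>a<?n. (e * c a) * q a i)"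
      by (simp add: sum_distrib_left mult.assoc)
    then show ?thesis unfolding S_def by (intro CollectI exI[of _ "\<lambda>a. e * c a"])
  qed
  have Sq: "q a \<in> S" if "a < ?n" for a
    unfolding S_def
    by (intro CollectI exI[of _ "unit a"]) (use that in \<open>auto simp: sum_unit_left\<close>)
  have S0: "(\<lambda>i. 0) \<in> S"
    unfolding S_def by (intro CollectI exI[of _ "\<lambda>_. 0"]) simp
  have Ssum: "(\<lambda>i. \<Sum>a\<in>A. c a * y a i) \<in> S" if "finite A" "\<And>a. a \<in> A \<Longrightarrow> y a \<in> S" for A :: "nat set" and c y
    using that
  proof (induction A rule: finite_induct)
    case empty
    then show ?case using S0 by simp
  next
    case (insert a A)
    then show ?case using Sadd[OF Sscale[of "y a" "c a"]] by simp
  qed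
  have Scong: "x \<in> S" if "y \<in> S" "\<And>i. i \<in> I \<Longrightarrow> x i = y i" for x y
    using that unfolding S_def by auto
  have rn': "r < ?n" using m by simp
  have Sw: "w r \<in> S" using Sq[OF rn'] by (simp add: q_def)
  have Sp: "p a \<in> S" if a: "a < ?n" "a \<noteq> m" for a
  proof (cases "a < r")
    case True
    then show ?thesis using Sq[of a] p1[of a] a by (simp add: q_def)
  next
    case False
    define b where "b = (if a = r then m else a)"
    have b: "b < ?n" "\<not> b < r" "b \<noteq> r" "t b = a" using a m False rn' by (auto simp: b_def t_def)
    have "q b \<in> S" by (rule Sq[OF b(1)])
    from Sadd[OF this Sscale[OF Sw, of "?f r (p a)"]] show ?thesis
      using b by (simp add: q_def)
  qed
  have Spm: "p m \<in> S"
  proof -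
    have "(\<lambda>i. inverse (d m) * (w r i + (- 1) * (\<Sum>a\<in>{..<?n} - {m}. d a * p a i))) \<in> S"
      by (intro Sscale Sadd Sw Sscale[of _ "- 1"] Ssum) (use Sp in auto)
    then show ?thesis
    proof (rule Scong)
      fix i assume "i \<in> I"
      have "w r i = d m * p m i + (\<Sum>a\<in>{..<?n} - {m}. d a * p a i)"
        using d[OF \<open>i \<in> I\<close>] m by (simp add: sum.remove[of _ m])
      then show "p m i = inverse (d m) * (w r i + (- 1) * (\<Sum>a\<in>{..<?n} - {m}. d a * p a i))"
        using m by simp
    qed
  qed
  have q3: "x \<in> S" for x
  proof -
    obtain c where c: "\<And>i. i \<in> I \<Longrightarrow> x i = (\<Sum>a<?n. c a * p a i)" using p3[of x] by blast
    have "(\<lambda>i. \<Sum>a<?n. c a * p a i) \<in> S"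
      by (rule Ssum) (use Sp Spm in auto)
    then show ?thesis by (rule Scong) (rule c)
  qed
  show ?case
  proof (intro conjI exI[of _ q] allI impI)
    show "Suc r \<le> ?n" using rn' by simp
    show "q a = w a" if "a < Suc r" for a
      using that by (auto simp: q_def less_Suc_eq)
    show "?f k (q a) = 0" if "Suc r \<le> a" "k < Suc r" for a k
      using q2 that by blast
    show "\<exists>c. \<forall>i\<in>I. x i = (\<Sum>a<?n. c a * q a i)" for x
      using q3[of x] unfolding S_def by blast
  qed
qed

text \<open>The last two conclusions say that \<open>P\<close> and \<open>Q\<close>, restricted to the first \<open>card I\<close> and \<open>card J\<close>
  indices, are bases.\<close>

lemma rank_normal_form:
  fixes M :: "nat \<Rightarrow> nat \<Rightarrow> 'a::field"
  assumes fin: "finite I" "finite J"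
    and le: "rank_less I J (Suc r) M" and ge: "\<not> rank_less I J r M"
  obtains P Q where "r \<le> card I" "r \<le> card J"
    "\<And>a b. bil I J M (P a) (Q b) = (if a = b \<and> a < r then 1 else 0)"
    "\<And>x. \<exists>c. \<forall>i\<in>I. x i = (\<Sum>a<card I. c a * P a i)"
    "\<And>x. \<exists>c. \<forall>j\<in>J. x j = (\<Sum>b<card J. c b * Q b j)"
proof -
  obtain w u0 where "fdet r (\<lambda>a b. bil I J M (w a) (u0 b)) \<noteq> 0"
    using ge unfolding rank_less_def by blast
  from fdet_inverse[OF this] obtain Y where
    Y: "\<And>i j. i < r \<Longrightarrow> j < r \<Longrightarrow> (\<Sum>c<r. bil I J M (w i) (u0 c) * Y c j) = (if i = j then 1 else 0)"
    by blast
  \<comment> \<open>Correcting \<open>u0\<close> by the inverse Gram matrix makes the pairing with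
    \<open>w\<close> the identity.\<close>
  define u where "u b = (\<lambda>j. \<Sum>c<r. Y c b * u0 c j)" for b
  have gram: "bil I J M (w a) (u b) = (if a = b then 1 else 0)" if "a < r" "b < r" for a b
    unfolding u_def bil_sum_right using Y[OF that] by (simp add: mult.commute)
  have fdet1: "fdet r (\<lambda>a b. bil I J M (w a) (u b)) = 1"
    using fdet_cong[of r "\<lambda>a b. bil I J M (w a) (u b)" "\<lambda>a b. if a = b then 1 else 0"] gram
    by (simp add: fdet_diag)
  \<comment> \<open>The rank is at most \<open>r\<close>, so the Schur complement of the identity
    Gram block vanishes: the whole form factors through the pairs \<open>u k\<close>,
    \<open>w k\<close>.\<close>
  have factor: "bil I J M x y = (\<Sum>k<r. bil I J M x (u k) * bil I J M (w k) y)" for x y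
  proof (rule schur_complement_zero[OF rank_less_bordered[OF le]])
    show "fdet r (\<lambda>a b. bil I J M (w a) (u b)) \<noteq> 0" using fdet1 by simp
    fix i assume "i < r"
    then have "(\<Sum>j<r. bil I J M (w i) (u j) * bil I J M (w j) y)
        = (\<Sum>j<r. if i = j then bil I J M (w j) y else 0)"
      by (intro sum.cong refl) (auto simp: gram)
    then show "(\<Sum>j<r. bil I J M (w i) (u j) * bil I J M (w j) y) = bil I J M (w i) y"
      using \<open>i < r\<close> by simp
  qed
  define f where "f k i = (\<Sum>j\<in>J. M i j * u k j)" for k i
  define g where "g k j = (\<Sum>i\<in>I. w k i * M i j)" for k j
  have f: "(\<Sum>i\<in>I. f k i * x i) = bil I J M x (u k)" for k x
    by (simp add: f_def bil_def sum_distrib_left sum_distrib_right ac_simps)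
  have g: "(\<Sum>j\<in>J. g k j * y j) = bil I J M (w k) y" for k y
    unfolding bil_def g_def sum_distrib_right by (rule sum.swap)
  have "r \<le> card I \<and> (\<exists>p. (\<forall>a<r. p a = w a)
    \<and> (\<forall>a k. r \<le> a \<longrightarrow> k < r \<longrightarrow> (\<Sum>i\<in>I. f k i * p a i) = 0)
    \<and> (\<forall>x. \<exists>c. \<forall>i\<in>I. x i = (\<Sum>a<card I. c a * p a i)))"
    by (rule biorthogonal_basis_extension[OF fin(1)]) (use f gram in auto)
  then obtain P where P: "r \<le> card I" "\<And>a. a < r \<Longrightarrow> P a = w a"
    "\<And>a k. r \<le> a \<Longrightarrow> k < r \<Longrightarrow> bil I J M (P a) (u k) = 0"
    "\<And>x. \<exists>c. \<forall>i\<in>I. x i = (\<Sum>a<card I. c a * P a i)"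
    unfolding f by blast
  have "r \<le> card J \<and> (\<exists>p. (\<forall>a<r. p a = u a)
    \<and> (\<forall>a k. r \<le> a \<longrightarrow> k < r \<longrightarrow> (\<Sum>j\<in>J. g k j * p a j) = 0)
    \<and> (\<forall>x. \<exists>c. \<forall>j\<in>J. x j = (\<Sum>a<card J. c a * p a j)))"
    by (rule biorthogonal_basis_extension[OF fin(2)]) (use g gram in auto)
  then obtain Q where Q: "r \<le> card J" "\<And>a. a < r \<Longrightarrow> Q a = u a"
    "\<And>a k. r \<le> a \<Longrightarrow> k < r \<Longrightarrow> bil I J M (w k) (Q a) = 0"
    "\<And>x. \<exists>c. \<forall>j\<in>J. x j = (\<Sum>b<card J. c b * Q b j)"
    unfolding g by blast
  have left: "bil I J M (P a) (u k) = (if a = k then 1 else 0)" if "k < r" for a k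
    using P(2)[of a] P(3)[of a k] gram[of a k] that by (cases "a < r") auto
  have right: "bil I J M (w k) (Q b) = (if k = b then 1 else 0)" if "k < r" for b k
    using Q(2)[of b] Q(3)[of b k] gram[of k b] that by (cases "b < r") auto
  have "bil I J M (P a) (Q b) = (if a = b \<and> a < r then 1 else 0)" for a b
  proof -
    have "bil I J M (P a) (Q b) = (\<Sum>k<r. if a = k then (if a = b then 1 else 0) else 0)"
      by (rule trans[OF factor], intro sum.cong refl) (auto simp: left right)
    then show ?thesis by auto
  qed
  then show ?thesis using that P Q by blast
qed

section \<open>Families of matrices depending on linear parameters\<close>

text \<open>Parameters are kept apart from matrices: elimination and restriction to blocks change
  the family \<open>F\<close>, while \<open>S\<close> and \<open>V\<close> stay fixed and all
  equation counts refer to the same space.\<close>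

locale parameter_space = vector_space scale
  for scale :: "'a::field \<Rightarrow> 'b::ab_group_add \<Rightarrow> 'b" (infixr \<open>*s\<close> 75)
begin

definition linear_form :: "('b \<Rightarrow> 'a) \<Rightarrow> bool" where
  "linear_form f \<longleftrightarrow> (\<forall>x y. f (x + y) = f x + f y) \<and> (\<forall>c x. f (c *s x) = c * f x)"

text \<open>Dimension counts take the form of statements that \<open>k\<close> linear equations cut \<open>V\<close> down to a
  subset of \<open>U\<close>.\<close>

definition codim_le :: "'b set \<Rightarrow> 'b set \<Rightarrow> nat \<Rightarrow> bool" where
  "codim_le V U k \<longleftrightarrow> (\<exists>fs. length fs \<le> k \<and> (\<forall>f\<in>set fs. linear_form f) \<and>
     {v \<in> V. \<forall>f\<in>set fs. f v = 0} \<subseteq> U)"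

definition affine_on :: "'b set \<Rightarrow> 'b set \<Rightarrow> bool" where
  "affine_on S V \<longleftrightarrow> subspace V \<and> S \<noteq> {} \<and> (\<forall>s\<in>S. \<forall>v\<in>V. s + v \<in> S) \<and> (\<forall>s\<in>S. \<forall>t\<in>S. s - t \<in> V)"

definition linear_family :: "('b \<Rightarrow> nat \<Rightarrow> nat \<Rightarrow> 'a) \<Rightarrow> bool" where
  "linear_family F \<longleftrightarrow> (\<forall>i j. linear_form (\<lambda>v. F v i j))"

definition null_space :: "nat set \<Rightarrow> nat set \<Rightarrow> 'b set \<Rightarrow> ('b \<Rightarrow> nat \<Rightarrow> nat \<Rightarrow> 'a) \<Rightarrow> 'b set" where
  "null_space I J V F = {v \<in> V. \<forall>i\<in>I. \<forall>j\<in>J. F v i j = 0}"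

text \<open>Equivalence to a subset of \<open>\<R>(0,r)\<close>: the common kernel of \<open>r\<close> linear forms is contained in
  the kernel of every matrix.\<close>

definition kernel_form :: "nat set \<Rightarrow> nat set \<Rightarrow> nat \<Rightarrow> 'b set \<Rightarrow> ('b \<Rightarrow> nat \<Rightarrow> nat \<Rightarrow> 'a) \<Rightarrow> bool" where
  "kernel_form I J r S F \<longleftrightarrow> (\<exists>\<phi>. \<forall>z. (\<forall>l<r. (\<Sum>j\<in>J. \<phi> l j * z j) = (0::'a)) \<longrightarrow>
     (\<forall>s\<in>S. \<forall>i\<in>I. (\<Sum>j\<in>J. F s i j * z j) = 0))"

lemma linear_form_add: "linear_form f \<Longrightarrow> f (x + y) = f x + f y"
  and linear_form_scale: "linear_form f \<Longrightarrow> f (c *s x) = c * f x"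
  by (auto simp: linear_form_def)

lemma linear_form_zero: "linear_form f \<Longrightarrow> f 0 = 0"
  using linear_form_scale[of f 0 0] by simp

lemma linear_form_minus: "linear_form f \<Longrightarrow> f (- x) = - f x"
  using linear_form_scale[of f "- 1" x] by simp

lemma linear_form_diff: "linear_form f \<Longrightarrow> f (x - y) = f x - f y"
  using linear_form_add[of f x "- y"] by (simp add: linear_form_minus)

lemma linear_form_sum: "linear_form f \<Longrightarrow> f (\<Sum>a\<in>A. g a) = (\<Sum>a\<in>A. f (g a))"
  by (induction A rule: infinite_finite_induct) (auto simp: linear_form_zero linear_form_add)

lemma linear_form_sum_fun:
  assumes "\<And>a. a \<in> A \<Longrightarrow> linear_form (f a)"
  shows "linear_form (\<lambda>v. \<Sum>a\<in>A. f a v)"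
  using assms by (simp add: linear_form_def sum.distrib sum_distrib_left cong: sum.cong)

lemma linear_form_mult: "linear_form f \<Longrightarrow> linear_form (\<lambda>v. c * f v)"
  by (auto simp: linear_form_def algebra_simps)

lemma linear_form_diff_fun: "linear_form f \<Longrightarrow> linear_form g \<Longrightarrow> linear_form (\<lambda>v. f v - g v)"
  by (auto simp: linear_form_def algebra_simps)

lemma linear_form_bil:
  assumes "linear_family F"
  shows "linear_form (\<lambda>v. bil I J (F v) w u)"
  unfolding bil_def
  by (intro linear_form_sum_fun)
     (use assms in \<open>auto simp: linear_family_def linear_form_def algebra_simps\<close>)

lemma linear_family_bil:
  "linear_family F \<Longrightarrow> linear_family (\<lambda>v a b. bil I J (F v) (P a) (Q b))"
  using linear_form_bil by (simp add: linear_family_def)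

lemma linear_family_transpose: "linear_family F \<Longrightarrow> linear_family (\<lambda>v i j. F v j i)"
  by (simp add: linear_family_def)

lemma codim_le_family:
  assumes "finite A" "\<And>a. a \<in> A \<Longrightarrow> linear_form (f a)"
    and "\<And>v. v \<in> V \<Longrightarrow> (\<And>a. a \<in> A \<Longrightarrow> f a v = 0) \<Longrightarrow> v \<in> U"
  shows "codim_le V U (card A)"
proof -
  obtain xs where xs: "set xs = A" "distinct xs" using finite_distinct_list[OF assms(1)] by blast
  then have "length xs = card A" by (metis distinct_card)
  then show ?thesis unfolding codim_le_def
    by (intro exI[of _ "map f xs"]) (use assms xs in auto)
qed

lemma codim_le_trans:
  assumes "codim_le V U k" "codim_le U W l"
  shows "codim_le V W (k + l)"
proof -
  obtain fs gs where "length fs \<le> k" "\<forall>f\<in>set fs. linear_form f" "{v \<in> V. \<forall>f\<in>set fs. f v = 0} \<subseteq> U"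
    "length gs \<le> l" "\<forall>f\<in>set gs. linear_form f" "{v \<in> U. \<forall>f\<in>set gs. f v = 0} \<subseteq> W"
    using assms unfolding codim_le_def by blast
  then show ?thesis unfolding codim_le_def
    by (intro exI[of _ "fs @ gs"] conjI subsetI) (simp, auto simp: subset_iff)
qed

lemma codim_le_mono:
  assumes "codim_le V U k" "V' \<subseteq> V" "U \<subseteq> U'" "k \<le> l"
  shows "codim_le V' U' l"
proof -
  obtain fs where "length fs \<le> k" "\<forall>f\<in>set fs. linear_form f" "{v \<in> V. \<forall>f\<in>set fs. f v = 0} \<subseteq> U"
    using assms(1) unfolding codim_le_def by blast
  then show ?thesis using assms(2-4) unfolding codim_le_def by (intro exI[of _ fs]) auto
qed

lemma codim_le_hyperplane: "linear_form f \<Longrightarrow> codim_le V {v \<in> V. f v = 0} 1"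
  using codim_le_family[of "{()}" "\<lambda>_. f" V] by auto

lemma affine_on_hyperplane:
  assumes "affine_on S V" "linear_form f" "s \<in> S"
  shows "affine_on {t \<in> S. f t = f s} {v \<in> V. f v = 0}"
  using assms unfolding affine_on_def subspace_def
  by (auto simp: linear_form_add linear_form_diff linear_form_zero linear_form_scale)

lemma kernel_formE:
  assumes "kernel_form I J r S F"
  obtains \<phi> where "\<forall>z. (\<forall>l<r. (\<Sum>j\<in>J. \<phi> l j * z j) = 0) \<longrightarrow>
    (\<forall>s\<in>S. \<forall>i\<in>I. (\<Sum>j\<in>J. F s i j * z j) = 0)"
  using assms unfolding kernel_form_def by (elim exE)

text \<open>The image of \<open>V\<close> in the space of \<open>r\<close>-tuples is detected by its
  pivot coordinates. Fewer than \<open>r\<close> pivots would give at most \<open>r - 1\<close>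
  equations leading into \<open>U\<close>; hence all coordinates are pivots and the map is
  onto.\<close>

lemma codim_le_row_space:
  assumes V: "subspace V" and F: "\<And>k. k < r \<Longrightarrow> linear_form (\<lambda>v. f v k)"
    and U: "\<And>v. v \<in> V \<Longrightarrow> (\<And>k. k < r \<Longrightarrow> f v k = 0) \<Longrightarrow> v \<in> U"
    and ncd: "\<not> codim_le V U (r - 1)" and r: "0 < r"
  shows "\<exists>v\<in>V. \<forall>k<r. f v k = g k"
proof -
  define X where "X = {x. \<exists>v\<in>V. \<forall>k<r. x k = f v k}"
  have z: "(\<lambda>_. 0) \<in> X"
    unfolding X_def using V linear_form_zero[OF F] by (auto simp: subspace_def intro!: bexI[of _ 0])
  have a: "(\<lambda>i. x i + y i) \<in> X" if xy: "x \<in> X" "y \<in> X" for x y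
  proof -
    obtain v w where "v \<in> V" "w \<in> V" "\<forall>k<r. x k = f v k" "\<forall>k<r. y k = f w k"
      using xy unfolding X_def by blast
    then show ?thesis using V F linear_form_add[OF F]
      unfolding X_def subspace_def by (intro CollectI bexI[of _ "v + w"]) auto
  qed
  have s: "(\<lambda>i. c * x i) \<in> X" if x: "x \<in> X" for c x
  proof -
    obtain v where "v \<in> V" "\<forall>k<r. x k = f v k"
      using x unfolding X_def by blast
    then show ?thesis using V linear_form_scale[OF F]
      unfolding X_def subspace_def by (intro CollectI bexI[of _ "c *s v"]) auto
  qed
  obtain I where I: "I \<subseteq> {..<r}"
    "\<And>x i. x \<in> X \<Longrightarrow> (\<And>i. i \<in> I \<Longrightarrow> x i = 0) \<Longrightarrow> i \<in> {..<r} \<Longrightarrow> x i = 0"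
    "\<And>g. \<exists>x\<in>X. \<forall>i\<in>I. x i = g i"
    using pivot_coordinates[OF finite_lessThan z a s, of r] by blast
  have fI: "finite I" using I(1) finite_subset by blast
  have cd: "codim_le V U (card I)"
  proof (rule codim_le_family[OF fI, of "\<lambda>k v. f v k"])
    show "linear_form (\<lambda>v. f v k)" if "k \<in> I" for k using F I(1) that by auto
    fix v assume v: "v \<in> V" "\<And>k. k \<in> I \<Longrightarrow> f v k = 0"
    have "f v \<in> X" unfolding X_def using v by blast
    then have "\<And>k. k < r \<Longrightarrow> f v k = 0" using I(2)[of "f v"] v by auto
    then show "v \<in> U" using U v by blast
  qed
  have "I = {..<r}"
  proof (rule ccontr)
    assume "I \<noteq> {..<r}"
    then have "card I < r" using psubset_card_mono[of "{..<r}" I] I(1) by auto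
    then show False using ncd codim_le_mono[OF cd] by auto
  qed
  then obtain x where "x \<in> X" "\<And>k. k < r \<Longrightarrow> x k = g k" using I(3)[of g] by auto
  then obtain v where "v \<in> V" "\<forall>k<r. x k = f v k" unfolding X_def by blast
  then show ?thesis using \<open>\<And>k. k < r \<Longrightarrow> x k = g k\<close> by (intro bexI[of _ v]) auto
qed

end

section \<open>Block relations in a family normalized at one matrix\<close>

locale normal_family = parameter_space scale
  for scale :: "'a::field \<Rightarrow> 'b::ab_group_add \<Rightarrow> 'b" (infixr \<open>*s\<close> 75) +
  fixes S V :: "'b set" and F :: "'b \<Rightarrow> nat \<Rightarrow> nat \<Rightarrow> 'a" and n p r :: nat and s0 :: 'b
  assumes affine: "affine_on S V" and linear: "linear_family F"
    and rank: "\<And>s. s \<in> S \<Longrightarrow> rank_less {..<n} {..<p} (Suc r) (F s)"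
    and s0: "s0 \<in> S"
    and base: "\<And>i j. i < n \<Longrightarrow> j < p \<Longrightarrow> F s0 i j = (if i = j \<and> i < r then 1 else 0)"
    and r_le: "r \<le> n" "r \<le> p"
begin

abbreviation "N \<equiv> null_space {..<n} {..<p} V F"

text \<open>In the block form \<open>[A C; B D]\<close> with \<open>A\<close> of size \<open>r \<times> r\<close>, \<open>VA\<close> is defined by \<open>A = 0\<close> and
  \<open>VB\<close> by \<open>A = 0\<close> and \<open>C = 0\<close>.\<close>

definition "VA = {v \<in> V. \<forall>i<r. \<forall>k<r. F v i k = 0}"
definition "VB = {v \<in> VA. \<forall>i<r. \<forall>j. r \<le> j \<and> j < p \<longrightarrow> F v i j = 0}"

lemma entry: "linear_form (\<lambda>v. F v i j)"
  using linear by (simp add: linear_family_def)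

lemma F_add: "F (v + w) i j = F v i j + F w i j"
  using linear_form_add[OF entry] .

lemma F_diff: "F (v - w) i j = F v i j - F w i j"
  using linear_form_diff[OF entry] .

lemma F_scale: "F (c *s v) i j = c * F v i j"
  using linear_form_scale[OF entry] .

lemma F_0: "F 0 i j = 0"
  using linear_form_zero[OF entry] .

lemma subspace_V: "subspace V" and S_add: "s \<in> S \<Longrightarrow> v \<in> V \<Longrightarrow> s + v \<in> S"
  and S_diff: "s \<in> S \<Longrightarrow> t \<in> S \<Longrightarrow> s - t \<in> V"
  using affine by (auto simp: affine_on_def)

lemma VA_sub: "VA \<subseteq> V" and VB_sub: "VB \<subseteq> VA"
  by (auto simp: VA_def VB_def)

lemma subspace_VA: "subspace VA"
  using subspace_V unfolding subspace_def VA_def by (auto simp: F_add F_scale F_0)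

lemma bordered_minor:
  assumes "s \<in> S" "i < n" "j < p"
  shows "fdet (Suc r) (border r (F s) (\<lambda>a. F s a j) (\<lambda>b. F s i b) (F s i j)) = 0"
proof -
  have "fdet (Suc r) (border r (F s) (\<lambda>a. F s a j) (\<lambda>b. F s i b) (F s i j))
      = fdet (Suc r) (\<lambda>a b. F s (if a < r then a else i) (if b < r then b else j))"
    by (rule fdet_cong) (auto simp: border_def)
  also have "\<dots> = 0"
    by (rule rank_less_minor[OF rank[OF assms(1)]]) (use assms r_le in auto)
  finally show ?thesis .
qed

lemma schur:
  assumes "s \<in> S" "i < n" "j < p" "fdet r (F s) \<noteq> 0"
    "\<And>a. a < r \<Longrightarrow> (\<Sum>b<r. F s a b * z b) = F s a j"
  shows "F s i j = (\<Sum>b<r. F s i b * z b)"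
  by (rule schur_complement_zero[OF bordered_minor[OF assms(1-3)] assms(4,5)])

text \<open>At \<open>s0 + v\<close> the upper left block is the identity and the other blocks are
  those of \<open>v\<close>, so the vanishing of the Schur complement reads
  \<open>D = B C\<close>.\<close>

lemma block_D:
  assumes v: "v \<in> VA" and ij: "r \<le> i" "i < n" "r \<le> j" "j < p"
  shows "F v i j = (\<Sum>k<r. F v i k * F v k j)"
proof -
  have A: "F (s0 + v) a b = (if a = b then 1 else 0)" if "a < r" "b < r" for a b
    using v that r_le by (simp add: F_add VA_def base)
  have B: "F (s0 + v) i b = F v i b" if "b < p" for b
    using that ij by (simp add: F_add base)
  have C: "F (s0 + v) a j = F v a j" if "a < n" for a
    using that ij by (simp add: F_add base)
  have "F (s0 + v) i j = (\<Sum>b<r. F (s0 + v) i b * F v b j)"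
  proof (rule schur)
    show "s0 + v \<in> S" using v VA_sub s0 S_add by blast
    have "fdet r (F (s0 + v)) = fdet r (\<lambda>a b. if a = b then 1 else 0)"
      by (rule fdet_cong) (rule A)
    then show "fdet r (F (s0 + v)) \<noteq> 0" by (simp add: fdet_diag)
    fix a assume a: "a < r"
    have "(\<Sum>b<r. F (s0 + v) a b * F v b j) = (\<Sum>b<r. if a = b then F v b j else 0)"
      by (intro sum.cong refl) (use A a in auto)
    then show "(\<Sum>b<r. F (s0 + v) a b * F v b j) = F (s0 + v) a j"
      using a r_le C by simp
  qed (use ij in auto)
  then show ?thesis using B ij r_le by simp
qed

lemma VB_D:
  assumes "h \<in> VB" "r \<le> j" "j < p" "i < n"
  shows "F h i j = 0"
proof (cases "i < r")
  case True
  then show ?thesis using assms by (simp add: VB_def)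
next
  case False
  then show ?thesis using assms block_D[of h i j] by (simp add: VB_def)
qed

text \<open>The relation \<open>D = B C\<close> is compared at \<open>v\<close> and at
  \<open>h + v\<close>: adding \<open>h\<close> changes \<open>B\<close> but neither
  \<open>C\<close> nor \<open>D\<close>.\<close>

lemma block_BC:
  assumes h: "h \<in> VB" and v: "v \<in> VA" and ij: "r \<le> i" "i < n" "r \<le> j" "j < p"
  shows "(\<Sum>k<r. F h i k * F v k j) = 0"
proof -
  have hA: "h \<in> VA" using h VB_sub by blast
  have "h + v \<in> VA" using hA v subspace_VA by (simp add: subspace_add)
  from block_D[OF this ij] have "F v i j = (\<Sum>k<r. (F h i k + F v i k) * F v k j)"
    using h ij by (simp add: F_add VB_D[OF h] VB_def)
  then show ?thesis using block_D[OF v ij] by (simp add: algebra_simps sum.distrib)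
qed

lemma codim_VA: "codim_le V VA (r * r)"
  using codim_le_family[of "{..<r} \<times> {..<r}" "\<lambda>(i, k) v. F v i k" V VA] entry
  by (auto simp: VA_def split: prod.splits)

lemma null_spaceI:
  assumes "v \<in> VB" "\<And>i k. r \<le> i \<Longrightarrow> i < n \<Longrightarrow> k < r \<Longrightarrow> F v i k = 0"
  shows "v \<in> N"
proof -
  have "F v i j = 0" if "i < n" "j < p" for i j
  proof (cases "j < r")
    case True
    then show ?thesis using assms that VB_sub by (cases "i < r") (auto simp: VA_def)
  next
    case False
    then show ?thesis using VB_D assms that by simp
  qed
  then show ?thesis using assms(1) by (auto simp: null_space_def VB_def VA_def)
qed

text \<open>The pivot coordinates of the annihilator of the lower left blocks of \<open>VB\<close> control the upper
  right blocks of \<open>VA\<close>, the other coordinates control the lower left blocks.\<close>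

lemma codim_VA_null: "codim_le VA N ((max n p - r) * r)"
proof -
  define X where "X = {x. \<forall>h\<in>VB. \<forall>i. r \<le> i \<longrightarrow> i < n \<longrightarrow> (\<Sum>k<r. F h i k * x k) = 0}"
  have z: "(\<lambda>_. 0) \<in> X" unfolding X_def by simp
  have a: "(\<lambda>i. x i + y i) \<in> X" if xy: "x \<in> X" "y \<in> X" for x y
    using xy unfolding X_def by (simp add: algebra_simps sum.distrib)
  have s: "(\<lambda>i. c * x i) \<in> X" if x: "x \<in> X" for c x
  proof -
    have "(\<Sum>k<r. F h i k * (c * x k)) = c * (\<Sum>k<r. F h i k * x k)" for h i
      by (simp add: sum_distrib_left ac_simps)
    then show ?thesis using x unfolding X_def by simp
  qed
  obtain I where I: "I \<subseteq> {..<r}"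
    "\<And>x i. x \<in> X \<Longrightarrow> (\<And>i. i \<in> I \<Longrightarrow> x i = 0) \<Longrightarrow> i \<in> {..<r} \<Longrightarrow> x i = 0"
    "\<And>g. \<exists>x\<in>X. \<forall>i\<in>I. x i = g i"
    using pivot_coordinates[OF finite_lessThan z a s, of r] by blast
  have fI: "finite I" using I(1) finite_subset by blast
  have "codim_le VA VB (card (I \<times> {r..<p}))"
  proof (rule codim_le_family[where f = "\<lambda>(i, j) v. F v i j"])
    fix v assume v: "v \<in> VA" "\<And>a. a \<in> I \<times> {r..<p} \<Longrightarrow> (case a of (i, j) \<Rightarrow> \<lambda>v. F v i j) v = 0"
    have "F v i j = 0" if ij: "i < r" "r \<le> j" "j < p" for i j
    proof -
      have "(\<lambda>k. F v k j) \<in> X" unfolding X_def using block_BC v(1) ij by auto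
      then show ?thesis using I(2)[of "\<lambda>k. F v k j" i] v(2) ij by fastforce
    qed
    then show "v \<in> VB" using v by (simp add: VB_def)
  qed (use fI entry in auto)
  moreover have "codim_le VB N (card ({r..<n} \<times> ({..<r} - I)))"
  proof (rule codim_le_family[where f = "\<lambda>(i, j) v. F v i j"])
    fix v assume v: "v \<in> VB"
      "\<And>a. a \<in> {r..<n} \<times> ({..<r} - I) \<Longrightarrow> (case a of (i, j) \<Rightarrow> \<lambda>v. F v i j) v = 0"
    show "v \<in> N"
    proof (rule null_spaceI[OF v(1)])
      fix i k assume ik: "r \<le> i" "i < n" "k < r"
      show "F v i k = 0"
      proof (cases "k \<in> I")
        case True
        obtain x where x: "x \<in> X" "\<And>l. l \<in> I \<Longrightarrow> x l = (if l = k then 1 else 0)"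
          using I(3)[of "\<lambda>l. if l = k then 1 else 0"] by blast
        \<comment> \<open>\<open>x\<close> is 1 at \<open>k\<close> and 0 elsewhere on
          \<open>I\<close>, and the row of \<open>v\<close> is zero outside \<open>I\<close>, so the
          relation between them reduces to the entry at \<open>k\<close>.\<close>
        have "(\<Sum>l<r. F v i l * x l) = (\<Sum>l<r. if l = k then F v i k else 0)"
        proof (intro sum.cong refl)
          fix l assume "l \<in> {..<r}"
          then show "F v i l * x l = (if l = k then F v i k else 0)"
            using x(2)[of l] v(2)[of "(i, l)"] ik True by (cases "l \<in> I") auto
        qed
        then show ?thesis using x(1) v(1) ik unfolding X_def by simp
      next
        case False
        then show ?thesis using v(2)[of "(i, k)"] ik by simp
      qed
    qed
  qed (use entry in auto)
  ultimately have *: "codim_le VA N (card (I \<times> {r..<p}) + card ({r..<n} \<times> ({..<r} - I)))"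
    by (rule codim_le_trans)
  have cI: "card I \<le> r" using I(1) card_mono[of "{..<r}" I] by simp
  have "card (I \<times> {r..<p}) + card ({r..<n} \<times> ({..<r} - I)) = card I * (p - r) + (n - r) * (r - card I)"
    using I(1) fI by (simp add: card_Diff_subset card_cartesian_product)
  \<comment> \<open>The widths \<open>p - r\<close> and \<open>n - r\<close> carry the weights
    \<open>card I\<close> and \<open>r - card I\<close>, which sum to \<open>r\<close>; this is
    where the maximum of \<open>n\<close> and \<open>p\<close> enters.\<close>
  also have "\<dots> \<le> card I * (max n p - r) + (max n p - r) * (r - card I)"
    by (intro add_mono mult_le_mono) auto
  also have "\<dots> = (max n p - r) * r"
    using cI by (metis add_mult_distrib le_add_diff_inverse mult.commute)
  finally show ?thesis by (rule codim_le_mono[OF * subset_refl subset_refl])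
qed

lemma codim_null: "codim_le V N (max n p * r)"
proof -
  have "r * r + (max n p - r) * r = max n p * r"
    using r_le by (simp add: add_mult_distrib[symmetric])
  then show ?thesis using codim_le_trans[OF codim_VA codim_VA_null] by simp
qed

lemma transposed: "normal_family scale S V (\<lambda>s i j. F s j i) p n r s0"
  by unfold_locales
     (use affine linear s0 base r_le in
       \<open>auto intro: linear_family_transpose rank_less_transpose[OF rank]\<close>)

end

section \<open>Passage to normal form and Flanders' bound\<close>

context parameter_space
begin

text \<open>\<open>G s\<close> is \<open>F s\<close> in the bases of the normal form of
  \<open>F s0\<close>. The coordinates \<open>c\<close> and \<open>d\<close> of the unit vectors in
  these bases carry null spaces and common kernels back to \<open>F\<close>.\<close>

lemma normal_form_exists:
  fixes F :: "'b \<Rightarrow> nat \<Rightarrow> nat \<Rightarrow> 'a"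
  assumes fin: "finite I" "finite J" and aff: "affine_on S V" and lin: "linear_family F"
    and rank: "\<And>s. s \<in> S \<Longrightarrow> rank_less I J (Suc r) (F s)"
    and s0: "s0 \<in> S" "\<not> rank_less I J r (F s0)"
  obtains G where "normal_family scale S V G (card I) (card J) r s0"
    "null_space {..<card I} {..<card J} V G = null_space I J V F"
    "\<forall>k. kernel_form {..<card I} {..<card J} k S G \<longrightarrow> kernel_form I J k S F"
    "\<forall>k. kernel_form {..<card J} {..<card I} k S (\<lambda>s i j. G s j i) \<longrightarrow>
      kernel_form J I k S (\<lambda>s i j. F s j i)"
proof -
  obtain P Q where r: "r \<le> card I" "r \<le> card J"
    and PQ: "\<And>a b. bil I J (F s0) (P a) (Q b) = (if a = b \<and> a < r then 1 else 0)"
    and P: "\<And>x. \<exists>c. \<forall>i\<in>I. x i = (\<Sum>a<card I. c a * P a i)"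
    and Q: "\<And>x. \<exists>c. \<forall>j\<in>J. x j = (\<Sum>b<card J. c b * Q b j)"
    using rank_normal_form[OF fin rank[OF s0(1)] s0(2)] by blast
  define G where "G s a b = bil I J (F s) (P a) (Q b)" for s a b
  have norm: "normal_family scale S V G (card I) (card J) r s0"
  proof unfold_locales
    show "linear_family G" unfolding G_def by (rule linear_family_bil[OF lin])
    show "rank_less {..<card I} {..<card J} (Suc r) (G s)" if "s \<in> S" for s
      by (rule rank_less_change_basis[OF rank[OF that]]) (simp add: G_def)
  qed (use aff s0 r PQ in \<open>auto simp: G_def\<close>)
  have "\<forall>i. \<exists>c. \<forall>j\<in>I. unit i j = (\<Sum>a<card I. c a * P a j)" using P by blast
  then obtain c where c: "\<And>i j. j \<in> I \<Longrightarrow> unit i j = (\<Sum>a<card I. c i a * P a j)" by metis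
  have "\<forall>i. \<exists>c. \<forall>j\<in>J. unit i j = (\<Sum>a<card J. c a * Q a j)" using Q by blast
  then obtain d where d: "\<And>i j. j \<in> J \<Longrightarrow> unit i j = (\<Sum>b<card J. d i b * Q b j)" by metis
  have cd: "x i = (\<Sum>a<card I. (\<Sum>l\<in>I. x l * c l a) * P a i)" if "i \<in> I" for x i
  proof -
    have "x i = (\<Sum>l\<in>I. x l * unit l i)"
      using fin that by (simp add: unit_def if_distrib[of "\<lambda>x. _ * x"] cong: if_cong)
    also have "\<dots> = (\<Sum>l\<in>I. \<Sum>a<card I. x l * c l a * P a i)"
      by (simp add: c[OF that] sum_distrib_left mult.assoc)
    finally show ?thesis by (simp add: sum_distrib_right) (rule sum.swap)
  qed
  have dd: "y j = (\<Sum>b<card J. (\<Sum>l\<in>J. y l * d l b) * Q b j)" if "j \<in> J" for y j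
  proof -
    have "y j = (\<Sum>l\<in>J. y l * unit l j)"
      using fin that by (simp add: unit_def if_distrib[of "\<lambda>x. _ * x"] cong: if_cong)
    also have "\<dots> = (\<Sum>l\<in>J. \<Sum>a<card J. y l * d l a * Q a j)"
      by (simp add: d[OF that] sum_distrib_left mult.assoc)
    finally show ?thesis by (simp add: sum_distrib_right) (rule sum.swap)
  qed
  have expand: "bil I J (F s) x y
      = (\<Sum>a<card I. (\<Sum>l\<in>I. x l * c l a) * (\<Sum>b<card J. (\<Sum>l\<in>J. y l * d l b) * G s a b))" for s x y
  proof -
    have "bil I J (F s) x y = bil I J (F s) (\<lambda>i. \<Sum>a<card I. (\<Sum>l\<in>I. x l * c l a) * P a i)
        (\<lambda>j. \<Sum>b<card J. (\<Sum>l\<in>J. y l * d l b) * Q b j)"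
      by (rule bil_cong) (use cd dd in auto)
    then show ?thesis by (simp only: bil_sum_left bil_sum_right G_def)
  qed
  have null: "null_space {..<card I} {..<card J} V G = null_space I J V F"
  proof (intro equalityI subsetI)
    fix v assume v: "v \<in> null_space {..<card I} {..<card J} V G"
    have "F v i j = 0" if ij: "i \<in> I" "j \<in> J" for i j
      using bil_unit[OF fin ij, of "F v"] expand[of v "unit i" "unit j"] v
      by (simp add: null_space_def)
    then show "v \<in> null_space I J V F" using v by (simp add: null_space_def)
  next
    fix v assume "v \<in> null_space I J V F"
    then show "v \<in> null_space {..<card I} {..<card J} V G"
      by (simp add: null_space_def G_def bil_def)
  qed
  have col: "kernel_form I J k S F" if kf: "kernel_form {..<card I} {..<card J} k S G" for k
  proof -
    obtain \<phi> where \<phi>: "\<forall>z. (\<forall>l<k. (\<Sum>b<card J. \<phi> l b * z b) = 0) \<longrightarrow>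
        (\<forall>s\<in>S. \<forall>a\<in>{..<card I}. (\<Sum>b<card J. G s a b * z b) = 0)"
      by (rule kernel_formE[OF kf])
    show ?thesis
      unfolding kernel_form_def
    proof (intro exI[of _ "\<lambda>l j. \<Sum>b<card J. \<phi> l b * d j b"] allI impI ballI)
      fix z s i assume z: "\<forall>l<k. (\<Sum>j\<in>J. (\<Sum>b<card J. \<phi> l b * d j b) * z j) = 0"
        and s: "s \<in> S" and i: "i \<in> I"
      define y where "y b = (\<Sum>l\<in>J. z l * d l b)" for b
      have "(\<Sum>b<card J. \<phi> l b * y b) = (\<Sum>j\<in>J. (\<Sum>b<card J. \<phi> l b * d j b) * z j)" for l
        unfolding y_def sum_distrib_left sum_distrib_right
        by (subst sum.swap) (simp add: ac_simps)
      then have "(\<Sum>b<card J. G s a b * y b) = 0" if "a < card I" for a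
        using \<phi>[THEN spec, of y] z s that by simp
      then show "(\<Sum>j\<in>J. F s i j * z j) = 0"
        using expand[of s "unit i" z] by (simp add: bil_unit_left[OF fin(1) i] y_def mult.commute)
    qed
  qed
  have row: "kernel_form J I k S (\<lambda>s i j. F s j i)"
    if kf: "kernel_form {..<card J} {..<card I} k S (\<lambda>s i j. G s j i)" for k
  proof -
    obtain \<phi> where \<phi>: "\<forall>z. (\<forall>l<k. (\<Sum>a<card I. \<phi> l a * z a) = 0) \<longrightarrow>
        (\<forall>s\<in>S. \<forall>b\<in>{..<card J}. (\<Sum>a<card I. G s a b * z a) = 0)"
      by (rule kernel_formE[OF kf])
    show ?thesis
      unfolding kernel_form_def
    proof (intro exI[of _ "\<lambda>l i. \<Sum>a<card I. \<phi> l a * c i a"] allI impI ballI)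
      fix z s j assume z: "\<forall>l<k. (\<Sum>i\<in>I. (\<Sum>a<card I. \<phi> l a * c i a) * z i) = 0"
        and s: "s \<in> S" and j: "j \<in> J"
      define x where "x a = (\<Sum>l\<in>I. z l * c l a)" for a
      have "(\<Sum>a<card I. \<phi> l a * x a) = (\<Sum>i\<in>I. (\<Sum>a<card I. \<phi> l a * c i a) * z i)" for l
        unfolding x_def sum_distrib_left sum_distrib_right
        by (subst sum.swap) (simp add: ac_simps)
      then have *: "(\<Sum>a<card I. G s a b * x a) = 0" if "b < card J" for b
        using \<phi>[THEN spec, of x] z s that by simp
      have "bil I J (F s) z (unit j)
          = (\<Sum>a<card I. \<Sum>b<card J. (\<Sum>l\<in>J. unit j l * d l b) * (G s a b * x a))"
        unfolding expand x_def[symmetric] sum_distrib_left by (simp add: ac_simps)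
      also have "\<dots> = (\<Sum>b<card J. (\<Sum>l\<in>J. unit j l * d l b) * (\<Sum>a<card I. G s a b * x a))"
        by (subst sum.swap) (simp add: sum_distrib_left)
      also have "\<dots> = 0" by (simp add: *)
      finally show "(\<Sum>i\<in>I. F s i j * z i) = 0"
        by (simp add: bil_unit_right[OF fin(2) j] mult.commute)
    qed
  qed
  show ?thesis by (rule that[OF norm null]) (use col row in blast)+
qed

text \<open>If the maximal rank is attained, the family can be normalized, and the costs
  \<open>r * r\<close> for \<open>A = 0\<close> and \<open>(max n p - r) * r\<close> for the rest
  add up. If not, the smaller bound of the induction hypothesis applies.\<close>

theorem flanders_affine:
  fixes F :: "'b \<Rightarrow> nat \<Rightarrow> nat \<Rightarrow> 'a"
  assumes fin: "finite I" "finite J" and aff: "affine_on S V" and lin: "linear_family F"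
    and rank: "\<And>s. s \<in> S \<Longrightarrow> rank_less I J (Suc r) (F s)"
  shows "codim_le V (null_space I J V F) (max (card I) (card J) * r)"
  using rank
proof (induction r)
  case 0
  have F0: "F s i j = 0" if "s \<in> S" "i \<in> I" "j \<in> J" for s i j
    using rank_less_Suc_0[OF 0[OF that(1)]] fin that by blast
  obtain s where s: "s \<in> S" using aff by (auto simp: affine_on_def)
  have "V \<subseteq> null_space I J V F"
  proof
    fix v assume v: "v \<in> V"
    then have "s + v \<in> S" using aff s by (simp add: affine_on_def)
    then have "F v i j = 0" if "i \<in> I" "j \<in> J" for i j
      using F0[of "s + v" i j] F0[OF s] that
        linear_form_add[of "\<lambda>v. F v i j" s v] lin by (simp add: linear_family_def)
    then show "v \<in> null_space I J V F" using v by (simp add: null_space_def)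
  qed
  then show ?case unfolding codim_le_def by (intro exI[of _ "[]"]) auto
next
  case (Suc r)
  show ?case
  proof (cases "\<forall>s\<in>S. rank_less I J (Suc r) (F s)")
    case True
    then show ?thesis using Suc.IH by (auto elim!: codim_le_mono)
  next
    case False
    then obtain s0 where s0: "s0 \<in> S" "\<not> rank_less I J (Suc r) (F s0)" by blast
    obtain G where "normal_family scale S V G (card I) (card J) (Suc r) s0"
      "null_space {..<card I} {..<card J} V G = null_space I J V F"
      by (rule normal_form_exists[OF fin aff lin Suc.prems s0], assumption) (rule that)
    then show ?thesis using normal_family.codim_null by metis
  qed
qed

end

section \<open>Large families of square matrices\<close>

lemma bil_unit_elim_right:
  fixes M :: "nat \<Rightarrow> nat \<Rightarrow> 'a::comm_ring_1"
  assumes "finite I" "finite J" "i \<in> I" "j \<in> J" "j0 \<in> J"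
  shows "bil I J M (unit i) (\<lambda>b. unit j b - c * unit j0 b) = M i j - c * M i j0"
  using assms sum_unit_right[of J j "M i"] sum_unit_right[of J j0 "\<lambda>b. c * M i b"]
  by (simp add: bil_unit_left right_diff_distrib sum_subtractf ac_simps)

lemma bil_unit_elim_left:
  fixes M :: "nat \<Rightarrow> nat \<Rightarrow> 'a::comm_ring_1"
  assumes "finite I" "finite J" "i \<in> I" "i0 \<in> I" "j \<in> J"
  shows "bil I J M (\<lambda>a. unit i a - c * unit i0 a) (unit j) = M i j - c * M i0 j"
  by (rule trans[OF bil_transpose[symmetric]]) (rule bil_unit_elim_right[OF assms(2,1,5,3,4)])

lemma rank_less_kernel:
  fixes M :: "nat \<Rightarrow> nat \<Rightarrow> 'a::field"
  assumes fin: "finite J" and nz: "\<exists>j\<in>J. z j \<noteq> 0"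
    and z: "\<And>i. i \<in> I \<Longrightarrow> (\<Sum>j\<in>J. M i j * z j) = 0"
  shows "rank_less I J (card J) M"
  unfolding rank_less_def
proof (intro allI)
  fix w u :: "nat \<Rightarrow> nat \<Rightarrow> 'a"
  obtain e where e: "bij_betw e {..<card J} J"
    using ex_bij_betw_nat_finite[OF fin] by (metis lessThan_atLeast0)
  define X where "X a j = (\<Sum>i\<in>I. w a i * M i j)" for a j
  have "fdet (card J) (\<lambda>a b. bil I J M (w a) (u b))
      = fdet (card J) (\<lambda>a b. \<Sum>c<card J. X a (e c) * u b (e c))"
  proof (rule fdet_cong)
    fix a b
    have "bil I J M (w a) (u b) = (\<Sum>j\<in>J. X a j * u b j)"
      unfolding bil_def X_def sum_distrib_right by (rule sum.swap)
    also have "\<dots> = (\<Sum>c<card J. X a (e c) * u b (e c))"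
      by (rule sum.reindex_bij_betw[OF e, symmetric])
    finally show "bil I J M (w a) (u b) = (\<Sum>c<card J. X a (e c) * u b (e c))" .
  qed
  also have "\<dots> = fdet (card J) (\<lambda>a c. X a (e c)) * fdet (card J) (\<lambda>c b. u b (e c))"
    by (rule fdet_mult)
  also have "fdet (card J) (\<lambda>a c. X a (e c)) = 0"
  proof (rule fdet_eq_0I_right)
    show "\<exists>c<card J. z (e c) \<noteq> 0"
      using nz bij_betw_imp_surj_on[OF e] by (metis imageE lessThan_iff)
    fix a
    have "(\<Sum>c<card J. X a (e c) * z (e c)) = (\<Sum>j\<in>J. X a j * z j)"
      by (rule sum.reindex_bij_betw[OF e])
    also have "\<dots> = (\<Sum>i\<in>I. \<Sum>j\<in>J. w a i * M i j * z j)"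
      unfolding X_def sum_distrib_right by (rule sum.swap)
    also have "\<dots> = (\<Sum>i\<in>I. w a i * (\<Sum>j\<in>J. M i j * z j))"
      by (simp add: sum_distrib_left mult.assoc)
    also have "\<dots> = 0" by (simp add: z)
    finally show "(\<Sum>c<card J. X a (e c) * z (e c)) = 0" .
  qed
  finally show "fdet (card J) (\<lambda>a b. bil I J M (w a) (u b)) = 0" by simp
qed

lemma nonzero_solution:
  fixes \<phi> :: "nat \<Rightarrow> nat \<Rightarrow> 'a::field"
  assumes fin: "finite J" and k: "k < card J"
  obtains z where "\<exists>j\<in>J. z j \<noteq> 0" "\<And>l. l < k \<Longrightarrow> (\<Sum>j\<in>J. \<phi> l j * z j) = 0"
proof -
  obtain e where e: "bij_betw e {..<card J} J"
    using ex_bij_betw_nat_finite[OF fin] by (metis lessThan_atLeast0)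
  define X where "X l c = (if l < k then \<phi> l (e c) else 0)" for l c
  have "fdet (card J) X = 0"
    by (rule fdet_eq_0I_left[where v = "unit k"]) (use k in \<open>auto simp: X_def unit_def intro!: sum.neutral\<close>)
  from fdet_eq_0_right_kernel[OF this] obtain v where
    v: "\<exists>c<card J. v c \<noteq> 0" "\<And>l. l < card J \<Longrightarrow> (\<Sum>c<card J. X l c * v c) = 0" by blast
  define z where "z j = v (the_inv_into {..<card J} e j)" for j
  have ze: "z (e c) = v c" if "c < card J" for c
    using the_inv_into_f_f[OF bij_betw_imp_inj_on[OF e], of c] that by (simp add: z_def)
  show ?thesis
  proof (rule that[of z])
    show "\<exists>j\<in>J. z j \<noteq> 0" using v(1) ze bij_betwE[OF e] by (metis lessThan_iff)
    fix l assume l: "l < k"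
    have "(\<Sum>j\<in>J. \<phi> l j * z j) = (\<Sum>c<card J. \<phi> l (e c) * z (e c))"
      by (rule sum.reindex_bij_betw[OF e, symmetric])
    also have "\<dots> = (\<Sum>c<card J. X l c * v c)"
      by (intro sum.cong refl) (use l ze in \<open>auto simp: X_def\<close>)
    finally show "(\<Sum>j\<in>J. \<phi> l j * z j) = 0" using v(2)[of l] l k by simp
  qed
qed

text \<open>Quantified over all index sets and families because the induction applies it to a block
  of a transformed family on the same \<open>S\<close> and \<open>V\<close>. The constant is
  \<open>(n - 1) * (r - 1) + p\<close> at \<open>p = n\<close>.\<close>

definition (in parameter_space) square_bound :: "nat \<Rightarrow> bool" where
  "square_bound r \<longleftrightarrow> (\<forall>I J S V (F :: 'b \<Rightarrow> nat \<Rightarrow> nat \<Rightarrow> 'a). finite I \<longrightarrow> finite J \<longrightarrow> card J = card I \<longrightarrow>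
     r < card I \<longrightarrow> affine_on S V \<longrightarrow> linear_family F \<longrightarrow> (\<forall>s\<in>S. rank_less I J (Suc r) (F s)) \<longrightarrow>
     \<not> codim_le V (null_space I J V F) ((card I - 1) * r + 1) \<longrightarrow>
     kernel_form I J r S F \<or> kernel_form J I r S (\<lambda>s i j. F s j i))"

section \<open>Extraction along a direction supported in the lower left block\<close>

context normal_family
begin

text \<open>A column operation with pivot \<open>y j0\<close>, meant for \<open>y\<close> the row
  \<open>i\<close> of some \<open>h\<close> in \<open>VB\<close>: it clears that row outside
  \<open>j0\<close>. Columns from \<open>r\<close> on are left alone because \<open>h\<close>
  vanishes there.\<close>

definition "elim_cols y j0 s i j =
  (if j < r then F s i j - y j / y j0 * F s i j0 else F s i j)" for y :: "nat \<Rightarrow> 'a"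

lemma elim_cols_linear: "linear_family (\<lambda>s. elim_cols y j0 s)"
  unfolding linear_family_def
proof (intro allI)
  fix i j
  have "linear_form (\<lambda>s. F s i j - y j / y j0 * F s i j0)"
    by (intro linear_form_diff_fun linear_form_mult entry)
  then show "linear_form (\<lambda>s. elim_cols y j0 s i j)"
    unfolding elim_cols_def using entry by (cases "j < r") simp_all
qed

text \<open>After the column operation, \<open>h\<close> seen on the first \<open>r\<close> rows and
  row \<open>i\<close> has its only nonzero entry at \<open>(i, j0)\<close>. Comparing minors at
  \<open>s\<close> and \<open>s + h\<close> therefore strips off row \<open>i\<close> and column
  \<open>j0\<close>.\<close>

lemma elim_cols_rank:
  assumes h: "h \<in> VB" and i: "r \<le> i" "i < n" and j0: "j0 < r" "F h i j0 \<noteq> 0" and s: "s \<in> S"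
  shows "rank_less {..<r} ({..<p} - {j0}) r (elim_cols (F h i) j0 s)"
proof (rule rank_less_extraction[where M = "F s" and N = "F h" and I = "{..<n}" and J = "{..<p}"
      and w' = "unit i" and u' = "unit j0" and P = unit
      and Q = "\<lambda>j. if j < r then (\<lambda>b. unit j b - F h i j / F h i j0 * unit j0 b) else unit j"])
  have hV: "h \<in> V" and hA: "\<And>a b. a < r \<Longrightarrow> b < r \<Longrightarrow> F h a b = 0"
    using h by (auto simp: VB_def VA_def)
  have hp: "F h a j = 0" if "a < r" "j < p" for a j
    using hA[of a j] h that by (cases "j < r") (auto simp: VB_def)
  show "rank_less {..<n} {..<p} (Suc r) (F s)" using rank s by blast
  show "rank_less {..<n} {..<p} (Suc r) (\<lambda>i j. F s i j + F h i j)"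
  proof -
    have "F (s + h) = (\<lambda>i j. F s i j + F h i j)" by (intro ext) (rule F_add)
    then show ?thesis using rank[OF S_add[OF s hV]] by simp
  qed
  show "bil {..<n} {..<p} (F h) (unit i) (unit j0) \<noteq> 0"
    using i j0 r_le by (simp add: bil_unit)
  have row: "bil {..<n} {..<p} (F s) (unit a)
      (if j < r then (\<lambda>b. unit j b - F h i j / F h i j0 * unit j0 b) else unit j)
    = (if j < r then F s a j - F h i j / F h i j0 * F s a j0 else F s a j)"
    if "a < n" "j < p" for a j s
  proof (cases "j < r")
    case True
    then show ?thesis using that j0 r_le
      by (simp only: if_True) (rule bil_unit_elim_right, auto)
  qed (use that in \<open>simp add: bil_unit\<close>)
  show "bil {..<n} {..<p} (F h) (unit i)
      (if j < r then (\<lambda>b. unit j b - F h i j / F h i j0 * unit j0 b) else unit j) = 0"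
    if "j \<in> {..<p} - {j0}" for j
    using that i j0 row[of i j h] VB_D[OF h, of j i] by auto
  show "bil {..<n} {..<p} (F h) (unit a) (unit j0) = 0" if "a \<in> {..<r}" for a
    using that j0 r_le hA by (simp add: bil_unit)
  show "bil {..<n} {..<p} (F h) (unit a)
      (if j < r then (\<lambda>b. unit j b - F h i j / F h i j0 * unit j0 b) else unit j) = 0"
    if "a \<in> {..<r}" "j \<in> {..<p} - {j0}" for a j
    using that row[of a j h] r_le hp j0 by auto
  show "elim_cols (F h i) j0 s a j = bil {..<n} {..<p} (F s) (unit a)
      (if j < r then (\<lambda>b. unit j b - F h i j / F h i j0 * unit j0 b) else unit j)"
    if "a \<in> {..<r}" "j \<in> {..<p} - {j0}" for a j
    using that row[of a j s] r_le by (auto simp: elim_cols_def)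
qed

lemma elim_cols_add: "elim_cols y j0 (s + t) i j = elim_cols y j0 s i j + elim_cols y j0 t i j"
  by (auto simp: elim_cols_def F_add algebra_simps)

end

locale large_square_family = normal_family scale S V F n n r s0
  for scale :: "'a::field \<Rightarrow> 'b::ab_group_add \<Rightarrow> 'b" (infixr \<open>*s\<close> 75) and S V F n r s0 +
  assumes r_less: "r < n" and large: "\<not> codim_le V N ((n - 1) * r + 1)"
begin

lemma large_VA_improved:
  assumes "codim_le VA N b" "b + a \<le> (n - 1) * r + 1"
  shows "\<not> codim_le V VA a"
  using large codim_le_trans[OF _ assms(1)] codim_le_mono[OF _ subset_refl subset_refl, of V N "a + b"] assms(2)
  by (metis add.commute)

text \<open>\<open>(n - r) * r\<close> equations lead from \<open>VA\<close> to \<open>N\<close>,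
  and they are subtracted from the threshold. Most contradictions below consist in forcing
  \<open>A = 0\<close> by \<open>(r - 1) * r + 1\<close> equations.\<close>

lemma large_VA: "\<not> codim_le V VA ((r - 1) * r + 1)"
proof (cases "r = 0")
  case True
  then show ?thesis using large codim_le_mono[OF codim_null subset_refl subset_refl] by auto
next
  case False
  have "(n - r) + (r - 1) = n - 1" using False r_less by simp
  then have "(n - r) * r + ((r - 1) * r + 1) = (n - 1) * r + 1"
    by (metis add.assoc add_mult_distrib)
  then show ?thesis using large_VA_improved[of "(n - r) * r"] codim_VA_null by simp
qed

lemma r_ge_2: "2 \<le> r"
proof (rule ccontr)
  assume "\<not> 2 \<le> r"
  then have "r * r \<le> (r - 1) * r + 1" by (cases r) auto
  then show False using large_VA codim_le_mono[OF codim_VA subset_refl subset_refl] by blast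
qed

text \<open>Among the members with a prescribed value of one form, some has an invertible upper left
  block: otherwise Flanders' bound \<open>r * (r - 1)\<close> for singular blocks and one equation
  for the form would contradict \<open>large_VA\<close>.\<close>

lemma exists_invertible_section:
  assumes f: "linear_form f" and s: "s \<in> S"
  shows "\<exists>t\<in>S. f t = f s \<and> fdet r (F t) \<noteq> 0"
proof (rule ccontr)
  assume "\<not> ?thesis"
  then have *: "fdet r (F t) = 0" if "t \<in> {t \<in> S. f t = f s}" for t using that by blast
  let ?W = "{v \<in> V. f v = 0}"
  have "codim_le ?W (null_space {..<r} {..<r} ?W F) (max (card {..<r}) (card {..<r}) * (r - 1))"
  proof (rule flanders_affine[OF _ _ affine_on_hyperplane[OF affine f s] linear])
    show "rank_less {..<r} {..<r} (Suc (r - 1)) (F t)" if "t \<in> {t \<in> S. f t = f s}" for t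
      using rank_less_square[OF *[OF that]] r_ge_2 by simp
  qed auto
  then have "codim_le V (null_space {..<r} {..<r} ?W F) (1 + r * (r - 1))"
    using codim_le_trans[OF codim_le_hyperplane[OF f]] by simp
  then have "codim_le V VA ((r - 1) * r + 1)"
    by (rule codim_le_mono) (auto simp: null_space_def VA_def mult.commute)
  then show False using large_VA by simp
qed

text \<open>The count of two arguments below: Flanders' bound for an \<open>(r - 1)\<close> by
  \<open>(r - 1)\<close> block of rank at most \<open>r - 2\<close>, then one row and one column of
  the \<open>r\<close> by \<open>r\<close> block, with their common entry counted once.\<close>

lemma codim_bound_arith: "(r - 1) * (r - 2) + (r + (r - 1)) = (r - 1) * r + 1"
proof -
  obtain k where "r = k + 2" using r_ge_2 by (metis add.commute le_Suc_ex)
  then show ?thesis by simp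
qed

text \<open>A direction \<open>g\<close> with \<open>A = 0\<close> and nonzero \<open>C\<close>
  would permit a second extraction. The one along \<open>h\<close> leaves rank at most
  \<open>r - 1\<close> off column \<open>j0\<close>; the one along \<open>g\<close> also strips off
  row \<open>i0\<close> and column \<open>j1\<close>, leaving an \<open>(r - 1)\<close> by
  \<open>(r - 1)\<close> block of rank at most \<open>r - 2\<close>.\<close>

lemma VA_eq_VB:
  assumes h: "h \<in> VB" and i: "r \<le> i" "i < n" and j0: "j0 < r" "F h i j0 \<noteq> 0"
  shows "VA \<subseteq> VB"
proof (rule ccontr)
  assume "\<not> VA \<subseteq> VB"
  then obtain g i0 j1 where g: "g \<in> VA" and i0: "i0 < r" and j1: "r \<le> j1" "j1 < n"
    and nz: "F g i0 j1 \<noteq> 0"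
    by (auto simp: VB_def)
  define T where "T = elim_cols (F h i) j0"
  have Tg: "T g a j = (if j < r then 0 else F g a j)" if "a < r" for a j
    using g that j0 by (auto simp: T_def elim_cols_def VA_def)
  \<comment> \<open>The row operation with pivot \<open>F g i0 j1\<close> clears column
    \<open>j1\<close> of \<open>g\<close>; the columns kept afterwards lie in \<open>A\<close>,
    where \<open>g\<close> is zero.\<close>
  define U where "U s a j = T s a j - F g a j1 / F g i0 j1 * T s i0 j" for s a j
  have Trank: "rank_less {..<r} ({..<n} - {j0}) (Suc (r - 1)) (T s)" if "s \<in> S" for s
    using elim_cols_rank[OF h i j0 that] r_ge_2 by (simp add: T_def)
  have fin: "finite ({..<n} - {j0})" by simp
  have Urank: "rank_less ({..<r} - {i0}) ({..<r} - {j0}) (Suc (r - 2)) (U s)" if s: "s \<in> S" for s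
  proof (rule rank_less_extraction[where M = "T s" and N = "T g" and I = "{..<r}"
        and J = "{..<n} - {j0}" and w' = "unit i0" and u' = "unit j1" and Q = unit
        and P = "\<lambda>a b. unit a b - F g a j1 / F g i0 j1 * unit i0 b"])
    have r2: "Suc (Suc (r - 2)) = Suc (r - 1)" using r_ge_2 by simp
    show "rank_less {..<r} ({..<n} - {j0}) (Suc (Suc (r - 2))) (T s)"
      unfolding r2 by (rule Trank[OF s])
    have "s + g \<in> S" using s g VA_sub S_add by blast
    moreover have "T (s + g) = (\<lambda>i j. T s i j + T g i j)"
      by (intro ext) (simp add: T_def elim_cols_add)
    ultimately show "rank_less {..<r} ({..<n} - {j0}) (Suc (Suc (r - 2))) (\<lambda>i j. T s i j + T g i j)"
      unfolding r2 using Trank[of "s + g"] by simp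
    show "bil {..<r} ({..<n} - {j0}) (T g) (unit i0) (unit j1) \<noteq> 0"
      using i0 j1 j0 nz by (simp add: bil_unit Tg)
    show "bil {..<r} ({..<n} - {j0}) (T g) (unit i0) (unit j) = 0" if "j \<in> {..<r} - {j0}" for j
      using that i0 r_le by (simp add: bil_unit Tg)
    show "bil {..<r} ({..<n} - {j0}) (T g) (\<lambda>b. unit a b - F g a j1 / F g i0 j1 * unit i0 b) (unit j1) = 0"
      if "a \<in> {..<r} - {i0}" for a
      using that i0 j0 j1 nz by (subst bil_unit_elim_left) (auto simp: Tg)
    show "bil {..<r} ({..<n} - {j0}) (T g) (\<lambda>b. unit a b - F g a j1 / F g i0 j1 * unit i0 b) (unit j) = 0"
      if "a \<in> {..<r} - {i0}" "j \<in> {..<r} - {j0}" for a j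
      using that i0 r_le by (subst bil_unit_elim_left) (auto simp: Tg)
    show "U s a j = bil {..<r} ({..<n} - {j0}) (T s) (\<lambda>b. unit a b - F g a j1 / F g i0 j1 * unit i0 b) (unit j)"
      if "a \<in> {..<r} - {i0}" "j \<in> {..<r} - {j0}" for a j
      using that i0 r_le by (subst bil_unit_elim_left) (auto simp: U_def)
  qed
  have Ulin: "linear_family U"
    using elim_cols_linear[of "F h i" j0] unfolding linear_family_def U_def T_def
    by (intro allI linear_form_diff_fun linear_form_mult) blast+
  let ?N = "null_space ({..<r} - {i0}) ({..<r} - {j0}) V U"
  have "codim_le V ?N (max (card ({..<r} - {i0})) (card ({..<r} - {j0})) * (r - 2))"
    by (rule flanders_affine[OF _ _ affine Ulin Urank]) auto
  then have c1: "codim_le V ?N ((r - 1) * (r - 2))" using i0 j0 by simp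
  let ?X = "{i0} \<times> {..<r} \<union> ({..<r} - {i0}) \<times> {j0}"
  have "codim_le ?N VA (card ?X)"
  proof (rule codim_le_family[where f = "\<lambda>(i, j) v. F v i j"])
    fix v assume v: "v \<in> ?N" "\<And>a. a \<in> ?X \<Longrightarrow> (case a of (i, j) \<Rightarrow> \<lambda>v. F v i j) v = 0"
    have z1: "F v i0 j = 0" if "j < r" for j using v(2)[of "(i0, j)"] that by simp
    have z2: "F v a j0 = 0" if "a < r" for a
      using v(2)[of "(a, j0)"] z1 that j0 by (cases "a = i0") auto
    have "F v a j = 0" if "a < r" "j < r" for a j
    proof (cases "a = i0 \<or> j = j0")
      case False
      then have "U v a j = 0" using v(1) that by (simp add: null_space_def)
      then show ?thesis using z1 z2 that i0 j0
        by (simp add: U_def T_def elim_cols_def)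
    qed (use z1 z2 that in auto)
    then show "v \<in> VA" using v(1) by (simp add: VA_def null_space_def)
  qed (use entry in auto)
  moreover have "card ?X = r + (r - 1)"
    using i0 by (subst card_Un_disjoint) (auto simp: card_cartesian_product)
  ultimately have "codim_le V VA ((r - 1) * (r - 2) + (r + (r - 1)))"
    using codim_le_trans[OF c1] by metis
  then show False using large_VA codim_bound_arith by metis
qed

text \<open>If the lower left rows of \<open>VA\<close> have a common nonzero annihilator,
  \<open>VA\<close> is smaller than expected, and the saving makes the induction hypothesis
  applicable to an \<open>r\<close> by \<open>r\<close> block. If not, the solution \<open>z\<close>
  of \<open>A z = c\<close> for a column \<open>c\<close> of \<open>C\<close> turns out to
  annihilate these rows, so \<open>z = 0\<close> and \<open>c = 0\<close>.\<close>

lemma upper_right_zero: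
  assumes IH: "square_bound (r - 1)"
    and h: "h \<in> VB" and i: "r \<le> i" "i < n" and j0: "j0 < r" "F h i j0 \<noteq> 0"
    and s: "s \<in> S" and a: "a < r" and j1: "r \<le> j1" "j1 < n"
  shows "F s a j1 = 0"
proof -
  have VAB: "VA \<subseteq> VB" by (rule VA_eq_VB[OF h i j0])
  define ann where "ann z \<longleftrightarrow> (\<forall>v\<in>VA. \<forall>i. r \<le> i \<longrightarrow> i < n \<longrightarrow> (\<Sum>k<r. F v i k * z k) = 0)" for z
  show ?thesis
  proof (cases "\<exists>z k0. ann z \<and> k0 < r \<and> z k0 \<noteq> 0")
    case True
    then obtain z k0 where z: "ann z" "k0 < r" "z k0 \<noteq> 0" by blast
    \<comment> \<open>The relation given by \<open>z\<close> determines the entry at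
      \<open>k0\<close> from the others, which saves one equation in each of the
      \<open>n - r\<close> lower rows.\<close>
    have "codim_le VA N (card ({r..<n} \<times> ({..<r} - {k0})))"
    proof (rule codim_le_family[where f = "\<lambda>(i, j) v. F v i j"])
      fix v assume v: "v \<in> VA"
        "\<And>a. a \<in> {r..<n} \<times> ({..<r} - {k0}) \<Longrightarrow> (case a of (i, j) \<Rightarrow> \<lambda>v. F v i j) v = 0"
      show "v \<in> N"
      proof (rule null_spaceI)
        show "v \<in> VB" using v VAB by blast
        fix i k assume ik: "r \<le> i" "i < n" "k < r"
        have zero: "F v i l = 0" if "l < r" "l \<noteq> k0" for l using v(2)[of "(i, l)"] ik that by simp
        have "(\<Sum>l<r. F v i l * z l) = (\<Sum>l<r. if l = k0 then F v i k0 * z k0 else 0)"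
          by (intro sum.cong refl) (use zero in auto)
        then have "F v i k0 = 0" using z v(1) ik by (simp add: ann_def)
        then show "F v i k = 0" using zero ik by (cases "k = k0") auto
      qed
    qed (use entry in auto)
    moreover have "card ({r..<n} \<times> ({..<r} - {k0})) = (n - r) * (r - 1)"
      using z(2) by (simp add: card_cartesian_product)
    ultimately have cN: "codim_le VA N ((n - r) * (r - 1))" by simp
    define T where "T = elim_cols (F h i) j0"
    \<comment> \<open>Column \<open>j1\<close> takes the place of column \<open>j0\<close>.\<close>
    let ?I = "{..<r}" and ?J = "insert j1 ({..<r} - {j0})"
    have cJ: "card ?J = r" using j0 j1 by simp
    have Tlin: "linear_family T" using elim_cols_linear by (simp add: T_def)
    have T_upper: "T t b j = F t b j - F h i j / F h i j0 * F t b j0" if "j < r" for t b j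
      using that by (simp add: T_def elim_cols_def)
    have T_j1: "T t b j1 = F t b j1" for t b
      using j1 by (simp add: T_def elim_cols_def)
    have Trank: "rank_less ?I ?J (Suc (r - 1)) (T t)" if "t \<in> S" for t
    proof -
      have "Suc (r - 1) = r" using r_ge_2 by simp
      moreover have "?J \<subseteq> {..<n} - {j0}" using j0 j1 r_less by auto
      ultimately show ?thesis
        using rank_less_subset[OF elim_cols_rank[OF h i j0 that], of ?I ?J] by (simp add: T_def)
    qed
    let ?N = "null_space ?I ?J V T"
    have cT: "codim_le ?N VA (card {..<r})"
    proof (rule codim_le_family[where f = "\<lambda>b v. F v b j0"])
      fix v assume v: "v \<in> ?N" "\<And>b. b \<in> {..<r} \<Longrightarrow> F v b j0 = 0"
      have "F v b j = 0" if "b < r" "j < r" for b j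
      proof (cases "j = j0")
        case False
        then have "T v b j = 0" using v(1) that by (simp add: null_space_def)
        then show ?thesis using v(2) that T_upper by simp
      qed (use v that in auto)
      then show "v \<in> VA" using v(1) by (simp add: VA_def null_space_def)
    qed (use entry in auto)
    have "\<not> codim_le V ?N ((r - 1) * (r - 1) + 1)"
    proof
      assume "codim_le V ?N ((r - 1) * (r - 1) + 1)"
      then have "codim_le V VA ((r - 1) * (r - 1) + 1 + r)"
        using codim_le_trans cT by fastforce
      \<comment> \<open>The saving \<open>n - r\<close> is set against the \<open>r\<close>
        equations for column \<open>j0\<close>; the inequality amounts to
        \<open>r < n\<close>.\<close>
      moreover have "(n - r) * (r - 1) + ((r - 1) * (r - 1) + 1 + r) \<le> (n - 1) * r + 1"
      proof -
        obtain q where "n = r + 1 + q" using r_less by (metis Suc_eq_plus1 less_iff_Suc_add add_Suc_shift add.commute add.left_commute)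
        moreover obtain k where "r = k + 2" using r_ge_2 by (metis add.commute le_Suc_ex)
        ultimately show ?thesis by (simp add: algebra_simps)
      qed
      ultimately show False using large_VA_improved[OF cN] by blast
    qed
    then have "kernel_form ?I ?J (r - 1) S T \<or> kernel_form ?J ?I (r - 1) S (\<lambda>s i j. T s j i)"
      using IH cJ affine Tlin Trank r_ge_2 unfolding square_bound_def
      by (elim allE[of _ ?I] allE[of _ ?J] allE[of _ S] allE[of _ V] allE[of _ T]) simp
    then show ?thesis
    proof
      assume "kernel_form ?I ?J (r - 1) S T"
      then obtain \<phi> where \<phi>: "\<forall>z. (\<forall>l<r - 1. (\<Sum>j\<in>?J. \<phi> l j * z j) = 0) \<longrightarrow>
          (\<forall>t\<in>S. \<forall>b\<in>{..<r}. (\<Sum>j\<in>?J. T t b j * z j) = 0)"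
        by (rule kernel_formE)
      have "r - 1 < card ?J" unfolding cJ using r_ge_2 by simp
      then obtain l where l: "\<exists>j\<in>?J. l j \<noteq> 0" "\<And>k. k < r - 1 \<Longrightarrow> (\<Sum>j\<in>?J. \<phi> k j * l j) = 0"
        using nonzero_solution[of ?J "r - 1" \<phi>] by blast
      have Tl: "(\<Sum>j\<in>?J. T t b j * l j) = 0" if "t \<in> S" "b < r" for t b
        using \<phi>[THEN spec, of l] l(2) that by blast
      have split: "(\<Sum>j\<in>?J. f j) = f j1 + (\<Sum>j\<in>{..<r} - {j0}. f j)" for f :: "nat \<Rightarrow> 'a"
        using j1 by simp
      \<comment> \<open>At \<open>s0\<close> the rows other than \<open>j0\<close> of the block are
        unit vectors, which leaves \<open>l\<close> no entry outside \<open>j1\<close>.\<close>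
      have l0: "l b = 0" if b: "b < r" "b \<noteq> j0" for b
      proof -
        have "(\<Sum>j\<in>{..<r} - {j0}. T s0 b j * l j) = (\<Sum>j\<in>{..<r} - {j0}. if b = j then l b else 0)"
          by (intro sum.cong refl) (use b j0 r_le in \<open>auto simp: T_upper base\<close>)
        then have "(\<Sum>j\<in>?J. T s0 b j * l j) = T s0 b j1 * l j1 + l b"
          unfolding split using b by simp
        moreover have "T s0 b j1 = 0" using b j1 by (simp add: T_j1 base)
        ultimately show ?thesis using Tl[OF s0 b(1)] by simp
      qed
      have "l j1 \<noteq> 0" using l(1) l0 by auto
      moreover have "(\<Sum>j\<in>{..<r} - {j0}. T s a j * l j) = 0"
        by (rule sum.neutral) (use l0 in auto)
      ultimately show ?thesis using Tl[OF s a] unfolding split by (simp add: T_j1)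
    next
      assume "kernel_form ?J ?I (r - 1) S (\<lambda>s i j. T s j i)"
      then obtain \<phi> where \<phi>: "\<forall>z. (\<forall>l<r - 1. (\<Sum>b<r. \<phi> l b * z b) = 0) \<longrightarrow>
          (\<forall>t\<in>S. \<forall>j\<in>?J. (\<Sum>b<r. T t b j * z b) = 0)"
        by (rule kernel_formE)
      obtain l where l: "\<exists>b\<in>{..<r}. l b \<noteq> 0" "\<And>k. k < r - 1 \<Longrightarrow> (\<Sum>b<r. \<phi> k b * l b) = 0"
        using nonzero_solution[of "{..<r}" "r - 1" \<phi>] r_ge_2 by auto
      have lT: "(\<Sum>b<r. T t b j * l b) = 0" if "t \<in> S" "j \<in> ?J" for t j
        using \<phi>[THEN spec, of l] l(2) that by blast
      obtain i0 where i0: "i0 < r" "l i0 \<noteq> 0" using l(1) by auto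
      \<comment> \<open>A row relation common to all \<open>T t\<close> passes to differences, so
        row \<open>i0\<close> of \<open>T v\<close> follows from the other rows. The entry
        \<open>(i0, j0)\<close> is added because the block lacks column \<open>j0\<close>.\<close>
      let ?X = "({..<r} - {i0}) \<times> {..<r} \<union> {(i0, j0)}"
      have "codim_le V VA (card ?X)"
      proof (rule codim_le_family[where f = "\<lambda>(i, j) v. F v i j"])
        fix v assume v: "v \<in> V" "\<And>a. a \<in> ?X \<Longrightarrow> (case a of (i, j) \<Rightarrow> \<lambda>v. F v i j) v = 0"
        have z1: "F v b j = 0" if "b < r" "b \<noteq> i0" "j < r" for b j using v(2)[of "(b, j)"] that by simp
        have z2: "F v i0 j0 = 0" using v(2)[of "(i0, j0)"] by simp
        have "F v i0 j = 0" if j: "j < r" "j \<noteq> j0" for j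
        proof -
          have "(\<Sum>b<r. T (s0 + v) b j * l b) = 0" "(\<Sum>b<r. T s0 b j * l b) = 0"
            using lT s0 S_add[OF s0 v(1)] j by auto
          then have "(\<Sum>b<r. T v b j * l b) = 0"
            by (simp add: T_def elim_cols_add algebra_simps sum.distrib)
          moreover have "(\<Sum>b<r. T v b j * l b) = (\<Sum>b<r. if b = i0 then F v i0 j * l i0 else 0)"
            by (intro sum.cong refl) (use z1 z2 j j0 in \<open>auto simp: T_upper\<close>)
          ultimately show ?thesis using i0 by simp
        qed
        then have "F v b j = 0" if "b < r" "j < r" for b j
          using z1[of b j] z2 that by (cases "b = i0"; cases "j = j0") auto
        then show "v \<in> VA" using v(1) by (simp add: VA_def)
      qed (use entry in auto)
      moreover have "card ?X = (r - 1) * r + 1"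
        using i0 by (subst card_Un_disjoint) (auto simp: card_cartesian_product)
      ultimately have "codim_le V VA ((r - 1) * r + 1)" by (simp only:)
      then show ?thesis using large_VA by blast
    qed
  next
    case False
    show ?thesis
    proof (rule ccontr)
      assume nz: "F s a j1 \<noteq> 0"
      obtain t where t: "t \<in> S" "F t a j1 = F s a j1" "fdet r (F t) \<noteq> 0"
        using exists_invertible_section[OF entry s] by blast
      obtain z where z: "\<And>b. b < r \<Longrightarrow> (\<Sum>k<r. F t b k * z k) = F t b j1"
        using fdet_solve[OF t(3), of "\<lambda>b. F t b j1"] by blast
      \<comment> \<open>Adding \<open>v\<close> changes neither the upper rows nor the entry
        \<open>(i, j1)\<close>, so the same \<open>z\<close> solves the system at
        \<open>t + v\<close>. The difference of the two Schur relations is the lower left row of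
        \<open>v\<close> applied to \<open>z\<close>.\<close>
      have "ann z"
        unfolding ann_def
      proof (intro ballI allI impI)
        fix v i assume v: "v \<in> VA" and i: "r \<le> i" "i < n"
        have vB: "v \<in> VB" using v VAB by blast
        have tv: "t + v \<in> S" using t v VA_sub S_add by blast
        have zero: "F v b j = 0" if "b < r" "j < n" for b j
          using vB v that by (cases "j < r") (auto simp: VB_def VA_def)
        have "F t i j1 = (\<Sum>k<r. F t i k * z k)"
          by (rule schur[OF t(1) i(2) j1(2) t(3) z])
        moreover have "F (t + v) i j1 = (\<Sum>k<r. F (t + v) i k * z k)"
        proof (rule schur[OF tv i(2) j1(2)])
          have "fdet r (F (t + v)) = fdet r (F t)"
            by (rule fdet_cong) (use zero r_less in \<open>auto simp: F_add\<close>)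
          then show "fdet r (F (t + v)) \<noteq> 0" using t(3) by simp
          show "(\<Sum>k<r. F (t + v) b k * z k) = F (t + v) b j1" if "b < r" for b
            using z[OF that] zero[OF that] r_less j1 by (simp add: F_add)
        qed
        ultimately show "(\<Sum>k<r. F v i k * z k) = 0"
          using VB_D[OF vB j1 i(2)] by (simp add: F_add algebra_simps sum.distrib)
      qed
      then have "\<And>k. k < r \<Longrightarrow> z k = 0" using False by blast
      then show False using z[OF a] t(2) nz by simp
    qed
  qed
qed

text \<open>Once \<open>C = 0\<close> on all of \<open>S\<close>, the Schur complement of an
  invertible \<open>A\<close> is \<open>D\<close>, and a member with invertible \<open>A\<close> and
  the same entry of \<open>D\<close> exists.\<close>

lemma right_zero:
  assumes IH: "square_bound (r - 1)"
    and h: "h \<in> VB" and i: "r \<le> i" "i < n" and j0: "j0 < r" "F h i j0 \<noteq> 0"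
    and s: "s \<in> S" and a: "a < n" and j: "r \<le> j" "j < n"
  shows "F s a j = 0"
proof (cases "a < r")
  case True
  then show ?thesis using upper_right_zero[OF IH h i j0 s _ j] by simp
next
  case False
  show ?thesis
  proof (rule ccontr)
    assume nz: "F s a j \<noteq> 0"
    obtain t where t: "t \<in> S" "F t a j = F s a j" "fdet r (F t) \<noteq> 0"
      using exists_invertible_section[OF entry s] by blast
    have "F t a j = (\<Sum>k<r. F t a k * 0)"
      by (rule schur[OF t(1) a j(2) t(3)]) (use upper_right_zero[OF IH h i j0 t(1) _ j] in simp)
    then show False using t(2) nz by simp
  qed
qed

end

section \<open>Polarization when no direction is supported in the lower left block\<close>

text \<open>For fixed \<open>X\<close> the determinant is bilinear in \<open>c\<close> and
  \<open>b\<close> plus a linear term in \<open>d\<close>. Its second difference cancels the latter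
  and leaves the two cross terms, in every characteristic.\<close>

lemma fdet_border_polarization:
  fixes X :: "nat \<Rightarrow> nat \<Rightarrow> 'a::comm_ring_1"
  assumes "fdet (Suc k) (border k X c b d) = 0"
    "fdet (Suc k) (border k X (\<lambda>i. c i + x i) (\<lambda>j. b j + y j) (d + e)) = 0"
    "fdet (Suc k) (border k X (\<lambda>i. c i + x' i) (\<lambda>j. b j + y' j) (d + e')) = 0"
    "fdet (Suc k) (border k X (\<lambda>i. c i + x i + x' i) (\<lambda>j. b j + y j + y' j) (d + e + e')) = 0"
  shows "fdet (Suc k) (border k X x y' 0) + fdet (Suc k) (border k X x' y 0) = 0"
proof -
  define B where "B c b = fdet (Suc k) (border k X c b 0)" for c b
  have corner: "fdet (Suc k) (border k X c b d) = B c b + d * fdet k X" for c b d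
    using fdet_border_corner[of k X c b 0 d] by (simp add: B_def)
  have col: "B (\<lambda>i. c i + c' i) b = B c b + B c' b" for c c' b
    using fdet_border_add_column[of k X c c' b 0 0] by (simp add: B_def)
  have row: "B c (\<lambda>i. b i + b' i) = B c b + B c b'" for c b b'
    using fdet_border_add_row[of k X c b b' 0 0] by (simp add: B_def)
  have "B x y' + B x' y
      = fdet (Suc k) (border k X (\<lambda>i. c i + x i + x' i) (\<lambda>j. b j + y j + y' j) (d + e + e'))
      - fdet (Suc k) (border k X (\<lambda>i. c i + x i) (\<lambda>j. b j + y j) (d + e))
      - fdet (Suc k) (border k X (\<lambda>i. c i + x' i) (\<lambda>j. b j + y' j) (d + e'))
      + fdet (Suc k) (border k X c b d)"
    unfolding corner col row by (simp add: algebra_simps)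
  then show ?thesis unfolding assms by (simp add: B_def)
qed

text \<open>Adding \<open>x i * u j\<close> to \<open>X\<close> is a column operation when the last
  column is \<open>x\<close> with zero corner.\<close>

lemma fdet_border_rank_one_shift:
  fixes X :: "nat \<Rightarrow> nat \<Rightarrow> 'a::comm_ring_1"
  shows "fdet (Suc k) (border k (\<lambda>i j. X i j + x i * u j) x y 0) = fdet (Suc k) (border k X x y 0)"
proof -
  have eq: "fdet k (\<lambda>i j. X i j + x i * u j + x i * y j) = fdet k (\<lambda>i j. X i j + x i * (u j + y j))"
    by (rule fdet_cong) (simp add: algebra_simps)
  have "fdet (Suc k) (border k X x (\<lambda>j. u j + y j) 0)
      = fdet (Suc k) (border k X x u 0) + fdet (Suc k) (border k X x y 0)"
    using fdet_border_add_row[of k X x u y 0 0] by simp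
  then have "fdet k X - fdet k (\<lambda>i j. X i j + x i * (u j + y j))
      = fdet k X - fdet k (\<lambda>i j. X i j + x i * u j) + fdet (Suc k) (border k X x y 0)"
    by (simp only: fdet_border_rank_one_update[of k X x u]
        fdet_border_rank_one_update[of k X x "\<lambda>j. u j + y j"])
  then show ?thesis
    unfolding fdet_border_rank_one_update[of k "\<lambda>i j. X i j + x i * u j"] eq
    by (simp add: algebra_simps)
qed

text \<open>With \<open>Z = [X x'; y 0]\<close>, the rank one update formula turns equality of the
  two determinants into singularity of \<open>Z\<close> bordered by \<open>(x, 0)\<close> and
  \<open>(u, 0)\<close>; \<open>v\<close>, \<open>\<alpha>\<close>, \<open>\<beta>\<close> are the
  parts of a kernel vector.\<close>

lemma bordered_kernel:
  fixes X :: "nat \<Rightarrow> nat \<Rightarrow> 'a::field"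
  assumes "fdet (Suc k) (border k (\<lambda>i j. X i j + x i * u j) x' y 0) = fdet (Suc k) (border k X x' y 0)"
  obtains v \<alpha> \<beta> where "(\<exists>j<k. v j \<noteq> 0) \<or> \<alpha> \<noteq> 0 \<or> \<beta> \<noteq> 0"
    "\<And>i. i < k \<Longrightarrow> (\<Sum>j<k. X i j * v j) + x' i * \<alpha> + x i * \<beta> = 0"
    "(\<Sum>j<k. y j * v j) = 0" "(\<Sum>j<k. u j * v j) = 0"
proof -
  define Z where "Z = border k X x' y 0"
  define p where "p i = (if i < k then x i else 0)" for i
  define q where "q j = (if j < k then u j else 0)" for j
  have "fdet (Suc k) (\<lambda>i j. Z i j + p i * q j)
      = fdet (Suc k) (border k (\<lambda>i j. X i j + x i * u j) x' y 0)"
    by (rule fdet_cong) (auto simp: Z_def p_def q_def border_def)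
  then have "fdet (Suc (Suc k)) (border (Suc k) Z p q 0) = 0"
    using assms by (simp add: fdet_border_rank_one_update Z_def)
  from fdet_eq_0_right_kernel[OF this] obtain v where nz: "\<exists>j<Suc (Suc k). v j \<noteq> 0"
    and v: "\<And>i. i < Suc (Suc k) \<Longrightarrow> (\<Sum>j<Suc (Suc k). border (Suc k) Z p q 0 i j * v j) = 0"
    by blast
  show ?thesis
  proof (rule that[of v "v k" "v (Suc k)"])
    show "(\<exists>j<k. v j \<noteq> 0) \<or> v k \<noteq> 0 \<or> v (Suc k) \<noteq> 0"
      using nz by (auto simp: less_Suc_eq)
    show "(\<Sum>j<k. X i j * v j) + x' i * v k + x i * v (Suc k) = 0" if "i < k" for i
      using v[of i] that by (simp add: Z_def p_def border_def)
    show "(\<Sum>j<k. y j * v j) = 0"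
      using v[of k] by (simp add: Z_def p_def border_def)
    show "(\<Sum>j<k. u j * v j) = 0"
      using v[of "Suc k"] by (simp add: q_def border_def)
  qed
qed

text \<open>On vectors orthogonal to \<open>y\<close>, clearing with the pivot \<open>y j0\<close>
  preserves the value of a row, so kernel vectors survive the loss of coordinate
  \<open>j0\<close>.\<close>

lemma sum_elim:
  fixes y :: "nat \<Rightarrow> 'a::field"
  assumes "finite J" "j0 \<in> J" "y j0 \<noteq> 0" "(\<Sum>j\<in>J. y j * v j) = 0"
  shows "(\<Sum>j\<in>J - {j0}. (\<rho> j - y j / y j0 * \<rho> j0) * v j) = (\<Sum>j\<in>J. \<rho> j * v j)"
proof -
  have "(\<Sum>j\<in>J - {j0}. y j * v j) = - (y j0 * v j0)"
    using assms by (simp add: sum.remove[of J j0] eq_neg_iff_add_eq_0 add.commute)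
  then have "(\<Sum>j\<in>J - {j0}. \<rho> j0 / y j0 * (y j * v j)) = - (\<rho> j0 * v j0)"
    using assms(3) by (simp only: sum_distrib_left[symmetric]) simp
  moreover have "(\<Sum>j\<in>J - {j0}. (\<rho> j - y j / y j0 * \<rho> j0) * v j)
      = (\<Sum>j\<in>J - {j0}. \<rho> j * v j) - (\<Sum>j\<in>J - {j0}. \<rho> j0 / y j0 * (y j * v j))"
    by (simp add: sum_subtractf[symmetric] algebra_simps)
  ultimately show ?thesis using assms by (simp add: sum.remove[of J j0])
qed

lemma (in parameter_space) subspace_projection:
  assumes "subspace U"
  obtains \<pi> where "\<And>v. \<pi> v \<in> U" "\<And>v. v \<in> U \<Longrightarrow> \<pi> v = v"
    "\<And>x y. \<pi> (x + y) = \<pi> x + \<pi> y" "\<And>c x. \<pi> (c *s x) = c *s \<pi> x"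
proof -
  interpret pair: vector_space_pair scale scale by unfold_locales
  have "Vector_Spaces.linear scale scale (\<lambda>v. v)" by (rule linear_ident)
  from pair.linear_exists_left_inverse_on[OF this assms] obtain g where
    g: "range g \<subseteq> U" "Vector_Spaces.linear scale scale g" "\<forall>v\<in>U. g v = v"
    by (auto simp: inj_on_def)
  show ?thesis
    by (rule that[of g]) (use g in \<open>auto simp: Vector_Spaces.linear_iff\<close>)
qed

context large_square_family
begin

text \<open>Suppose that on \<open>VA\<close> the entry \<open>(i0, r)\<close> being zero forced the
  upper part of column \<open>r\<close> to vanish. Then \<open>r * r\<close> equations for
  \<open>A\<close>, one for this entry and \<open>r * (n - r - 1)\<close> for the other right
  columns would lead to \<open>VB\<close>, hence to \<open>N\<close>; their number is exactly the
  threshold.\<close>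

lemma exists_independent_columns:
  assumes noB: "VB \<subseteq> N" and BC: "\<And>v. v \<in> VA \<Longrightarrow> (\<And>i k. r \<le> i \<Longrightarrow> i < n \<Longrightarrow> k < r \<Longrightarrow> F v i k = 0) \<Longrightarrow> v \<in> VB"
    and i0: "i0 < r"
  shows "\<exists>v\<in>VA. F v i0 r = 0 \<and> (\<exists>i<r. F v i r \<noteq> 0)"
proof (rule ccontr)
  assume neg: "\<not> ?thesis"
  let ?X = "insert (i0, r) ({..<r} \<times> {Suc r..<n})"
  have "codim_le VA VB (card ?X)"
  proof (rule codim_le_family[where f = "\<lambda>(i, j) v. F v i j"])
    fix v assume v: "v \<in> VA" "\<And>a. a \<in> ?X \<Longrightarrow> (case a of (i, j) \<Rightarrow> \<lambda>v. F v i j) v = 0"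
    have "F v i0 r = 0" using v(2)[of "(i0, r)"] by simp
    then have c0: "F v i r = 0" if "i < r" for i using neg v(1) that by blast
    have "F v i j = 0" if "i < r" "r \<le> j" "j < n" for i j
      using v(2)[of "(i, j)"] c0[of i] that by (cases "j = r") auto
    then show "v \<in> VB" using v(1) by (simp add: VB_def)
  qed (use entry in auto)
  moreover have "card ?X = 1 + r * (n - Suc r)"
    by (subst card_insert_disjoint) (auto simp: card_cartesian_product)
  ultimately have "codim_le VA N (1 + r * (n - Suc r))"
    using codim_le_mono[OF _ subset_refl noB] by fastforce
  then have "codim_le V N (r * r + (1 + r * (n - Suc r)))"
    by (rule codim_le_trans[OF codim_VA])
  moreover have "r * r + (1 + r * (n - Suc r)) = (n - 1) * r + 1"
  proof -
    obtain q where "n = Suc r + q" using r_less by (metis less_iff_Suc_add add_Suc)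
    then show ?thesis by (simp add: algebra_simps)
  qed
  ultimately show False using large by simp
qed

text \<open>If the lower left blocks of \<open>VA\<close> determine the upper right ones and conversely, take two
  elements \<open>v1\<close>, \<open>v2\<close> of \<open>VA\<close> with linearly independent columns \<open>x\<close>, \<open>x'\<close> and lower rows
  \<open>y \<noteq> 0\<close>, \<open>y'\<close>.  Polarizing the bordered minors along \<open>v1\<close>, \<open>v2\<close> and along the directions
  whose upper left block is \<open>x u\<^sup>T\<close> shows that the matrix with rows \<open>[A x' x]\<close>, \<open>[y 0 0]\<close>,
  \<open>[u 0 0]\<close> is singular.\<close>

lemma exists_upper_right:
  assumes noB: "VB \<subseteq> N"
  shows "\<exists>h\<in>VA. (\<forall>i k. r \<le> i \<longrightarrow> i < n \<longrightarrow> k < r \<longrightarrow> F h i k = 0) \<and>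
    (\<exists>i<r. \<exists>j. r \<le> j \<and> j < n \<and> F h i j \<noteq> 0)"
proof (rule ccontr)
  assume neg: "\<not> ?thesis"
  have BC: "v \<in> VB" if "v \<in> VA" "\<And>i k. r \<le> i \<Longrightarrow> i < n \<Longrightarrow> k < r \<Longrightarrow> F v i k = 0" for v
    using neg that unfolding VB_def by blast
  have r0: "0 < r" using r_ge_2 by simp
  \<comment> \<open>\<open>i1\<close> is a place where \<open>x'\<close> is nonzero;
    \<open>x\<close> is then chosen nonzero but zero at \<open>i1\<close>, which makes the two
    columns independent.\<close>
  obtain v2 i1 where v2: "v2 \<in> VA" and i1: "i1 < r" and x'1: "F v2 i1 r \<noteq> 0"
    using exists_independent_columns[OF noB BC r0] by blast
  obtain v1 i2 where v1: "v1 \<in> VA" and x1: "F v1 i1 r = 0" and i2: "i2 < r" and x2: "F v1 i2 r \<noteq> 0"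
    using exists_independent_columns[OF noB BC i1] by blast
  have i12: "i1 \<noteq> i2" using x1 x2 by auto
  have "v1 \<notin> VB" using x2 i2 r_less by (auto simp: VB_def)
  then obtain i3 j0 where i3: "r \<le> i3" "i3 < n" and j0: "j0 < r" and y0: "F v1 i3 j0 \<noteq> 0"
    using BC[OF v1] by blast
  define x where "x i = F v1 i r" for i
  define x' where "x' i = F v2 i r" for i
  define y where "y j = F v1 i3 j" for j
  define y' where "y' j = F v2 i3 j" for j
  note nz = x'1[folded x'_def] x1[folded x_def] x2[folded x_def] y0[folded y_def]
  have upper: "border r (F (s + v)) c b d i j = border r (F s) c b d i j" if "v \<in> VA" for s v c b d i j
    using that by (auto simp: border_def F_add VA_def)
  have polar: "fdet (Suc r) (border r (F s) x y' 0) + fdet (Suc r) (border r (F s) x' y 0) = 0"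
    if s: "s \<in> S" for s
  proof -
    have minor: "fdet (Suc r) (border r (F s) (\<lambda>a. F (s + v) a r) (\<lambda>b. F (s + v) i3 b) (F (s + v) i3 r)) = 0"
      if v: "v \<in> VA" for v
    proof -
      have "s + v \<in> S" using v s VA_sub S_add by blast
      from bordered_minor[OF this i3(2) r_less] show ?thesis
        using upper[OF v] by (metis (no_types, lifting) fdet_cong)
    qed
    have V0: "0 \<in> VA" and V12: "v1 + v2 \<in> VA"
      using subspace_VA v1 v2 by (auto simp: subspace_0 subspace_add)
    show ?thesis
      by (rule fdet_border_polarization[where c = "\<lambda>a. F s a r" and b = "F s i3" and d = "F s i3 r"
          and e = "F v1 i3 r" and e' = "F v2 i3 r"])
         (use minor[OF V0] minor[OF v1] minor[OF v2] minor[OF V12]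
          in \<open>simp_all add: F_add F_0 x_def x'_def y_def y'_def add.assoc\<close>)
  qed
  \<comment> \<open>Directions whose upper left block is \<open>x\<close> times a row vector; that
    vector is row \<open>i2\<close> divided by \<open>x i2\<close>.\<close>
  define V1 where "V1 = {h \<in> V. \<forall>i<r. \<forall>k<r. F h i k * x i2 = x i * F h i2 k}"
  have "subspace V1"
    using subspace_V unfolding subspace_def V1_def by (auto simp: F_add F_scale F_0 algebra_simps)
  then obtain \<pi> where \<pi>: "\<And>v. \<pi> v \<in> V1" "\<And>v. v \<in> V1 \<Longrightarrow> \<pi> v = v"
    "\<And>v w. \<pi> (v + w) = \<pi> v + \<pi> w" "\<And>c v. \<pi> (c *s v) = c *s \<pi> v"
    using subspace_projection by metis
  \<comment> \<open>\<open>c\<close> and \<open>\<tau>\<close> are such that row \<open>i\<close>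
    minus \<open>c i\<close> times row \<open>i2\<close> minus \<open>\<tau> i\<close> times row
    \<open>i1\<close> is zero in the columns \<open>x\<close> and \<open>x'\<close>; here
    \<open>x i1 = 0\<close> is used.\<close>
  define c where "c i = x i / x i2" for i
  define \<tau> where "\<tau> i = (x' i - c i * x' i2) / x' i1" for i
  define R where "R s i j = F s i j - c i * F s i2 j - \<tau> i * F s i1 j" for s i j
  \<comment> \<open>Row \<open>i2\<close> is consumed as a pivot, and its slot holds the row
    \<open>u\<close> up to the factor \<open>x i2\<close>. Reading it off the projection
    \<open>\<pi> s\<close> onto \<open>V1\<close> makes it linear in \<open>s\<close>.\<close>
  define \<rho> where "\<rho> s i j = (if i = i2 then F (\<pi> s) i2 j else R s i j)" for s i j
  define G where "G s i j = \<rho> s i j - y j / y j0 * \<rho> s i j0" for s i j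
  have singular: "\<exists>v. (\<exists>j\<in>{..<r} - {j0}. v j \<noteq> 0) \<and> (\<forall>i\<in>{..<r} - {i1}. (\<Sum>j\<in>{..<r} - {j0}. G s i j * v j) = 0)"
    if s: "s \<in> S" for s
  proof -
    define h where "h = \<pi> s"
    define u where "u j = F h i2 j / x i2" for j
    have h: "h \<in> V" "\<And>i k. i < r \<Longrightarrow> k < r \<Longrightarrow> F h i k = x i * u k"
      using \<pi>(1)[of s] nz by (auto simp: h_def V1_def u_def field_simps)
    have "s + h \<in> S" using s h S_add by blast
    have shift: "fdet (Suc r) (border r (F (s + h)) c b d)
        = fdet (Suc r) (border r (\<lambda>i j. F s i j + x i * u j) c b d)" for c b d
      by (rule fdet_cong) (auto simp: border_def F_add h)
    \<comment> \<open>The shift along \<open>h\<close> leaves the polarized term with column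
      \<open>x\<close> unchanged; as the two terms sum to zero before and after, it leaves the one
      with column \<open>x'\<close> unchanged too.\<close>
    have "fdet (Suc r) (border r (\<lambda>i j. F s i j + x i * u j) x' y 0) = fdet (Suc r) (border r (F s) x' y 0)"
    proof -
      have "fdet (Suc r) (border r (F (s + h)) x y' 0) = fdet (Suc r) (border r (F s) x y' 0)"
        by (rule trans[OF shift fdet_border_rank_one_shift])
      then have "fdet (Suc r) (border r (F (s + h)) x' y 0) = fdet (Suc r) (border r (F s) x' y 0)"
        using minus_unique[OF polar[OF s]] minus_unique[OF polar[OF \<open>s + h \<in> S\<close>]] by simp
      then show ?thesis by (simp only: shift)
    qed
    from bordered_kernel[OF this] obtain v \<alpha> \<beta> where
      v: "(\<exists>j<r. v j \<noteq> 0) \<or> \<alpha> \<noteq> 0 \<or> \<beta> \<noteq> 0"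
      "\<And>i. i < r \<Longrightarrow> (\<Sum>j<r. F s i j * v j) + x' i * \<alpha> + x i * \<beta> = 0"
      "(\<Sum>j<r. y j * v j) = 0" "(\<Sum>j<r. u j * v j) = 0" by blast
    have row: "(\<Sum>j<r. F s i j * v j) = - (x' i * \<alpha> + x i * \<beta>)" if "i < r" for i
      using v(2)[OF that] by (simp only: add.assoc eq_neg_iff_add_eq_0)
    have "\<exists>j\<in>{..<r} - {j0}. v j \<noteq> 0"
    proof (rule ccontr)
      assume "\<not> ?thesis"
      then have z: "v j = 0" if "j < r" "j \<noteq> j0" for j using that by blast
      have "(\<Sum>j<r. y j * v j) = (\<Sum>j<r. if j = j0 then y j0 * v j0 else 0)"
        by (intro sum.cong refl) (use z in auto)
      then have "v j0 = 0" using v(3) nz j0 by simp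
      then have z: "v j = 0" if "j < r" for j using z that by blast
      have "\<alpha> = 0" using v(2)[OF i1] z nz by simp
      moreover have "\<beta> = 0" using v(2)[OF i2] z nz \<open>\<alpha> = 0\<close> by simp
      ultimately show False using v(1) z by blast
    qed
    moreover have "(\<Sum>j\<in>{..<r} - {j0}. G s i j * v j) = 0" if i: "i \<in> {..<r} - {i1}" for i
    proof -
      have "(\<Sum>j\<in>{..<r} - {j0}. G s i j * v j) = (\<Sum>j<r. \<rho> s i j * v j)"
        unfolding G_def by (rule sum_elim) (use j0 nz v in auto)
      also have "\<dots> = 0"
      proof (cases "i = i2")
        case True
        have "(\<Sum>j<r. \<rho> s i j * v j) = x i2 * (\<Sum>j<r. u j * v j)"
          unfolding sum_distrib_left using True nz by (intro sum.cong refl) (simp add: \<rho>_def h_def[symmetric] u_def)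
        then show ?thesis using v(4) by simp
      next
        case False
        have "(\<Sum>j<r. \<rho> s i j * v j) = (\<Sum>j<r. F s i j * v j) - c i * (\<Sum>j<r. F s i2 j * v j)
            - \<tau> i * (\<Sum>j<r. F s i1 j * v j)"
          unfolding sum_distrib_left sum_subtractf[symmetric]
          by (intro sum.cong refl) (simp add: \<rho>_def R_def False algebra_simps)
        also have "\<dots> = \<alpha> * (\<tau> i * x' i1 - (x' i - c i * x' i2)) + \<beta> * (c i * x i2 - x i)"
          unfolding row[OF i1] row[OF i2] using i nz by (subst row) (auto simp: algebra_simps)
        also have "\<dots> = 0"
          using nz by (simp add: c_def \<tau>_def)
        finally show ?thesis .
      qed
      finally show ?thesis .
    qed
    ultimately show ?thesis by blast
  qed
  have cJ: "card ({..<r} - {j0}) = r - 1" and cI: "card ({..<r} - {i1}) = r - 1"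
    using j0 i1 by simp_all
  have Grank: "rank_less ({..<r} - {i1}) ({..<r} - {j0}) (Suc (r - 2)) (G s)" if s: "s \<in> S" for s
  proof -
    obtain v where v: "\<exists>j\<in>{..<r} - {j0}. v j \<noteq> 0"
      "\<And>i. i \<in> {..<r} - {i1} \<Longrightarrow> (\<Sum>j\<in>{..<r} - {j0}. G s i j * v j) = 0"
      using singular[OF s] by blast
    have "rank_less ({..<r} - {i1}) ({..<r} - {j0}) (card ({..<r} - {j0})) (G s)"
      by (rule rank_less_kernel[OF _ v]) simp_all
    moreover have "Suc (r - 2) = r - 1" using r_ge_2 by simp
    ultimately show ?thesis by (simp only: cJ)
  qed
  have \<rho>_lin: "linear_form (\<lambda>s. \<rho> s i j)" for i j
  proof (cases "i = i2")
    case True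
    then show ?thesis by (simp add: \<rho>_def linear_form_def \<pi> F_add F_scale)
  next
    case False
    have "linear_form (\<lambda>s. R s i j)"
      unfolding R_def by (intro linear_form_diff_fun linear_form_mult entry)
    then show ?thesis using False by (simp add: \<rho>_def)
  qed
  have Glin: "linear_family G"
    unfolding linear_family_def G_def by (intro allI linear_form_diff_fun linear_form_mult \<rho>_lin)
  let ?N = "null_space ({..<r} - {i1}) ({..<r} - {j0}) V G"
  have "codim_le V ?N (max (card ({..<r} - {i1})) (card ({..<r} - {j0})) * (r - 2))"
    by (rule flanders_affine[OF _ _ affine Glin Grank]) auto
  then have c1: "codim_le V ?N ((r - 1) * (r - 2))" unfolding cJ cI by simp
  \<comment> \<open>These equations together with \<open>G v = 0\<close> first put \<open>v\<close>
    into \<open>V1\<close>. There \<open>\<pi> v = v\<close>, so the slot \<open>i2\<close> of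
    \<open>G v\<close> controls the true row \<open>i2\<close>, and all of \<open>A\<close>
    vanishes.\<close>
  let ?X = "{..<r} \<times> {j0} \<union> {i1} \<times> ({..<r} - {j0})"
  have "codim_le ?N VA (card ?X)"
  proof (rule codim_le_family[where f = "\<lambda>(i, j) v. F v i j"])
    fix v assume v: "v \<in> ?N" "\<And>a. a \<in> ?X \<Longrightarrow> (case a of (i, j) \<Rightarrow> \<lambda>v. F v i j) v = 0"
    have vV: "v \<in> V" and vG: "\<And>i j. i < r \<Longrightarrow> i \<noteq> i1 \<Longrightarrow> j < r \<Longrightarrow> j \<noteq> j0 \<Longrightarrow> G v i j = 0"
      using v(1) by (auto simp: null_space_def)
    have col0: "F v i j0 = 0" if "i < r" for i using v(2)[of "(i, j0)"] that by simp
    have row1: "F v i1 j = 0" if "j < r" for j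
      using v(2)[of "(i1, j)"] col0[OF i1] that by (cases "j = j0") auto
    have R0: "R v i j0 = 0" if "i < r" for i
      using col0 that i1 i2 by (simp add: R_def)
    have "F v i j * x i2 = x i * F v i2 j" if "i < r" "j < r" for i j
    proof (cases "i = i1 \<or> i = i2 \<or> j = j0")
      case True
      then show ?thesis using row1 col0 that nz i2 by auto
    next
      case False
      then have "R v i j = 0" using vG[of i j] R0[of i] that by (simp add: G_def \<rho>_def)
      then show ?thesis using row1[OF that(2)] nz by (simp add: R_def c_def field_simps)
    qed
    then have "v \<in> V1" using vV by (simp add: V1_def)
    have "F v i2 j = 0" if "j < r" for j
      using vG[of i2 j] col0[OF i2] that i12 i2 \<pi>(2)[OF \<open>v \<in> V1\<close>]
      by (cases "j = j0") (auto simp: G_def \<rho>_def)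
    then have "F v i j = 0" if "i < r" "j < r" for i j
      using \<open>v \<in> V1\<close> that nz by (auto simp: V1_def)
    then show "v \<in> VA" using vV by (simp add: VA_def)
  qed (use entry in auto)
  moreover have "card ?X = r + (r - 1)"
    using j0 by (subst card_Un_disjoint) (auto simp: card_cartesian_product)
  ultimately have "codim_le V VA ((r - 1) * (r - 2) + (r + (r - 1)))"
    using codim_le_trans[OF c1] by metis
  then show False using large_VA codim_bound_arith by metis
qed

end

section \<open>Conclusion of the square case\<close>

context parameter_space
begin

lemma null_space_transpose: "null_space J I V (\<lambda>s i j. F s j i) = null_space I J V F"
  by (auto simp: null_space_def)

lemma kernel_form_zero_columns:
  assumes "\<And>s i j. s \<in> S \<Longrightarrow> i < n \<Longrightarrow> r \<le> j \<Longrightarrow> j < p \<Longrightarrow> F s i j = 0"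
  shows "kernel_form {..<n} {..<p} r S F"
  unfolding kernel_form_def
proof (intro exI[of _ unit] allI impI ballI)
  fix z s i assume z: "\<forall>l<r. (\<Sum>j<p. unit l j * z j) = (0::'a)" and s: "s \<in> S" and i: "i \<in> {..<n}"
  have "F s i j * z j = 0" if "j < p" for j
    using z sum_unit_left[of "{..<p}" j z] assms[OF s _ _ that, of i] i that by (cases "j < r") auto
  then show "(\<Sum>j<p. F s i j * z j) = 0" by (intro sum.neutral ballI) simp
qed

lemma kernel_form_rank_zero:
  assumes "finite I" "finite J" "\<And>s. s \<in> S \<Longrightarrow> rank_less I J (Suc 0) (F s)"
  shows "kernel_form I J 0 S F"
  using rank_less_Suc_0[OF assms(3) assms(1,2)] by (simp add: kernel_form_def)

theorem square_bound_holds: "square_bound r"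
proof (induction r)
  case 0
  then show ?case unfolding square_bound_def using kernel_form_rank_zero by blast
next
  case (Suc r)
  show ?case
    unfolding square_bound_def
  proof (intro allI impI)
    fix I J S V and F :: "'b \<Rightarrow> nat \<Rightarrow> nat \<Rightarrow> 'a"
    assume fin: "finite I" "finite J" and cJ: "card J = card I" and rn: "Suc r < card I"
      and aff: "affine_on S V" and lin: "linear_family F"
      and rank: "\<forall>s\<in>S. rank_less I J (Suc (Suc r)) (F s)"
      and large: "\<not> codim_le V (null_space I J V F) ((card I - 1) * Suc r + 1)"
    let ?n = "card I"
    have "\<exists>s\<in>S. \<not> rank_less I J (Suc r) (F s)"
    proof (rule ccontr)
      assume "\<not> ?thesis"
      then have "codim_le V (null_space I J V F) (max ?n (card J) * r)"
        by (intro flanders_affine[OF fin aff lin]) blast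
      \<comment> \<open>If the top rank were never attained, Flanders' bound would not exceed the
        threshold.\<close>
      moreover have "?n * r \<le> (?n - 1) * Suc r + 1"
      proof -
        obtain q where "?n = Suc (Suc r) + q" using rn by (metis less_iff_Suc_add add_Suc)
        then show ?thesis by simp
      qed
      ultimately show False using large codim_le_mono[OF _ subset_refl subset_refl] cJ by fastforce
    qed
    then obtain s0 where s0: "s0 \<in> S" "\<not> rank_less I J (Suc r) (F s0)" by blast
    obtain G where G: "normal_family scale S V G ?n ?n (Suc r) s0"
      and null: "null_space {..<?n} {..<?n} V G = null_space I J V F"
      and col: "\<forall>k. kernel_form {..<?n} {..<?n} k S G \<longrightarrow> kernel_form I J k S F"
      and row: "\<forall>k. kernel_form {..<?n} {..<?n} k S (\<lambda>s i j. G s j i) \<longrightarrow>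
        kernel_form J I k S (\<lambda>s i j. F s j i)"
      by (rule normal_form_exists[OF fin aff lin rank[rule_format] s0, unfolded cJ], assumption) (rule that)
    have large': "\<not> codim_le V (null_space {..<?n} {..<?n} V G) ((?n - 1) * Suc r + 1)"
      using large by (simp only: null not_False_eq_True)
    interpret A: large_square_family scale S V G ?n "Suc r" s0
      using G rn large' by (intro large_square_family.intro large_square_family_axioms.intro)
    interpret B: large_square_family scale S V "\<lambda>s i j. G s j i" ?n "Suc r" s0
      using A.transposed rn large' null_space_transpose[of "{..<?n}" "{..<?n}" V G]
      by (intro large_square_family.intro large_square_family_axioms.intro) simp_all
    have IH: "square_bound (Suc r - 1)" using Suc.IH by simp
    show "kernel_form I J (Suc r) S F \<or> kernel_form J I (Suc r) S (\<lambda>s i j. F s j i)"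
    proof (cases "A.VB \<subseteq> A.N")
      case False
      then obtain h i k where "h \<in> A.VB" and hk: "Suc r \<le> i" "i < ?n" "k < Suc r" "G h i k \<noteq> 0"
        using A.null_spaceI by blast
      then show ?thesis proof -
        have "kernel_form {..<?n} {..<?n} (Suc r) S G"
          by (rule kernel_form_zero_columns) (rule A.right_zero[OF IH \<open>h \<in> A.VB\<close> hk])
        then show ?thesis using col by blast
      qed
    next
      case True
      then obtain h i j where h: "h \<in> A.VA"
        "\<And>i k. Suc r \<le> i \<Longrightarrow> i < ?n \<Longrightarrow> k < Suc r \<Longrightarrow> G h i k = 0"
        and ij: "i < Suc r" "Suc r \<le> j" "j < ?n" "G h i j \<noteq> 0"
        using A.exists_upper_right by blast
      have "h \<in> B.VB" using h by (auto simp: B.VB_def B.VA_def A.VA_def)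
      have "kernel_form {..<?n} {..<?n} (Suc r) S (\<lambda>s i j. G s j i)"
        by (rule kernel_form_zero_columns) (rule B.right_zero[OF IH \<open>h \<in> B.VB\<close> ij(2,3,1,4)])
      then show ?thesis using row by blast
    qed
  qed
qed

end

section \<open>Rectangular matrices\<close>

context normal_family
begin

abbreviation "row_space i \<equiv> null_space ({..<n} - {i}) {..<p} V F"

lemma subspace_row_space: "subspace (row_space i)"
  using subspace_V unfolding subspace_def null_space_def by (auto simp: F_add F_scale F_0)

lemma row_space_zero:
  "v \<in> row_space i \<Longrightarrow> a < n \<Longrightarrow> a \<noteq> i \<Longrightarrow> j < p \<Longrightarrow> F v a j = 0"
  by (simp add: null_space_def)

lemma row_space_lower:
  assumes "r \<le> i" "i < n"
  shows "row_space i \<subseteq> VB"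
  using assms r_le by (auto simp: VB_def VA_def null_space_def)

lemma exists_lower_row:
  assumes i: "r \<le> i" "i < n" and r: "0 < r" and ncd: "\<not> codim_le (row_space i) N (r - 1)"
  shows "\<exists>h\<in>row_space i. \<forall>k<r. F h i k = g k"
proof (rule codim_le_row_space[OF subspace_row_space entry _ ncd r])
  fix v assume v: "v \<in> row_space i" "\<And>k. k < r \<Longrightarrow> F v i k = 0"
  show "v \<in> N"
  proof (rule null_spaceI)
    show "v \<in> VB" using row_space_lower[OF i] v by blast
    fix a k assume "r \<le> a" "a < n" "k < r"
    then show "F v a k = 0" using v row_space_zero[OF v(1), of a k] r_le by (cases "a = i") auto
  qed
qed

text \<open>If all matrices supported on a single row of the lower left block are available, then no
  direction supported on an upper row has an entry in the right block: otherwise the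
  extraction lemma would produce a nonzero minor.\<close>

lemma upper_row_right_zero:
  assumes rn: "r < n" and ncd: "\<not> codim_le (row_space r) N (r - 1)"
    and h: "h \<in> row_space i" and i: "i < r" and j: "r \<le> j" "j < p"
  shows "F h i j = 0"
proof -
  obtain g where g: "g \<in> row_space r" "\<And>k. k < r \<Longrightarrow> F g r k = unit i k"
    using exists_lower_row[OF order_refl rn _ ncd, of "unit i"] i by auto
  have gB: "g \<in> VB" using row_space_lower[OF order_refl rn] g by blast
  have nz: "F g r i \<noteq> 0" using g i by (simp add: unit_def)
  define s where "s = s0 + h"
  have s: "s \<in> S" using s0 h S_add by (auto simp: s_def null_space_def)
  \<comment> \<open>Row \<open>r\<close> of \<open>g\<close> is a unit vector, so the column
    operation leaves the columns other than \<open>i\<close> as they are. With column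
    \<open>j\<close> in place of column \<open>i\<close>, the block of \<open>s0 + h\<close> is the
    identity except for row \<open>i\<close>, whose diagonal entry is
    \<open>F h i j\<close>.\<close>
  have "fdet r (\<lambda>a b. elim_cols (F g r) i s a (if b = i then j else b)) = 0"
    by (rule rank_less_minor[OF elim_cols_rank[OF gB order_refl rn i nz s]])
       (use i j r_le in auto)
  moreover have eq: "elim_cols (F g r) i s a (if b = i then j else b)
      = (if a = i then (if b = i then F h i j else F h i b) else if b = i then 0 else unit a b)"
    if "a < r" "b < r" for a b
    using that i j r_le g(2)[of b] row_space_zero[OF h, of a b] row_space_zero[OF h, of a j]
    by (auto simp: elim_cols_def s_def F_add base unit_def)
  ultimately have "fdet r (\<lambda>a b. if a = i then (if b = i then F h i j else F h i b)
      else if b = i then 0 else unit a b) = 0"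
    using fdet_cong[OF eq, of r] by simp
  from fdet_eq_0_right_kernel[OF this] obtain v where v: "\<exists>b<r. v b \<noteq> 0"
    and zero: "\<And>a. a < r \<Longrightarrow> (\<Sum>b<r. (if a = i then (if b = i then F h i j else F h i b)
      else if b = i then 0 else unit a b) * v b) = 0" by blast
  have v0: "v a = 0" if "a < r" "a \<noteq> i" for a
  proof -
    have "(\<Sum>b<r. (if b = i then 0 else unit a b) * v b) = (\<Sum>b<r. unit a b * v b)"
      by (intro sum.cong refl) (use that in \<open>auto simp: unit_def\<close>)
    then show ?thesis using zero[OF that(1)] that sum_unit_left[of "{..<r}" a v] by simp
  qed
  have "(\<Sum>b<r. (if b = i then F h i j else F h i b) * v b) = (\<Sum>b<r. if b = i then F h i j * v i else 0)"
    by (intro sum.cong refl) (use v0 in auto)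
  then have "F h i j * v i = 0" using zero[OF i] i by simp
  moreover have "v i \<noteq> 0" using v v0 by metis
  ultimately show ?thesis by simp
qed

text \<open>Any left part of any row is realized by a direction on that row with zero right part.
  Subtracting such directions from \<open>v\<close> leaves \<open>w\<close> with
  \<open>A = 0\<close> and \<open>B = 0\<close>; its \<open>C\<close> is orthogonal to all possible
  lower left rows, hence zero, and \<open>D = B C = 0\<close>.\<close>

lemma full_row_spaces:
  assumes rn: "r < n" and r: "0 < r" and ncd: "\<And>i. i < n \<Longrightarrow> \<not> codim_le (row_space i) N (r - 1)"
    and s: "s \<in> S" and a: "a < n" and j: "r \<le> j" "j < p"
  shows "F s a j = 0"
proof -
  have right: "F h b l = 0" if "h \<in> row_space i" "i < n" "b < n" "r \<le> l" "l < p" for h i b l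
  proof (cases "b = i")
    case True
    show ?thesis
    proof (cases "i < r")
      case i: True
      show ?thesis using upper_row_right_zero[OF rn ncd[OF rn] that(1) i that(4,5)] True by simp
    next
      case False
      then have "h \<in> VB" using row_space_lower[of i] that by auto
      then show ?thesis using VB_D that by blast
    qed
  qed (use row_space_zero that in blast)
  have full: "\<exists>h\<in>row_space i. \<forall>k<r. F h i k = g k" if i: "i < n" for i g
  proof (rule codim_le_row_space[OF subspace_row_space entry _ ncd[OF i] r])
    fix v assume v: "v \<in> row_space i" "\<And>k. k < r \<Longrightarrow> F v i k = 0"
    have "F v b l = 0" if "b < n" "l < p" for b l
      using v row_space_zero[OF v(1) that(1) _ that(2)] right[OF v(1) i that(1) _ that(2)]
      by (cases "l < r"; cases "b = i") auto
    then show "v \<in> N" using v(1) by (simp add: null_space_def)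
  qed
  have zero: "F v a j = 0" if v: "v \<in> V" for v
  proof -
    have "\<forall>i\<in>{..<n}. \<exists>h. h \<in> row_space i \<and> (\<forall>k<r. F h i k = F v i k)" using full by blast
    then obtain h where h: "\<And>i. i < n \<Longrightarrow> h i \<in> row_space i"
      "\<And>i k. i < n \<Longrightarrow> k < r \<Longrightarrow> F (h i) i k = F v i k"
      by (metis lessThan_iff)
    define w where "w = v - (\<Sum>i<n. h i)"
    have F_sum: "F (\<Sum>i<n. h i) b l = (\<Sum>i<n. F (h i) b l)" for b l
      by (rule linear_form_sum[OF entry])
    have left: "F w b k = 0" if "b < n" "k < r" for b k
    proof -
      have "(\<Sum>i<n. F (h i) b k) = (\<Sum>i<n. if i = b then F v b k else 0)"
      proof (intro sum.cong refl)
        fix i assume "i \<in> {..<n}"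
        then show "F (h i) b k = (if i = b then F v b k else 0)"
          using h that row_space_zero[of "h i" i b k] r_le by auto
      qed
      then show ?thesis using that by (simp add: w_def F_diff F_sum)
    qed
    have "h i \<in> V" if "i < n" for i using h(1)[OF that] by (simp add: null_space_def)
    then have wV: "w \<in> V"
      unfolding w_def using subspace_V v by (intro subspace_diff subspace_sum) auto
    then have wA: "w \<in> VA" using left r_le by (simp add: VA_def)
    have upper: "F w i j = 0" if i: "i < r" for i
    proof -
      obtain g where g: "g \<in> row_space r" "\<And>k. k < r \<Longrightarrow> F g r k = unit i k"
        using full[OF rn, of "unit i"] by blast
      have "g \<in> VB" using row_space_lower[OF order_refl rn] g by blast
      from block_BC[OF this wA order_refl rn j] have "(\<Sum>k<r. unit i k * F w k j) = 0"
        using g(2) by simp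
      then show ?thesis using sum_unit_left[of "{..<r}" i "\<lambda>k. F w k j"] i by simp
    qed
    have "F w a j = 0"
    proof (cases "a < r")
      case False
      then show ?thesis using block_D[OF wA _ a j] left a by simp
    qed (use upper in auto)
    moreover have "F (h i) a j = 0" if "i < n" for i
      by (rule right[OF h(1)[OF that] that a j])
    ultimately show ?thesis by (simp add: w_def F_diff F_sum)
  qed
  have "F (s - s0) a j = 0" using zero S_diff[OF s s0] by blast
  then show ?thesis using base[OF a j(2)] j by (simp add: F_diff)
qed

end

section \<open>Deleting a row and adding it back\<close>

context parameter_space
begin

lemma kernel_form_full:
  assumes fin: "finite J" and le: "card J \<le> r"
  shows "kernel_form I J r S F"
proof -
  obtain e where e: "bij_betw e {..<card J} J"
    using ex_bij_betw_nat_finite[OF fin] by (metis lessThan_atLeast0)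
  show ?thesis
    unfolding kernel_form_def
  proof (intro exI[of _ "\<lambda>l. unit (e l)"] allI impI ballI)
    fix z s i assume z: "\<forall>l<r. (\<Sum>j\<in>J. unit (e l) j * z j) = (0::'a)"
    have "z j = 0" if "j \<in> J" for j
    proof -
      obtain l where l: "l < card J" "j = e l"
        using bij_betw_imp_surj_on[OF e] \<open>j \<in> J\<close> by auto
      then show ?thesis using z sum_unit_left[OF fin \<open>j \<in> J\<close>, of z] le by simp
    qed
    then show "(\<Sum>j\<in>J. F s i j * z j) = 0" by simp
  qed
qed

text \<open>Once a common kernel is found for the matrices without their \<open>i\<close>-th row, a nonzero value of
  the \<open>i\<close>-th row on it forces the remaining rows to have rank less than \<open>r\<close>.\<close>

lemma kernel_form_add_row:
  assumes fin: "finite I" "finite J" and aff: "affine_on S V" and lin: "linear_family F"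
    and rank: "\<And>s. s \<in> S \<Longrightarrow> rank_less I J (Suc r) (F s)"
    and i: "i \<in> I" and card: "card J < card I" and r: "0 < r"
    and large: "\<not> codim_le V (null_space I J V F) ((card I - 1) * (r - 1) + card J)"
    and kf: "kernel_form (I - {i}) J r S F"
  shows "kernel_form I J r S F"
proof -
  obtain \<phi> where \<phi>: "\<forall>z. (\<forall>l<r. (\<Sum>j\<in>J. \<phi> l j * z j) = 0) \<longrightarrow>
      (\<forall>s\<in>S. \<forall>a\<in>I - {i}. (\<Sum>j\<in>J. F s a j * z j) = 0)"
    by (rule kernel_formE[OF kf])
  have entry: "linear_form (\<lambda>v. F v a b)" for a b using lin by (simp add: linear_family_def)
  have "(\<Sum>j\<in>J. F s i j * z j) = 0"
    if z: "\<forall>l<r. (\<Sum>j\<in>J. \<phi> l j * z j) = 0" and s: "s \<in> S" for z s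
  proof (rule ccontr)
    assume nz: "(\<Sum>j\<in>J. F s i j * z j) \<noteq> 0"
    \<comment> \<open>Fixing the value of row \<open>i\<close> at \<open>z\<close> costs one
      equation and keeps that value nonzero on the whole slice.\<close>
    define f where "f v = (\<Sum>j\<in>J. F v i j * z j)" for v
    have f: "linear_form f"
    proof -
      have "linear_form (\<lambda>v. \<Sum>j\<in>J. z j * F v i j)"
        by (intro linear_form_sum_fun linear_form_mult entry)
      moreover have "(\<lambda>v. \<Sum>j\<in>J. z j * F v i j) = f"
        by (rule ext) (simp add: f_def mult.commute)
      ultimately show ?thesis by simp
    qed
    define W where "W = {v \<in> V. f v = 0}"
    obtain j0 where j0: "j0 \<in> J" "z j0 \<noteq> 0"
    proof -
      have "\<exists>j\<in>J. F s i j * z j \<noteq> 0" using nz by (meson sum.neutral)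
      then show ?thesis using that by auto
    qed
    have rank': "rank_less (I - {i}) J (Suc (r - 1)) (F t)" if t: "t \<in> {t \<in> S. f t = f s}" for t
    proof (rule rank_less_kernel_column[where P = unit and Q = unit and w' = "unit i" and u' = z])
      show "rank_less I J (Suc (Suc (r - 1))) (F t)" using rank t r by simp
      show "bil I J (F t) (unit i) z \<noteq> 0"
        using t nz by (simp add: bil_unit_left[OF fin(1) i] f_def)
      show "bil I J (F t) (unit a) z = 0" if "a \<in> I - {i}" for a
        using \<phi> z t that by (simp add: bil_unit_left[OF fin(1)])
      show "F t a b = bil I J (F t) (unit a) (unit b)" if "a \<in> I - {i}" "b \<in> J" for a b
        using that fin by (simp add: bil_unit)
    qed
    have "codim_le W (null_space (I - {i}) J W F) (max (card (I - {i})) (card J) * (r - 1))"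
      unfolding W_def
      by (rule flanders_affine[OF _ fin(2) affine_on_hyperplane[OF aff f s] lin rank']) (use fin in auto)
    moreover have "max (card (I - {i})) (card J) = card I - 1"
      using fin i card by simp
    ultimately have "codim_le V (null_space (I - {i}) J W F) (1 + (card I - 1) * (r - 1))"
      using codim_le_trans[OF codim_le_hyperplane[OF f]] by (simp add: W_def)
    \<comment> \<open>The entry at \<open>j0\<close> is recovered from \<open>f v = 0\<close>. One
      equation for the slice, Flanders' bound for the other rows and \<open>card J - 1\<close> for
      row \<open>i\<close> make up the threshold.\<close>
    moreover have "codim_le (null_space (I - {i}) J W F) (null_space I J V F) (card (J - {j0}))"
    proof (rule codim_le_family[where f = "\<lambda>j v. F v i j"])
      fix v assume v: "v \<in> null_space (I - {i}) J W F" "\<And>j. j \<in> J - {j0} \<Longrightarrow> F v i j = 0"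
      have vW: "v \<in> V" "f v = 0" using v(1) by (auto simp: null_space_def W_def)
      have "f v = F v i j0 * z j0"
        unfolding f_def using v(2) fin j0 by (subst sum.remove[of J j0]) auto
      then have "F v i j0 = 0" using vW j0 by simp
      then have "F v i j = 0" if "j \<in> J" for j using v(2) that by (cases "j = j0") auto
      then show "v \<in> null_space I J V F" using v(1) vW by (auto simp: null_space_def)
    qed (use fin entry in auto)
    ultimately have "codim_le V (null_space I J V F) (1 + (card I - 1) * (r - 1) + card (J - {j0}))"
      by (rule codim_le_trans)
    moreover have "1 + (card I - 1) * (r - 1) + card (J - {j0}) = (card I - 1) * (r - 1) + card J"
      using fin j0 card_gt_0_iff[of J] by auto
    ultimately show False using large by (simp only:)
  qed
  then show ?thesis unfolding kernel_form_def
    using \<phi> by (intro exI[of _ \<phi>]) blast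
qed

text \<open>If all but one of the rows are subject to a common system of relations leaving only \<open>r\<close> of them
  free, then \<open>r + 1\<close> rows determine the whole matrix.\<close>

lemma codim_le_row_relations:
  assumes fin: "finite I" "finite J" and aff: "affine_on S V" and lin: "linear_family F"
    and rank: "\<And>s. s \<in> S \<Longrightarrow> rank_less I J (Suc r) (F s)"
    and i: "i \<in> I" and card: "r < card J"
    and kf: "kernel_form J (I - {i}) r S (\<lambda>s i j. F s j i)"
  shows "codim_le V (null_space I J V F) (card J * r)"
proof -
  let ?I = "I - {i}"
  obtain \<phi> where \<phi>: "\<forall>z. (\<forall>l<r. (\<Sum>a\<in>?I. \<phi> l a * z a) = 0) \<longrightarrow>
      (\<forall>s\<in>S. \<forall>j\<in>J. (\<Sum>a\<in>?I. F s a j * z a) = 0)"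
    by (rule kernel_formE[OF kf])
  \<comment> \<open>The double annihilator of the forms \<open>\<phi> l\<close>: it contains the
    column of every direction, restricted to \<open>I - {i}\<close>, and has at most
    \<open>r\<close> pivots.\<close>
  define X where "X = {x. \<forall>z. (\<forall>l<r. (\<Sum>a\<in>?I. \<phi> l a * z a) = 0) \<longrightarrow> (\<Sum>a\<in>?I. x a * z a) = 0}"
  have z: "(\<lambda>_. 0) \<in> X" unfolding X_def by simp
  have a: "(\<lambda>i. x i + y i) \<in> X" if "x \<in> X" "y \<in> X" for x y
    using that unfolding X_def by (simp add: algebra_simps sum.distrib)
  have s: "(\<lambda>i. c * x i) \<in> X" if "x \<in> X" for c x
    using that unfolding X_def by (simp add: mult.assoc sum_distrib_left[symmetric])
  have finI: "finite ?I" using fin by simp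
  obtain K where K: "K \<subseteq> ?I"
    "\<And>x i. x \<in> X \<Longrightarrow> (\<And>i. i \<in> K \<Longrightarrow> x i = 0) \<Longrightarrow> i \<in> ?I \<Longrightarrow> x i = 0"
    "\<And>g. \<exists>x\<in>X. \<forall>i\<in>K. x i = g i"
    using pivot_coordinates[OF finI z a s] by blast
  have fK: "finite K" using K(1) finI finite_subset by blast
  have cK: "card K \<le> r"
  proof (rule ccontr)
    assume "\<not> card K \<le> r"
    then obtain w where w: "\<exists>a\<in>K. w a \<noteq> 0" "\<And>l. l < r \<Longrightarrow> (\<Sum>a\<in>K. \<phi> l a * w a) = 0"
      using nonzero_solution[OF fK, of r \<phi>] by auto
    then obtain b where b: "b \<in> K" "w b \<noteq> 0" by blast
    define w' where "w' a = (if a \<in> K then w a else 0)" for a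
    have sumK: "(\<Sum>a\<in>?I. f a * w' a) = (\<Sum>a\<in>K. f a * w a)" for f
      by (rule sum.mono_neutral_cong_right) (use finI K(1) in \<open>auto simp: w'_def\<close>)
    obtain x where x: "x \<in> X" "\<And>a. a \<in> K \<Longrightarrow> x a = unit b a" using K(3)[of "unit b"] by blast
    have "\<forall>l<r. (\<Sum>a\<in>?I. \<phi> l a * w' a) = 0" using w(2) by (simp add: sumK)
    then have "(\<Sum>a\<in>?I. x a * w' a) = 0" using x(1) unfolding X_def by blast
    moreover have "(\<Sum>a\<in>K. x a * w a) = w b"
      using sum_unit_left[OF fK b(1), of w] x(2) by simp
    ultimately show False using b by (simp add: sumK)
  qed
  have col: "(\<lambda>a. F v a j) \<in> X" if v: "v \<in> V" and j: "j \<in> J" for v j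
  proof -
    obtain t where t: "t \<in> S" "t + v \<in> S" using aff v by (auto simp: affine_on_def)
    have "F (t + v) a j = F t a j + F v a j" for a
      using lin by (simp add: linear_family_def linear_form_def)
    then have "(\<Sum>a\<in>?I. F (t + v) a j * z a) = (\<Sum>a\<in>?I. F t a j * z a) + (\<Sum>a\<in>?I. F v a j * z a)" for z
      by (simp add: distrib_right sum.distrib)
    moreover have "(\<Sum>a\<in>?I. F (t + v) a j * z a) = 0" "(\<Sum>a\<in>?I. F t a j * z a) = 0"
      if "\<forall>l<r. (\<Sum>a\<in>?I. \<phi> l a * z a) = 0" for z
      using \<phi> t j that by blast+
    ultimately show ?thesis unfolding X_def by simp
  qed
  have "codim_le V (null_space (insert i K) J V F) (max (card (insert i K)) (card J) * r)"
    by (rule flanders_affine[OF _ fin(2) aff lin rank_less_subset[OF rank]]) (use fin fK K(1) i in auto)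
  moreover have "max (card (insert i K)) (card J) = card J"
    using cK card card_insert_le_m1[of "Suc r" K i] by (simp add: max_def card_insert_if[OF fK])
  moreover have "null_space (insert i K) J V F \<subseteq> null_space I J V F"
  proof
    fix v assume v: "v \<in> null_space (insert i K) J V F"
    have "F v a j = 0" if "a \<in> I" "j \<in> J" for a j
      using K(2)[OF col, of v j a] v that by (cases "a = i") (auto simp: null_space_def)
    then show "v \<in> null_space I J V F" using v by (simp add: null_space_def)
  qed
  ultimately show ?thesis using codim_le_mono[OF _ subset_refl] by fastforce
qed

text \<open>Note that \<open>(n - 1) (r - 1) + p = n r - (n - p + r) + 1\<close>.\<close>

theorem large_affine_spaces:
  fixes F :: "'b \<Rightarrow> nat \<Rightarrow> nat \<Rightarrow> 'a"
  assumes "finite I" "finite J" "card J \<le> card I" "0 < r" "r \<le> card J"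
    and "affine_on S V" "linear_family F"
    and "\<And>s. s \<in> S \<Longrightarrow> rank_less I J (Suc r) (F s)"
    and "\<not> codim_le V (null_space I J V F) ((card I - 1) * (r - 1) + card J)"
  shows "kernel_form I J r S F \<or> card I = card J \<and> kernel_form J I r S (\<lambda>s i j. F s j i)"
  using assms
proof (induction "card I - card J" arbitrary: I J F)
  case 0
  then have eq: "card J = card I" by simp
  show ?case
  proof (cases "card J \<le> r")
    case True
    then show ?thesis using kernel_form_full 0 by blast
  next
    case False
    have "0 < r" "0 < card I" using 0 False eq by auto
    then have "(card I - 1) * (r - 1) + card J = (card I - 1) * r + 1"
      using eq by (cases r; cases "card I") simp_all
    then have "\<not> codim_le V (null_space I J V F) ((card I - 1) * r + 1)"
      using \<open>\<not> codim_le V (null_space I J V F) ((card I - 1) * (r - 1) + card J)\<close> by simp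
    moreover have "r < card I" using False eq by simp
    ultimately show ?thesis
      using square_bound_holds[of r, unfolded square_bound_def, rule_format, of I J S V F] 0 eq
      by simp
  qed
next
  case (Suc d)
  let ?n = "card I" and ?p = "card J"
  have np: "?p < ?n" using Suc.hyps(2) by simp
  show ?case
  proof (cases "?p \<le> r")
    case True
    then show ?thesis using kernel_form_full Suc.prems by blast
  next
    case False
    have rn: "r < ?n" using False np by simp
    have "\<exists>s\<in>S. \<not> rank_less I J r (F s)"
    proof (rule ccontr)
      assume "\<not> ?thesis"
      then have "rank_less I J (Suc (r - 1)) (F s)" if "s \<in> S" for s
        using that \<open>0 < r\<close> by auto
      from flanders_affine[OF Suc.prems(1,2,6,7) this]
      have "codim_le V (null_space I J V F) (?n * (r - 1))" using np by (simp add: max_def)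
      moreover have "?n * (r - 1) \<le> (?n - 1) * (r - 1) + ?p"
        using np False by (cases ?n) auto
      ultimately show False using Suc.prems(9) codim_le_mono[OF _ subset_refl subset_refl] by blast
    qed
    then obtain s0 where s0: "s0 \<in> S" "\<not> rank_less I J r (F s0)" by blast
    obtain G where G: "normal_family scale S V G ?n ?p r s0"
      and null: "null_space {..<?n} {..<?p} V G = null_space I J V F"
      and col: "\<forall>k. kernel_form {..<?n} {..<?p} k S G \<longrightarrow> kernel_form I J k S F"
      by (rule normal_form_exists[OF Suc.prems(1,2,6,7,8) s0], assumption) (rule that)
    interpret A: normal_family scale S V G ?n ?p r s0 by (rule G)
    have large: "\<not> codim_le V A.N ((?n - 1) * (r - 1) + ?p)"
      using Suc.prems(9) by (simp only: null not_False_eq_True)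
    have "kernel_form {..<?n} {..<?p} r S G"
    proof (cases "\<exists>i<?n. codim_le (A.row_space i) A.N (r - 1)")
      case True
      then obtain i where i: "i < ?n" and cd: "codim_le (A.row_space i) A.N (r - 1)" by blast
      let ?I = "{..<?n} - {i}"
      have cI: "card ?I = ?n - 1" using i by simp
      have "\<not> codim_le V (null_space ?I {..<?p} V G) ((card ?I - 1) * (r - 1) + card {..<?p})"
      proof
        assume "codim_le V (null_space ?I {..<?p} V G) ((card ?I - 1) * (r - 1) + card {..<?p})"
        then have "codim_le V A.N ((card ?I - 1) * (r - 1) + card {..<?p} + (r - 1))"
          using cd by (rule codim_le_trans)
        moreover have "(card ?I - 1) * (r - 1) + card {..<?p} + (r - 1) = (?n - 1) * (r - 1) + ?p"
        proof -
          have "2 \<le> ?n" using rn Suc.prems(4) by simp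
          then obtain q where "?n = 2 + q" by (metis le_iff_add)
          then show ?thesis unfolding cI by simp
        qed
        ultimately have "codim_le V A.N ((?n - 1) * (r - 1) + ?p)" by (simp only:)
        then show False using large by blast
      qed
      moreover have "rank_less ?I {..<?p} (Suc r) (G s)" if "s \<in> S" for s
        by (rule rank_less_subset[OF A.rank[OF that]]) auto
      moreover have "d = card ?I - card {..<?p}" using Suc.hyps(2) cI by simp
      ultimately have IH: "kernel_form ?I {..<?p} r S G \<or>
          card ?I = card {..<?p} \<and> kernel_form {..<?p} ?I r S (\<lambda>s i j. G s j i)"
        using Suc.hyps(1)[of ?I "{..<?p}" G] Suc.prems np cI A.linear by simp
      then show ?thesis
      proof
        assume "kernel_form ?I {..<?p} r S G"
        then show ?thesis
          using kernel_form_add_row[OF _ _ A.affine A.linear A.rank, of i] i np Suc.prems(4) large by simp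
      next
        \<comment> \<open>Here \<open>n - 1 = p\<close>, and \<open>p * r\<close> is exactly the
          threshold; so the transposed alternative of the square case does not propagate to
          \<open>n > p\<close>.\<close>
        assume *: "card ?I = card {..<?p} \<and> kernel_form {..<?p} ?I r S (\<lambda>s i j. G s j i)"
        have "codim_le V A.N (card {..<?p} * r)"
          by (rule codim_le_row_relations[OF _ _ A.affine A.linear A.rank, of i]) (use * i False in auto)
        moreover have "card {..<?p} * r = (?n - 1) * (r - 1) + ?p"
          using * cI Suc.prems(4) by (cases r) auto
        ultimately show ?thesis using large by simp
      qed
    next
      case False
      then have "\<not> codim_le (A.row_space i) A.N (r - 1)" if "i < ?n" for i using that by blast
      from A.full_row_spaces[OF rn Suc.prems(4) this] show ?thesis
        by (rule kernel_form_zero_columns)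
    qed
    then show ?thesis using col by blast
  qed
qed

end

section \<open>Affine spaces of matrices\<close>

text \<open>A maximal independent set of columns has the rank as its size and spans all columns;
  \<open>X\<close> lists its elements and \<open>Y\<close> the coefficients.\<close>

lemma rank_factorization:
  fixes A :: "'a::field mat"
  assumes A: "A \<in> carrier_mat n p"
  obtains X Y where "\<And>i j. i < n \<Longrightarrow> j < p \<Longrightarrow> A $$ (i, j) = (\<Sum>c<vec_space.rank n A. X i c * Y c j)"
proof -
  interpret vec_space "TYPE('a)" n .
  let ?C = "set (cols A)"
  let ?P = "\<lambda>U. U \<subseteq> ?C \<and> lin_indpt U"
  have C: "?C \<subseteq> carrier_vec n" using cols_dim A by blast
  have "?P {}" by (auto simp: lin_dep_def)
  then obtain U where fU: "finite U" and max: "maximal U ?P"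
    using maximal_exists_superset[of ?C ?P "{}"] by auto
  have U: "U \<subseteq> ?C" "lin_indpt U" using max by (auto simp: maximal_def)
  have UC: "U \<subseteq> carrier_vec n" using U C by blast
  have rank: "rank A = card U" using rank_card_indpt[OF A max] .
  have span: "x \<in> span U" if x: "x \<in> ?C" for x
  proof (cases "x \<in> U")
    case True
    then show ?thesis using in_own_span[of U] UC by auto
  next
    case False
    have "lin_dep (U \<union> {x})"
    proof (rule ccontr)
      assume "lin_indpt (U \<union> {x})"
      then have "U \<union> {x} = U" using max x U unfolding maximal_def by blast
      then show False using False by blast
    qed
    then show ?thesis using lin_dep_iff_in_span[of U x] UC U(2) x C False by auto
  qed
  have "\<exists>a. col A j = lincomb a U" if "j < p" for j
  proof -
    have "col A j \<in> ?C" using that A by (auto simp: cols_def)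
    then show ?thesis using span finite_span[OF fU] UC by auto
  qed
  then obtain a where a: "\<And>j. j < p \<Longrightarrow> col A j = lincomb (a j) U" by metis
  obtain e where e: "bij_betw e {..<card U} U"
    using ex_bij_betw_nat_finite[OF fU] by (metis lessThan_atLeast0)
  show ?thesis
  proof (rule that)
    fix i j assume ij: "i < n" "j < p"
    have "A $$ (i, j) = col A j $ i" using ij A by simp
    also have "\<dots> = (\<Sum>x\<in>U. a j x * x $ i)"
      using a[OF ij(2)] lincomb_index[OF ij(1) UC] by simp
    also have "\<dots> = (\<Sum>c<card U. a j (e c) * e c $ i)"
      by (rule sum.reindex_bij_betw[OF e, symmetric])
    finally show "A $$ (i, j) = (\<Sum>c<rank A. e c $ i * a j (e c))"
      by (simp add: rank mult.commute)
  qed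
qed

lemma rank_less_of_rank:
  fixes A :: "'a::field mat"
  assumes A: "A \<in> carrier_mat n p" and rank: "vec_space.rank n A \<le> r"
    and M: "\<And>i j. i < n \<Longrightarrow> j < p \<Longrightarrow> M i j = A $$ (i, j)"
  shows "rank_less {..<n} {..<p} (Suc r) M"
  unfolding rank_less_def
proof (intro allI)
  fix w u :: "nat \<Rightarrow> nat \<Rightarrow> 'a"
  let ?k = "vec_space.rank n A"
  obtain X Y where XY: "\<And>i j. i < n \<Longrightarrow> j < p \<Longrightarrow> A $$ (i, j) = (\<Sum>c<?k. X i c * Y c j)"
    using rank_factorization[OF A] by blast
  have "bil {..<n} {..<p} M x y = (\<Sum>c<?k. (\<Sum>i<n. x i * X i c) * (\<Sum>j<p. Y c j * y j))" for x y
  proof -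
    have "bil {..<n} {..<p} M x y = (\<Sum>i<n. \<Sum>j<p. \<Sum>c<?k. x i * X i c * (Y c j * y j))"
      unfolding bil_def
      by (intro sum.cong refl) (simp add: M XY sum_distrib_left sum_distrib_right ac_simps)
    also have "\<dots> = (\<Sum>i<n. \<Sum>c<?k. \<Sum>j<p. x i * X i c * (Y c j * y j))"
      by (intro sum.cong refl sum.swap)
    also have "\<dots> = (\<Sum>c<?k. \<Sum>i<n. \<Sum>j<p. x i * X i c * (Y c j * y j))"
      by (rule sum.swap)
    finally show ?thesis by (simp add: sum_product)
  qed
  then show "fdet (Suc r) (\<lambda>a b. bil {..<n} {..<p} M (w a) (u b)) = 0"
    using fdet_factor_through_smaller[of ?k "Suc r"
        "\<lambda>a c. \<Sum>i<n. w a i * X i c" "\<lambda>c b. \<Sum>j<p. Y c j * u b j"] rank by simp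
qed

lemma mat_subspaceD:
  fixes W :: "'a::field mat set"
  assumes "mat_subspace n p W"
  shows "W \<subseteq> carrier_mat n p" "0\<^sub>m n p \<in> W"
    "A \<in> W \<Longrightarrow> B \<in> W \<Longrightarrow> A + B \<in> W" "A \<in> W \<Longrightarrow> c \<cdot>\<^sub>m A \<in> W"
proof -
  have sub: "submodule class_ring W (module_mat TYPE('a) n p)"
    using assms by (simp add: subspace_def)
  show "W \<subseteq> carrier_mat n p" "0\<^sub>m n p \<in> W"
    using submodule.subset[OF sub] submodule.zero_closed[OF sub] by (simp_all add: module_mat_simps)
  show "A \<in> W \<Longrightarrow> B \<in> W \<Longrightarrow> A + B \<in> W"
    using submodule.m_closed[OF sub] by (simp add: module_mat_simps)
  show "A \<in> W \<Longrightarrow> c \<cdot>\<^sub>m A \<in> W"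
    using submodule.smult_closed[OF sub] by (simp add: module_mat_simps)
qed

lemma mat_subspaceI:
  fixes W :: "'a::field mat set"
  assumes "W \<subseteq> carrier_mat n p" "0\<^sub>m n p \<in> W"
    "\<And>A B. A \<in> W \<Longrightarrow> B \<in> W \<Longrightarrow> A + B \<in> W" "\<And>c A. A \<in> W \<Longrightarrow> c \<cdot>\<^sub>m A \<in> W"
  shows "mat_subspace n p W"
proof (rule subspace.intro[OF matrix_vs])
  have "module class_ring (module_mat TYPE('a) n p)"
    using matrix_vs vectorspace_def by blast
  then show "submodule class_ring W (module_mat TYPE('a) n p)"
    by (rule submodule.intro) (use assms in \<open>auto simp: module_mat_simps\<close>)
qed

text \<open>Zero outside the index range, so that a function in the image vanishing on the range is
  the zero vector of the function space.\<close>

definition mat_fun :: "nat \<Rightarrow> nat \<Rightarrow> 'a::zero mat \<Rightarrow> nat \<Rightarrow> nat \<Rightarrow> 'a" where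
  "mat_fun n p A i j = (if i < n \<and> j < p then A $$ (i, j) else 0)"

interpretation mat_space: parameter_space "\<lambda>c (f :: nat \<Rightarrow> nat \<Rightarrow> 'a::field) i j. c * f i j"
  by unfold_locales (auto simp: fun_eq_iff algebra_simps)

lemma mat_fun_add:
  "A \<in> carrier_mat n p \<Longrightarrow> B \<in> carrier_mat n p \<Longrightarrow>
    mat_fun n p (A + B) = mat_fun n p A + mat_fun n p (B :: 'a::field mat)"
  by (auto simp: mat_fun_def fun_eq_iff)

lemma mat_fun_smult:
  "A \<in> carrier_mat n p \<Longrightarrow> mat_fun n p (c \<cdot>\<^sub>m A) = (\<lambda>i j. c * mat_fun n p (A :: 'a::field mat) i j)"
  by (auto simp: mat_fun_def fun_eq_iff)

lemma subspace_mat_fun: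
  assumes "mat_subspace n p (W :: 'a::field mat set)"
  shows "mat_space.subspace (mat_fun n p ` W)"
proof -
  note W = mat_subspaceD[OF assms]
  have "0 \<in> mat_fun n p ` W"
    by (rule image_eqI[OF _ W(2)]) (auto simp: mat_fun_def fun_eq_iff)
  moreover have "mat_fun n p A + mat_fun n p B \<in> mat_fun n p ` W" if "A \<in> W" "B \<in> W" for A B
    using that W(1) W(3)[OF that] by (subst mat_fun_add[symmetric]) auto
  moreover have "(\<lambda>i j. c * mat_fun n p A i j) \<in> mat_fun n p ` W" if "A \<in> W" for A c
    using that W(1) W(4)[OF that] by (subst mat_fun_smult[symmetric]) auto
  ultimately show ?thesis unfolding mat_space.subspace_def by auto
qed

text \<open>Turns equation counts into dimensions: more than \<open>k\<close> vectors admit a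
  nontrivial combination on which \<open>k\<close> given forms vanish, so an independent set has at
  most \<open>k\<close> elements.\<close>

lemma mat_subspace_dim_le:
  fixes W :: "'a::field mat set"
  assumes W: "mat_subspace n p W"
    and cd: "mat_space.codim_le (mat_fun n p ` W) {0} k"
  shows "mat_subspace_dim n p W \<le> k"
proof -
  interpret M: vectorspace "class_ring :: 'a ring" "module_mat TYPE('a) n p"
    by (rule matrix_vs)
  interpret W: vectorspace "class_ring :: 'a ring" "(module_mat TYPE('a) n p)\<lparr>carrier := W\<rparr>"
    by (rule M.subspace_is_vs[OF W])
  note WD = mat_subspaceD[OF W]
  obtain fs where fs: "length fs \<le> k" "\<And>f. f \<in> set fs \<Longrightarrow> mat_space.linear_form f"
    "\<And>v. v \<in> mat_fun n p ` W \<Longrightarrow> (\<And>f. f \<in> set fs \<Longrightarrow> f v = 0) \<Longrightarrow> v = 0"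
    using cd unfolding mat_space.codim_le_def by blast
  have lincomb: "W.lincomb a B \<in> W \<and> mat_fun n p (W.lincomb a B) = (\<Sum>b\<in>B. (\<lambda>i j. a b * mat_fun n p b i j))"
    if "finite B" "B \<subseteq> W" for a B
    using that
  proof (induction B rule: finite_induct)
    case empty
    then show ?case using WD(2)
      by (auto simp: W.lincomb_def module_mat_simps mat_fun_def fun_eq_iff)
  next
    case (insert b B)
    have "W.lincomb a (insert b B) = a b \<cdot>\<^sub>m b + W.lincomb a B"
      unfolding W.lincomb_def
      by (subst W.finsum_insert) (use insert WD in \<open>auto simp: module_mat_simps\<close>)
    then show ?case
      using insert WD by (auto simp: mat_fun_add mat_fun_smult subset_iff)
  qed
  have card_le: "card B \<le> k" if B: "finite B" "B \<subseteq> W" "W.lin_indpt B" for B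
  proof (rule ccontr)
    assume "\<not> card B \<le> k"
    then have lt: "length fs < card {..<card B}" using fs(1) by simp
    obtain e where e: "bij_betw e {..<card B} B"
      using ex_bij_betw_nat_finite[OF B(1)] by (metis lessThan_atLeast0)
    obtain z where z: "\<exists>c\<in>{..<card B}. z c \<noteq> 0"
      "\<And>l. l < length fs \<Longrightarrow> (\<Sum>c\<in>{..<card B}. (fs ! l) (mat_fun n p (e c)) * z c) = 0"
      using nonzero_solution[OF finite_lessThan lt, of "\<lambda>l c. (fs ! l) (mat_fun n p (e c))"] by blast
    define a where "a b = z (the_inv_into {..<card B} e b)" for b
    have ae: "a (e c) = z c" if "c < card B" for c
      using the_inv_into_f_f[OF bij_betw_imp_inj_on[OF e], of c] that by (simp add: a_def)
    define v where "v = mat_fun n p (W.lincomb a B)"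
    have vW: "v \<in> mat_fun n p ` W"
      unfolding v_def by (rule imageI) (rule conjunct1[OF lincomb[OF B(1,2)]])
    have v: "v = (\<Sum>c<card B. (\<lambda>i j. z c * mat_fun n p (e c) i j))"
    proof -
      have "v = (\<Sum>b\<in>B. (\<lambda>i j. a b * mat_fun n p b i j))"
        using lincomb[OF B(1,2)] by (simp add: v_def)
      also have "\<dots> = (\<Sum>c<card B. (\<lambda>i j. a (e c) * mat_fun n p (e c) i j))"
        by (rule sum.reindex_bij_betw[OF e, symmetric])
      also have "\<dots> = (\<Sum>c<card B. (\<lambda>i j. z c * mat_fun n p (e c) i j))"
        by (intro sum.cong refl) (simp add: ae)
      finally show ?thesis .
    qed
    have "f v = 0" if f: "f \<in> set fs" for f
    proof -
      obtain l where l: "l < length fs" "f = fs ! l" using f by (auto simp: in_set_conv_nth)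
      have "f v = (\<Sum>c<card B. f (\<lambda>i j. z c * mat_fun n p (e c) i j))"
        unfolding v by (rule mat_space.linear_form_sum[OF fs(2)[OF f]])
      also have "\<dots> = (\<Sum>c<card B. (fs ! l) (mat_fun n p (e c)) * z c)"
        by (intro sum.cong refl)
           (use mat_space.linear_form_scale[OF fs(2)[OF f]] l in \<open>simp add: mult.commute\<close>)
      finally show ?thesis using z(2)[OF l(1)] by simp
    qed
    then have "v = 0" using fs(3) vW by blast
    have "W.lincomb a B = 0\<^sub>m n p"
    proof (rule eq_matI)
      have "W.lincomb a B \<in> carrier_mat n p" using lincomb[OF B(1,2)] WD(1) by blast
      then show dims: "dim_row (W.lincomb a B) = dim_row (0\<^sub>m n p :: 'a mat)"
        "dim_col (W.lincomb a B) = dim_col (0\<^sub>m n p :: 'a mat)" by auto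
      fix i j assume "i < dim_row (0\<^sub>m n p :: 'a mat)" "j < dim_col (0\<^sub>m n p :: 'a mat)"
      moreover have "v i j = 0" using \<open>v = 0\<close> by simp
      ultimately show "W.lincomb a B $$ (i, j) = 0\<^sub>m n p $$ (i, j)"
        by (simp add: v_def mat_fun_def)
    qed
    moreover obtain c where c: "c < card B" "z c \<noteq> 0" using z(1) by blast
    moreover have "e c \<in> B" using bij_betwE[OF e] c by blast
    ultimately have "W.lin_dep B"
      unfolding W.lin_dep_def using B(1) ae[of c]
      by (intro exI[of _ B] exI[of _ a] exI[of _ "e c"]) (auto simp: module_mat_simps)
    then show False using B(3) by blast
  qed
  have fin: "finite B \<and> card B \<le> k" if B: "B \<subseteq> W" "W.lin_indpt B" for B
  proof (cases "finite B")
    case False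
    then obtain C where C: "C \<subseteq> B" "finite C" "card C = Suc k"
      using infinite_arbitrarily_large by blast
    then have "card C \<le> k" using card_le[of C] B W.subset_li_is_li[OF B(2)] by blast
    then show ?thesis using C by simp
  qed (use card_le B in blast)
  have "W.lin_indpt {}" by (auto simp: W.lin_dep_def)
  then obtain B where B: "finite B" "maximal B (\<lambda>B. B \<subseteq> W \<and> W.lin_indpt B)"
    using maximal_exists[of "\<lambda>B. B \<subseteq> W \<and> W.lin_indpt B" k "{}"] fin by blast
  have "W.gen_set B" using W.max_li_is_gen[of B] B(2) by simp
  then have "W.dim \<le> card B"
    using W.gen_ge_dim[OF B(1)] B(2) by (simp add: maximal_def)
  also have "card B \<le> k" using fin[of B] B(2) by (simp add: maximal_def)
  finally show ?thesis .
qed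

section \<open>Compression spaces and equivalence\<close>

lemma compression_space_iff:
  fixes M :: "'a::field mat"
  assumes "s \<le> n" "t \<le> p"
  shows "M \<in> compression_space n p s t \<longleftrightarrow>
    M \<in> carrier_mat n p \<and> (\<forall>i j. s \<le> i \<longrightarrow> i < n \<longrightarrow> t \<le> j \<longrightarrow> j < p \<longrightarrow> M $$ (i, j) = 0)"
proof
  assume "M \<in> compression_space n p s t"
  then obtain A B C where "M = four_block_mat A C B (0\<^sub>m (n - s) (p - t))"
    "A \<in> carrier_mat s t" "B \<in> carrier_mat (n - s) t" "C \<in> carrier_mat s (p - t)"
    unfolding compression_space_def by blast
  then show "M \<in> carrier_mat n p \<and> (\<forall>i j. s \<le> i \<longrightarrow> i < n \<longrightarrow> t \<le> j \<longrightarrow> j < p \<longrightarrow> M $$ (i, j) = 0)"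
    using assms by auto
next
  assume M: "M \<in> carrier_mat n p \<and> (\<forall>i j. s \<le> i \<longrightarrow> i < n \<longrightarrow> t \<le> j \<longrightarrow> j < p \<longrightarrow> M $$ (i, j) = 0)"
  let ?A = "mat s t (\<lambda>(i, j). M $$ (i, j))" and ?B = "mat (n - s) t (\<lambda>(i, j). M $$ (s + i, j))"
    and ?C = "mat s (p - t) (\<lambda>(i, j). M $$ (i, t + j))"
  have "M = four_block_mat ?A ?C ?B (0\<^sub>m (n - s) (p - t))"
    by (rule eq_matI) (use M assms in auto)
  then show "M \<in> compression_space n p s t"
    unfolding compression_space_def
    by (intro CollectI exI[of _ ?A] exI[of _ ?B] exI[of _ ?C]) auto
qed

lemma mat_subspace_compression:
  assumes "s \<le> n" "t \<le> p"
  shows "mat_subspace n p (compression_space n p s t :: 'a::field mat set)"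
  by (rule mat_subspaceI) (use assms in \<open>auto simp: compression_space_iff\<close>)

lemma GL_inverse:
  fixes P :: "'a::field mat"
  assumes "P \<in> GL n"
  obtains P' where "P' \<in> GL n" "P' \<in> carrier_mat n n" "P * P' = 1\<^sub>m n" "P' * P = 1\<^sub>m n"
proof -
  have P: "P \<in> carrier_mat n n" using assms by (simp add: GL_def)
  obtain B where B: "P * B = 1\<^sub>m (dim_row P)" "B * P = 1\<^sub>m (dim_row B)"
    using assms by (auto simp: GL_def invertible_mat_def inverts_mat_def)
  have "dim_col B = n" using B(1) P by (metis carrier_matD(1) index_mult_mat(3) index_one_mat(3))
  moreover have "dim_row B = n" using B(2) P by (metis carrier_matD(2) index_mult_mat(3) index_one_mat(3))
  ultimately have c: "B \<in> carrier_mat n n" by auto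
  have "B \<in> GL n"
    using B c P by (auto simp: GL_def invertible_mat_def inverts_mat_def)
  then show ?thesis using that c B P by auto
qed

lemma GL_I:
  fixes P :: "'a::field mat"
  assumes "P \<in> carrier_mat n n" "P' \<in> carrier_mat n n" "P * P' = 1\<^sub>m n" "P' * P = 1\<^sub>m n"
  shows "P \<in> GL n"
  using assms by (auto simp: GL_def invertible_mat_def inverts_mat_def)

lemma mat_subspace_equivalent:
  fixes W :: "'a::field mat set"
  assumes W: "mat_subspace n p W" and P: "P \<in> carrier_mat n n" and Q: "Q \<in> carrier_mat p p"
  shows "mat_subspace n p {P * M * Q | M. M \<in> W}"
proof (rule mat_subspaceI)
  note WD = mat_subspaceD[OF W]
  show "{P * M * Q | M. M \<in> W} \<subseteq> carrier_mat n p" using WD(1) P Q by auto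
  have "P * 0\<^sub>m n p * Q = 0\<^sub>m n p" using P Q by simp
  then show "0\<^sub>m n p \<in> {P * M * Q | M. M \<in> W}" using WD(2)
    by (intro CollectI exI[of _ "0\<^sub>m n p"]) simp
  fix A B assume "A \<in> {P * M * Q | M. M \<in> W}" "B \<in> {P * M * Q | M. M \<in> W}"
  then obtain M N where MN: "A = P * M * Q" "B = P * N * Q" "M \<in> W" "N \<in> W" by blast
  then have "M \<in> carrier_mat n p" "N \<in> carrier_mat n p" using WD(1) by auto
  then have "A + B = P * (M + N) * Q"
    unfolding MN using P Q
    by (simp add: mult_add_distrib_mat[of _ n n _ p] add_mult_distrib_mat[of _ n p _ _ p])
  then show "A + B \<in> {P * M * Q | M. M \<in> W}" using WD(3) MN by blast
next
  note WD = mat_subspaceD[OF W]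
  fix c A assume "A \<in> {P * M * Q | M. M \<in> W}"
  then obtain M where M: "A = P * M * Q" "M \<in> W" by blast
  then have "M \<in> carrier_mat n p" using WD(1) by auto
  then have "c \<cdot>\<^sub>m A = P * (c \<cdot>\<^sub>m M) * Q"
    unfolding M using P Q by (simp add: mult_smult_distrib[of _ n n _ p] mult_smult_assoc_mat[of _ n p _ p])
  then show "c \<cdot>\<^sub>m A \<in> {P * M * Q | M. M \<in> W}" using WD(4) M by blast
qed

lemma equivalent_to_compression:
  fixes S :: "'a::field mat set"
  assumes S: "affine_subspace n p S" and P: "P \<in> GL n" and Q: "Q \<in> GL p"
    and st: "s \<le> n" "t \<le> p"
    and comp: "\<And>M. M \<in> S \<Longrightarrow> P * M * Q \<in> compression_space n p s t"
  shows "r_decomposable n p (s + t) S"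
    "\<exists>T. affine_subspace n p T \<and> T \<subseteq> compression_space n p s t \<and> mat_equivalent n p S T"
proof -
  obtain A W where A: "A \<in> carrier_mat n p" and W: "mat_subspace n p W" and SA: "S = {A + M | M. M \<in> W}"
    using S unfolding affine_subspace_def by blast
  note WD = mat_subspaceD[OF W]
  have Sc: "S \<subseteq> carrier_mat n p" using A WD(1) unfolding SA by auto
  have Pc: "P \<in> carrier_mat n n" and Qc: "Q \<in> carrier_mat p p" using P Q by (auto simp: GL_def)
  obtain P' where P': "P' \<in> GL n" "P' \<in> carrier_mat n n" "P * P' = 1\<^sub>m n" "P' * P = 1\<^sub>m n"
    using GL_inverse[OF P] by blast
  obtain Q' where Q': "Q' \<in> GL p" "Q' \<in> carrier_mat p p" "Q * Q' = 1\<^sub>m p" "Q' * Q = 1\<^sub>m p"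
    using GL_inverse[OF Q] by blast
  have restore: "P' * (P * M * Q) * Q' = M" if M: "M \<in> carrier_mat n p" for M
  proof -
    have "P' * (P * M * Q) * Q' = (P' * P) * M * (Q * Q')"
      using M Pc Qc P'(2) Q'(2)
      by (simp add: assoc_mult_mat[of _ n n _ p _ p] assoc_mult_mat[of _ n n _ n _ p]
          assoc_mult_mat[of _ n p _ p _ p])
    then show ?thesis using M by (simp add: P'(4) Q'(3))
  qed
  define T where "T = {P * M * Q | M. M \<in> S}"
  have TA: "T = {P * A * Q + M | M. M \<in> {P * M * Q | M. M \<in> W}}"
  proof -
    have "P * (A + M) * Q = P * A * Q + P * M * Q" if "M \<in> W" for M
    proof -
      have "M \<in> carrier_mat n p" using WD(1) that by blast
      then show ?thesis using A Pc Qc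
        by (simp add: mult_add_distrib_mat[of _ n n _ p] add_mult_distrib_mat[of _ n p _ _ p])
    qed
    then show ?thesis unfolding T_def SA by (auto, metis)
  qed
  have "affine_subspace n p T"
    unfolding affine_subspace_def
  proof (intro bexI exI conjI)
    show "mat_subspace n p {P * M * Q | M. M \<in> W}" by (rule mat_subspace_equivalent[OF W Pc Qc])
    show "T = {P * A * Q + M | M. M \<in> {P * M * Q | M. M \<in> W}}" by (rule TA)
    show "P * A * Q \<in> carrier_mat n p" using A Pc Qc by simp
  qed
  moreover have Tsub: "T \<subseteq> compression_space n p s t" using comp by (auto simp: T_def)
  moreover have "mat_equivalent n p S T"
    unfolding mat_equivalent_def
  proof (intro conjI bexI[OF _ P'(1)] bexI[OF _ Q'(1)])
    show "S \<subseteq> carrier_mat n p" by (rule Sc)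
    show "T \<subseteq> carrier_mat n p" using Sc Pc Qc by (auto simp: T_def)
    have "{P' * N * Q' | N. N \<in> T} = {P' * (P * M * Q) * Q' | M. M \<in> S}" by (auto simp: T_def)
    also have "\<dots> = S" using restore Sc by (auto simp: subset_iff) metis
    finally show "S = {P' * N * Q' | N. N \<in> T}" by simp
  qed
  ultimately show "\<exists>T. affine_subspace n p T \<and> T \<subseteq> compression_space n p s t \<and> mat_equivalent n p S T"
    by blast
  define U where "U = {P' * M * Q' | M. M \<in> compression_space n p s t}"
  have C: "mat_subspace n p (compression_space n p s t :: 'a mat set)"
    by (rule mat_subspace_compression[OF st])
  have U: "mat_subspace n p U"
    unfolding U_def by (rule mat_subspace_equivalent[OF C P'(2) Q'(2)])
  moreover have "mat_equivalent n p U (compression_space n p s t)"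
    unfolding mat_equivalent_def
    by (intro conjI mat_subspaceD(1)[OF U] mat_subspaceD(1)[OF C]
        bexI[OF _ P'(1)] bexI[OF _ Q'(1)]) (rule U_def)
  moreover have "S \<subseteq> U"
  proof
    fix M assume M: "M \<in> S"
    then have "M = P' * (P * M * Q) * Q'" using restore[of M] Sc by auto
    then show "M \<in> U" unfolding U_def using comp[OF M] by blast
  qed
  ultimately show "r_decomposable n p (s + t) S"
    unfolding r_decomposable_def using st by blast
qed

text \<open>In echelon form the pivot of row \<open>i\<close> stands at column
  \<open>min i r\<close> or later, so the rows from \<open>r\<close> on are zero.\<close>

lemma echelon_vanishing_rows:
  fixes A :: "'a::field mat"
  assumes A: "A \<in> carrier_mat m r"
  obtains P where "P \<in> GL m" "\<And>i j. r \<le> i \<Longrightarrow> i < m \<Longrightarrow> j < r \<Longrightarrow> (P * A) $$ (i, j) = 0"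
proof -
  define C where "C = gauss_jordan_single A"
  note gj = gauss_jordan_single[OF A C_def[symmetric]]
  obtain P P' where P: "C = P * A" "P \<in> carrier_mat m m" "P' \<in> carrier_mat m m"
    "P * P' = 1\<^sub>m m" "P' * P = 1\<^sub>m m" using gj(4) by blast
  obtain f where f: "pivot_fun C f r" using gj(2,3) unfolding row_echelon_form_def by auto
  note piv = pivot_funD[OF _ f, of m]
  have dim: "dim_row C = m" using gj(2) by simp
  have ge: "min i r \<le> f i" if "i < m" for i
    using that
  proof (induction i)
    case (Suc i)
    then show ?case using piv(3)[OF dim, of i] by auto
  qed simp
  show ?thesis
  proof (rule that[OF GL_I[OF P(2-5)]])
    fix i j assume "r \<le> i" "i < m" "j < r"
    then show "(P * A) $$ (i, j) = 0"
      using piv(2)[OF dim, of i j] ge[of i] P(1) by simp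
  qed
qed

text \<open>The rows of \<open>P\<close> from \<open>r\<close> on lie in the common kernel of the
  forms \<open>\<phi> l\<close>; as \<open>P\<close> is invertible, they are part of a
  basis.\<close>

lemma kernel_form_compression:
  fixes \<phi> :: "nat \<Rightarrow> nat \<Rightarrow> 'a::field"
  obtains P where "P \<in> GL m" "\<And>i l. r \<le> i \<Longrightarrow> i < m \<Longrightarrow> l < r \<Longrightarrow> (\<Sum>j<m. \<phi> l j * P $$ (i, j)) = 0"
proof -
  let ?A = "mat m r (\<lambda>(j, l). \<phi> l j)"
  obtain P where P: "P \<in> GL m" "\<And>i j. r \<le> i \<Longrightarrow> i < m \<Longrightarrow> j < r \<Longrightarrow> (P * ?A) $$ (i, j) = 0"
    using echelon_vanishing_rows[of ?A m r] by auto
  have Pc: "P \<in> carrier_mat m m" using P(1) by (simp add: GL_def)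
  show ?thesis
  proof (rule that[OF P(1)])
    fix i l assume il: "r \<le> i" "i < m" "l < r"
    have "(P * ?A) $$ (i, l) = (\<Sum>j<m. P $$ (i, j) * \<phi> l j)"
      using il Pc by (simp add: scalar_prod_def lessThan_atLeast0)
    then show "(\<Sum>j<m. \<phi> l j * P $$ (i, j)) = 0" using P(2)[OF il] by (simp add: mult.commute)
  qed
qed

theorem theorem1p5:
  fixes n p r :: nat and S :: "'a::field mat set"
  assumes "n \<ge> p" and "p \<ge> r" and "r \<ge> 1"
    and "affine_subspace n p S"
    and "\<forall>A \<in> S. vec_space.rank n A \<le> r"
    and "int (affine_subspace_dim n p S) > int n * int r - (int n - int p + int r) + 1"
  shows "r_decomposable n p r S \<and>
    ((\<exists>T. affine_subspace n p T \<and> T \<subseteq> compression_space n p 0 r \<and> mat_equivalent n p S T) \<or>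
     (n = p \<and>
      (\<exists>T. affine_subspace n p T \<and> T \<subseteq> compression_space n p r 0 \<and> mat_equivalent n p S T)))"
proof -
  obtain A W where A: "A \<in> carrier_mat n p" and W: "mat_subspace n p W" and SA: "S = {A + M | M. M \<in> W}"
    using assms(4) unfolding affine_subspace_def by blast
  note WD = mat_subspaceD[OF W]
  have Sc: "S \<subseteq> carrier_mat n p" using A WD(1) unfolding SA by auto
  define V where "V = mat_fun n p ` W"
  define S' where "S' = mat_fun n p ` S"
  have entry: "mat_fun n p M i j = M $$ (i, j)" if "i < n" "j < p" for M i j
    using that by (simp add: mat_fun_def)
  have aff: "mat_space.affine_on S' V"
    unfolding mat_space.affine_on_def
  proof (intro conjI ballI)
    show "mat_space.subspace V" unfolding V_def by (rule subspace_mat_fun[OF W])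
    show "S' \<noteq> {}" using WD(2) by (auto simp: S'_def SA)
  next
    fix s v assume "s \<in> S'" "v \<in> V"
    then obtain M N where MN: "M \<in> W" "N \<in> W" "s = mat_fun n p (A + M)" "v = mat_fun n p N"
      by (auto simp: S'_def SA V_def)
    then have c: "M \<in> carrier_mat n p" "N \<in> carrier_mat n p" using WD(1) by auto
    have "s + v = mat_fun n p (A + (M + N))"
      using MN(3,4) c A by (simp add: mat_fun_add add.assoc)
    moreover have "A + (M + N) \<in> S" using WD(3) MN unfolding SA by blast
    ultimately show "s + v \<in> S'" by (simp add: S'_def)
  next
    fix s t assume "s \<in> S'" "t \<in> S'"
    then obtain M N where MN: "M \<in> W" "N \<in> W" "s = mat_fun n p (A + M)" "t = mat_fun n p (A + N)"
      by (auto simp: S'_def SA)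
    then have c: "M \<in> carrier_mat n p" "N \<in> carrier_mat n p" using WD(1) by auto
    have "s - t = mat_fun n p (M + (- 1) \<cdot>\<^sub>m N)"
      unfolding MN(3,4) using c A by (auto simp: mat_fun_def fun_eq_iff)
    moreover have "M + (- 1) \<cdot>\<^sub>m N \<in> W" using WD(3,4) MN by blast
    ultimately show "s - t \<in> V" by (simp add: V_def)
  qed
  have lin: "mat_space.linear_family (\<lambda>s. s)"
    by (simp add: mat_space.linear_family_def mat_space.linear_form_def)
  have rank: "rank_less {..<n} {..<p} (Suc r) s" if s: "s \<in> S'" for s
  proof -
    obtain M where M: "M \<in> S" "s = mat_fun n p M" using s by (auto simp: S'_def)
    have Mc: "M \<in> carrier_mat n p" using M(1) Sc by blast
    show ?thesis
      by (rule rank_less_of_rank[OF Mc]) (use assms(5) M entry in auto)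
  qed
  have "affine_subspace_dim n p S = mat_subspace_dim n p W"
    unfolding affine_subspace_dim_def SA translation_space_translate[OF A W] ..
  moreover have "int n * int r - (int n - int p + int r) + 1 = int ((n - 1) * (r - 1) + p)"
  proof -
    obtain m k where "n = Suc m" "r = Suc k"
      using assms(1-3) by (cases n; cases r) auto
    then show ?thesis by (simp add: algebra_simps)
  qed
  ultimately have dim: "(n - 1) * (r - 1) + p < mat_subspace_dim n p W" using assms(6) by linarith
  have null: "mat_space.null_space {..<n} {..<p} V (\<lambda>s. s) \<subseteq> {0}"
  proof
    fix v assume v: "v \<in> mat_space.null_space {..<n} {..<p} V (\<lambda>s. s)"
    then obtain M where "v = mat_fun n p M" by (auto simp: mat_space.null_space_def V_def)
    then show "v \<in> {0}" using v by (auto simp: mat_space.null_space_def mat_fun_def fun_eq_iff)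
  qed
  have "\<not> mat_space.codim_le V (mat_space.null_space {..<n} {..<p} V (\<lambda>s. s))
      ((card {..<n} - 1) * (r - 1) + card {..<p})"
  proof
    assume "mat_space.codim_le V (mat_space.null_space {..<n} {..<p} V (\<lambda>s. s))
      ((card {..<n} - 1) * (r - 1) + card {..<p})"
    then have "mat_space.codim_le V {0} ((n - 1) * (r - 1) + p)"
      using null by (elim mat_space.codim_le_mono) auto
    then show False using mat_subspace_dim_le[OF W] dim unfolding V_def by fastforce
  qed
  then have "mat_space.kernel_form {..<n} {..<p} r S' (\<lambda>s. s) \<or>
      n = p \<and> mat_space.kernel_form {..<p} {..<n} r S' (\<lambda>s i j. s j i)"
    using mat_space.large_affine_spaces[OF _ _ _ _ _ aff lin rank] assms(1-3) by simp
  then show ?thesis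
  proof
    assume "mat_space.kernel_form {..<n} {..<p} r S' (\<lambda>s. s)"
    then obtain \<phi> where \<phi>: "\<forall>z. (\<forall>l<r. (\<Sum>j<p. \<phi> l j * z j) = 0) \<longrightarrow>
        (\<forall>s\<in>S'. \<forall>i\<in>{..<n}. (\<Sum>j<p. s i j * z j) = 0)"
      by (rule mat_space.kernel_formE)
    obtain P where P: "P \<in> GL p" "\<And>i l. r \<le> i \<Longrightarrow> i < p \<Longrightarrow> l < r \<Longrightarrow> (\<Sum>j<p. \<phi> l j * P $$ (i, j)) = 0"
      using kernel_form_compression by blast
    have Pc: "P \<in> carrier_mat p p" using P(1) by (simp add: GL_def)
    obtain P' where P': "P' \<in> carrier_mat p p" "P * P' = 1\<^sub>m p" "P' * P = 1\<^sub>m p"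
      using GL_inverse[OF P(1)] by blast
    \<comment> \<open>The columns of \<open>P\<^sup>T\<close> from \<open>r\<close> on are common
      kernel vectors, which produce the zero columns.\<close>
    have Q: "P\<^sup>T \<in> GL p"
    proof (rule GL_I[of _ _ "P'\<^sup>T"])
      show "P\<^sup>T * P'\<^sup>T = 1\<^sub>m p"
        unfolding transpose_mult[OF P'(1) Pc, symmetric] P'(3) by simp
      show "P'\<^sup>T * P\<^sup>T = 1\<^sub>m p"
        unfolding transpose_mult[OF Pc P'(1), symmetric] P'(2) by simp
    qed (use Pc P' in auto)
    have comp: "1\<^sub>m n * M * P\<^sup>T \<in> compression_space n p 0 r" if M: "M \<in> S" for M
    proof -
      have Mc: "M \<in> carrier_mat n p" using M Sc by blast
      have "(M * P\<^sup>T) $$ (i, j) = 0" if ij: "i < n" "r \<le> j" "j < p" for i j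
      proof -
        have "(M * P\<^sup>T) $$ (i, j) = (\<Sum>k<p. mat_fun n p M i k * P $$ (j, k))"
          using ij Mc Pc by (simp add: scalar_prod_def lessThan_atLeast0 entry)
        also have "\<dots> = 0"
          using \<phi>[THEN spec, of "\<lambda>k. P $$ (j, k)"] P(2)[OF ij(2,3)] M ij by (simp add: S'_def)
        finally show ?thesis .
      qed
      then show ?thesis using Mc Pc assms(2) by (simp add: compression_space_iff)
    qed
    have one: "1\<^sub>m n \<in> GL n" by (rule GL_I[of _ _ "1\<^sub>m n"]) auto
    from equivalent_to_compression[OF assms(4) one Q _ assms(2) comp] show ?thesis by simp
  next
    assume *: "n = p \<and> mat_space.kernel_form {..<p} {..<n} r S' (\<lambda>s i j. s j i)"
    then have "mat_space.kernel_form {..<p} {..<n} r S' (\<lambda>s i j. s j i)" by blast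
    then obtain \<phi> where \<phi>: "\<forall>z. (\<forall>l<r. (\<Sum>j<n. \<phi> l j * z j) = 0) \<longrightarrow>
        (\<forall>s\<in>S'. \<forall>i\<in>{..<p}. (\<Sum>j<n. s j i * z j) = 0)"
      by (rule mat_space.kernel_formE)
    obtain P where P: "P \<in> GL n" "\<And>i l. r \<le> i \<Longrightarrow> i < n \<Longrightarrow> l < r \<Longrightarrow> (\<Sum>j<n. \<phi> l j * P $$ (i, j)) = 0"
      using kernel_form_compression by blast
    have Pc: "P \<in> carrier_mat n n" using P(1) by (simp add: GL_def)
    have rn: "r \<le> n" using assms(1,2) by simp
    have comp: "P * M * 1\<^sub>m p \<in> compression_space n p r 0" if M: "M \<in> S" for M
    proof -
      have Mc: "M \<in> carrier_mat n p" using M Sc by blast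
      have "(P * M) $$ (i, j) = 0" if ij: "r \<le> i" "i < n" "j < p" for i j
      proof -
        have "(P * M) $$ (i, j) = (\<Sum>k<n. mat_fun n p M k j * P $$ (i, k))"
          using ij Mc Pc by (simp add: scalar_prod_def lessThan_atLeast0 entry mult.commute)
        also have "\<dots> = 0"
          using \<phi>[THEN spec, of "\<lambda>k. P $$ (i, k)"] P(2)[OF ij(1,2)] M ij by (simp add: S'_def)
        finally show ?thesis .
      qed
      moreover have "P * M * 1\<^sub>m p = P * M" using Mc Pc by simp
      ultimately show ?thesis using Mc Pc rn by (simp add: compression_space_iff)
    qed
    have one: "1\<^sub>m p \<in> GL p" by (rule GL_I[of _ _ "1\<^sub>m p"]) auto
    from equivalent_to_compression[OF assms(4) P(1) one rn _ comp] * show ?thesis by simp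
  qed
qed

end
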